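(* Let $K$, $\mathcal K$, $G$, $\Sigma_1,\Sigma_2$ and the clusters $\mathcal I_j=[k_{2j+1},k_{2j}]\cap\mathbb Z$, $j=0,\ldots,q$, be as in the context. For any $\gamma_0,\ldots,\gamma_q\in\mathbb C$, we have $$\det\left(1-\sum_{j=0}^q\gamma_j1_{\mathcal I_j}\mathcal K\right)_{\ell^2(\mathbb Z)}=\det(1-\mathcal M)_{L^2(\Sigma_1\cup\Sigma_2)},$$ where $\mathcal M:L^2(\Sigma_1\cup\Sigma_2)\to L^2(\Sigma_1\cup\Sigma_2)$ has kernel $$M(z,z')=\frac{1_{\Sigma_2}(z')1_{\Sigma_1}(z)\sum_{j=0}^q\gamma_j\left(\left(\frac z{z'}\right)^{k_{2j+1}}-\left(\frac z{z'}\right)^{1+k_{2j}}\right)-1_{\Sigma_1}(z')1_{\Sigma_2}(z)G(z,z')}{2\pi i(z-z')}.$$ If $k_0=+\infty$, the term $\left(\frac z{z'}\right)^{1+k_0}$ is understood as $0$.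
   Context: Let $\Sigma_1$ be the unit circle in $\mathbb C$ and $\Sigma_2$ a simple closed curve outside the unit circle (contained in $\{|z|>1\}$), both positively oriented. Let $d\geq1$, $g_1,\ldots,g_d\in L^2(\Sigma_2)$, $h_1,\ldots,h_d\in L^2(\Sigma_1)$, $G(u,v)=\sum_{i=1}^dg_i(u)h_i(v)$, and $$K(n,n')=\frac1{(2\pi i)^2}\int_{\Sigma_2}du\int_{\Sigma_1}dv\,\frac{u^{-n-1}v^{n'}G(u,v)}{u-v},\qquad n,n'\in\mathbb Z.$$ $\mathcal K$ is the operator on sequences with kernel $K$, $\mathcal K[\sigma](n)=\sum_{n'\in\mathbb Z}K(n,n')\sigma(n')$; it is only used through the compositions $1_{\mathcal I_j}\mathcal K$, where $1_{\mathcal I_j}[\sigma](n)=\sigma(n)$ for $n\in\mathcal I_j$ and $0$ otherwise. Clusters: $q\geq0$ is an integer, $k_1,\ldots,k_{2q+1}\in\mathbb Z$, $k_0\in\mathbb Z\cup\{+\infty\}$, with $k_{2q+1}\leq k_{2q}<k_{2q-1}\leq\cdots\leq k_2<k_1\leq k_0\leq+\infty$. Fredholm determinants: for a trace-class operator $\mathcal T$ on $\ell^2(\mathbb Z)$ with kernel $T$, $\det(1+\mathcal T)_{\ell^2(\mathbb Z)}=1+\sum_{p\geq1}\frac1{p!}\sum_{n_1,\ldots,n_p\in\mathbb Z}\det(T(n_i,n_l))_{i,l=1}^p$; for a trace-class operator on $L^2(\Sigma)$ with kernel $T$ (acting by $f\mapsto\int_\Sigma T(\cdot,z')f(z')dz'$),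 $\det(1+\mathcal T)_{L^2(\Sigma)}=1+\sum_{p\geq1}\frac1{p!}\int_{\Sigma^p}\det(T(z_i,z_l))_{i,l=1}^p\prod_{l=1}^pdz_l$. The kernel $M(z,z')$ vanishes when $z,z'$ lie on the same contour. *)

theory Defs
  imports
    "HOL-Complex_Analysis.Complex_Analysis"
    "HOL-Library.Extended"
    "Jordan_Normal_Form.Determinant"
begin

section \<open>Contours and square-integrable functions on them\<close>

text \<open>
  A rectifiable simple closed curve, given by a Lipschitz parametrization over \<open>[0,1]\<close>. Every
  rectifiable closed Jordan curve has one (its constant-speed parametrization), so this is no
  restriction on the point set; all integrals below are independent of the choice of the
  parametrization, up to orientation. Lipschitz continuity ensures that
  \<open>vector_derivative\<close> exists almost everywhere and is bounded.
\<close>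

definition positively_oriented_contour :: "(real \<Rightarrow> complex) \<Rightarrow> bool" where
  "positively_oriented_contour c \<longleftrightarrow>
     simple_path c \<and> pathfinish c = pathstart c \<and> (\<exists>L. L-lipschitz_on {0..1} c) \<and>
     (\<forall>w\<in>inside (path_image c). winding_number c w = 1)"

definition velocity :: "(real \<Rightarrow> complex) \<Rightarrow> real \<Rightarrow> complex" where
  "velocity c t = vector_derivative c (at t within {0..1})"

definition arc_length_measure :: "(real \<Rightarrow> complex) \<Rightarrow> complex measure" where
  "arc_length_measure c =
     distr (density (lebesgue_on {0..1}) (\<lambda>t. ennreal (norm (velocity c t))))
       (restrict_space borel (path_image c)) c"

text \<open>
  Elements of \<open>L\<^sup>2\<close> of a contour are represented by Borel functions; values off the contour are
  irrelevant.
\<close>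

definition L2_on :: "(real \<Rightarrow> complex) \<Rightarrow> (complex \<Rightarrow> complex) set" where
  "L2_on c = {f \<in> borel_measurable (arc_length_measure c).
     integrable (arc_length_measure c) (\<lambda>z. (norm (f z))\<^sup>2)}"


section \<open>The operator on sequences\<close>

definition finite_rank_symbol ::
  "nat \<Rightarrow> (nat \<Rightarrow> complex \<Rightarrow> complex) \<Rightarrow> (nat \<Rightarrow> complex \<Rightarrow> complex) \<Rightarrow>
   complex \<Rightarrow> complex \<Rightarrow> complex" where
  "finite_rank_symbol d g h u v = (\<Sum>i=1..d. g i u * h i v)"

definition K_kernel ::
  "(real \<Rightarrow> complex) \<Rightarrow> (real \<Rightarrow> complex) \<Rightarrow> (complex \<Rightarrow> complex \<Rightarrow> complex) \<Rightarrow>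
   int \<Rightarrow> int \<Rightarrow> complex" where
  "K_kernel c1 c2 G n n' =
     1 / (2 * of_real pi * \<i>)\<^sup>2 *
     contour_integral c2 (\<lambda>u. contour_integral c1 (\<lambda>v.
       u powi (- n - 1) * v powi n' * G u v / (u - v)))"

type_synonym seq_operator = "(int \<Rightarrow> complex) \<Rightarrow> (int \<Rightarrow> complex)"

definition kernel_operator :: "(int \<Rightarrow> int \<Rightarrow> complex) \<Rightarrow> seq_operator" where
  "kernel_operator T \<sigma> n = (\<Sum>\<^sub>\<infinity>n'\<in>UNIV. T n n' * \<sigma> n')"

definition restrict_seq :: "int set \<Rightarrow> seq_operator" where
  "restrict_seq I \<sigma> n = (if n \<in> I then \<sigma> n else 0)"

definition kernel_of :: "seq_operator \<Rightarrow> int \<Rightarrow> int \<Rightarrow> complex" where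
  "kernel_of T n n' = T (\<lambda>m. if m = n' then 1 else 0) n"


section \<open>Clusters\<close>

text \<open>The endpoints are extended integers only because \<open>k 0\<close> may be \<open>+\<infinity>\<close>.\<close>

definition cluster_endpoints :: "nat \<Rightarrow> (nat \<Rightarrow> int extended) \<Rightarrow> bool" where
  "cluster_endpoints q k \<longleftrightarrow>
     k 0 \<in> range Fin \<union> {Pinf} \<and>
     (\<forall>i\<in>{1..2*q+1}. k i \<in> range Fin) \<and>
     (\<forall>j\<in>{0..q}. k (2*j+1) \<le> k (2*j)) \<and>
     (\<forall>j\<in>{1..q}. k (2*j) < k (2*j-1))"

definition cluster :: "(nat \<Rightarrow> int extended) \<Rightarrow> nat \<Rightarrow> int set" where
  "cluster k j = {n. k (2*j+1) \<le> Fin n \<and> Fin n \<le> k (2*j)}"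

text \<open>
  The power with exponent \<open>+\<infinity>\<close> is \<open>0\<close>; it occurs only for bases of modulus less than 1.
  Exponent \<open>-\<infinity>\<close> does not occur.
\<close>

fun ext_powi :: "complex \<Rightarrow> int extended \<Rightarrow> complex" where
  "ext_powi w (Fin m) = w powi m"
| "ext_powi w Pinf = 0"
| "ext_powi w Minf = 0"


section \<open>Fredholm determinants\<close>

definition kernel_det :: "('a \<Rightarrow> 'a \<Rightarrow> complex) \<Rightarrow> nat \<Rightarrow> (nat \<Rightarrow> 'a) \<Rightarrow> complex" where
  "kernel_det T p x = Determinant.det (mat p p (\<lambda>(i, l). T (x i) (x l)))"

definition fredholm_term_seq :: "seq_operator \<Rightarrow> nat \<Rightarrow> complex" where
  "fredholm_term_seq T p =
     1 / fact p * (\<Sum>\<^sub>\<infinity>n\<in>{..<p} \<rightarrow>\<^sub>E UNIV. kernel_det (kernel_of T) p n)"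

definition fredholm_converges_seq :: "seq_operator \<Rightarrow> bool" where
  "fredholm_converges_seq T \<longleftrightarrow>
     (\<forall>p\<ge>1. kernel_det (kernel_of T) p summable_on ({..<p} \<rightarrow>\<^sub>E UNIV)) \<and>
     fredholm_term_seq T summable_on {1..}"

text \<open>The determinant \<open>det (1 + T)\<close> on \<open>\<ell>\<^sup>2(\<int>)\<close>.\<close>

definition fredholm_det_seq :: "seq_operator \<Rightarrow> complex" where
  "fredholm_det_seq T = 1 + (\<Sum>\<^sub>\<infinity>p\<in>{1..}. fredholm_term_seq T p)"

text \<open>
  A union of contours \<open>c j\<close>, \<open>j \<in> J\<close>, is parametrized by the pairs \<open>(j, t)\<close> with \<open>t \<in> [0,1]\<close>;
  the complex line element is \<open>dz = velocity (c j) t dt\<close>. Integrals over the \<open>p\<close>-th power of the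
  union become Lebesgue integrals over the \<open>p\<close>-th power of this parameter space.
\<close>

definition contour_parameters :: "'j set \<Rightarrow> ('j \<times> real) measure" where
  "contour_parameters J = count_space J \<Otimes>\<^sub>M lebesgue_on {0..1}"

definition contour_power :: "'j set \<Rightarrow> nat \<Rightarrow> (nat \<Rightarrow> 'j \<times> real) measure" where
  "contour_power J p = (\<Pi>\<^sub>M l\<in>{..<p}. contour_parameters J)"

definition kernel_det_form ::
  "('j \<Rightarrow> real \<Rightarrow> complex) \<Rightarrow> (complex \<Rightarrow> complex \<Rightarrow> complex) \<Rightarrow> nat \<Rightarrow>
   (nat \<Rightarrow> 'j \<times> real) \<Rightarrow> complex" where
  "kernel_det_form c T p x =
     kernel_det T p (\<lambda>l. c (fst (x l)) (snd (x l))) *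
     (\<Prod>l<p. velocity (c (fst (x l))) (snd (x l)))"

definition fredholm_term_contours ::
  "('j \<Rightarrow> real \<Rightarrow> complex) \<Rightarrow> 'j set \<Rightarrow> (complex \<Rightarrow> complex \<Rightarrow> complex) \<Rightarrow> nat \<Rightarrow> complex" where
  "fredholm_term_contours c J T p =
     1 / fact p * integral\<^sup>L (contour_power J p) (kernel_det_form c T p)"

definition fredholm_converges_contours ::
  "('j \<Rightarrow> real \<Rightarrow> complex) \<Rightarrow> 'j set \<Rightarrow> (complex \<Rightarrow> complex \<Rightarrow> complex) \<Rightarrow> bool" where
  "fredholm_converges_contours c J T \<longleftrightarrow>
     (\<forall>p\<ge>1. integrable (contour_power J p) (kernel_det_form c T p)) \<and>
     fredholm_term_contours c J T summable_on {1..}"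

text \<open>The determinant \<open>det (1 + T)\<close> on \<open>L\<^sup>2\<close> of the union of the contours.\<close>

definition fredholm_det_contours ::
  "('j \<Rightarrow> real \<Rightarrow> complex) \<Rightarrow> 'j set \<Rightarrow> (complex \<Rightarrow> complex \<Rightarrow> complex) \<Rightarrow> complex" where
  "fredholm_det_contours c J T = 1 + (\<Sum>\<^sub>\<infinity>p\<in>{1..}. fredholm_term_contours c J T p)"

definition M_kernel ::
  "complex set \<Rightarrow> complex set \<Rightarrow> (complex \<Rightarrow> complex \<Rightarrow> complex) \<Rightarrow> nat \<Rightarrow>
   (nat \<Rightarrow> int extended) \<Rightarrow> (nat \<Rightarrow> complex) \<Rightarrow> complex \<Rightarrow> complex \<Rightarrow> complex" where
  "M_kernel S1 S2 G q k \<gamma> z z' =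
     (indicator S2 z' * indicator S1 z *
        (\<Sum>j=0..q. \<gamma> j * (ext_powi (z / z') (k (2*j+1)) - ext_powi (z / z') (1 + k (2*j))))
      - indicator S1 z' * indicator S2 z * G z z')
     / (2 * of_real pi * \<i> * (z - z'))"

end

theory Submission
  imports Defs
begin

text \<open>
  Both determinants are determinants of compositions of the same three kernels. Write
  \<open>\<Gamma> n\<close> for the sum of the \<open>\<gamma> j\<close> over the clusters containing \<open>n\<close>. For \<open>v\<close> on the circle and
  \<open>u\<close> on the outer contour we have \<open>\<bar>v / u\<bar> < 1\<close>, and a geometric series identifies the part of
  \<open>- M\<close> that maps from the outer contour to the circle with \<open>\<Sum>n. \<Gamma> n * v powi n * u powi (- n - 1)\<close>,
  up to the factor \<open>1 / (2 * pi * \<i>)\<close> (\<open>cluster_coefficient_has_sum\<close>). So \<open>- M = A + B D\<close>, where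
  \<open>A\<close> is the kernel \<open>G u v / (2 * pi * \<i> * (u - v))\<close>, \<open>B\<close> is \<open>v powi n / (2 * pi * \<i>)\<close> and \<open>D\<close> is
  \<open>\<Gamma> n * u powi (- n - 1)\<close>, while \<open>\<Gamma> n * K n n'\<close> is the kernel of \<open>D A B\<close> by the definition of \<open>K\<close>.

  The kernel \<open>M\<close> is off-diagonal: it maps functions on either contour to functions on the other.
  Formally, \<open>det (1 + A + B D) = det (1 - A B D)\<close> by a Schur complement, and
  \<open>det (1 - A B D) = det (1 - D A B)\<close> by cyclicity. Both identities are proved here term by term in
  the Fredholm series, from the Leibniz expansion of the minors.

  Cyclicity (\<open>minor_integral_commute\<close>) follows from Fubini's theorem, since the integral belonging
  to a permutation is symmetric in the two sets of variables. For the off-diagonal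
  kernel (\<open>minor_integral_off_diagonal\<close>) only those permutations contribute that exchange the
  variables on one contour with those on the other. Hence terms of odd order vanish, and in order
  \<open>2 m\<close> a permutation is essentially a pair of permutations of \<open>m\<close> variables, whose composition is
  the permutation that survives after half of the variables have been integrated out. So the term of
  order \<open>2 m\<close> for the contours is the term of order \<open>m\<close> for the sequences.

  All integrals converge absolutely because every kernel is dominated by a product
  \<open>\<phi> x * \<psi> y\<close> such that \<open>\<phi> x * \<psi> x\<close> is integrable: in a term of the Leibniz expansion every variable
  occurs once as a row and once as a column. The series over \<open>p\<close> converges because row \<open>n\<close> of the
  sequence kernel is of size \<open>\<rho> ^ n\<close> with \<open>\<rho> < 1\<close>, and the rows of a nonzero minor are distinct
  (\<open>minor_integral_geometric_rows_bound\<close>). By the equality of the terms this also settles the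
  convergence of the series for the contours.
\<close>

section \<open>Integrals of minors\<close>

text \<open>
  Minors arise with rows indexed by an arbitrary subset of the variables, so the index set is an
  arbitrary finite set rather than an initial segment of the natural numbers.
\<close>

definition leibniz_det :: "'i set \<Rightarrow> ('a \<Rightarrow> 'a \<Rightarrow> complex) \<Rightarrow> ('i \<Rightarrow> 'a) \<Rightarrow> complex" where
  "leibniz_det I P x = (\<Sum>\<sigma> | \<sigma> permutes I. of_int (sign \<sigma>) * (\<Prod>i\<in>I. P (x i) (x (\<sigma> i))))"

text \<open>
  For an index set with \<open>p\<close> elements this is \<open>p!\<close> times the coefficient of order \<open>p\<close> in the
  Fredholm series of \<open>P\<close>.
\<close>

definition minor_integral :: "'a measure \<Rightarrow> 'i set \<Rightarrow> ('a \<Rightarrow> 'a \<Rightarrow> complex) \<Rightarrow> complex" where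
  "minor_integral \<mu> I P = (\<integral>x. leibniz_det I P x \<partial>PiM I (\<lambda>_. \<mu>))"

lemma kernel_det_eq_leibniz_det: "kernel_det T p x = leibniz_det {..<p} T x"
proof -
  have "(\<Prod>i = 0..<p. mat p p (\<lambda>(i, l). T (x i) (x l)) $$ (i, \<sigma> i))
      = (\<Prod>i<p. T (x i) (x (\<sigma> i)))" if "\<sigma> permutes {0..<p}" for \<sigma>
  proof (rule prod.cong)
    fix i assume "i \<in> {..<p}"
    moreover from this have "\<sigma> i \<in> {0..<p}"
      using permutes_in_image[OF that, of i] by simp
    ultimately show "mat p p (\<lambda>(i, l). T (x i) (x l)) $$ (i, \<sigma> i) = T (x i) (x (\<sigma> i))"
      by simp
  qed auto
  then show ?thesis
    unfolding kernel_det_def leibniz_det_def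
    by (subst det_def'[of _ p]) (auto intro!: sum.cong simp: atLeast0LessThan)
qed

text \<open>
  In a product along a permutation every variable occurs once as a row and once as a column.
  Therefore the majorant of the product can be regrouped into a product of functions of a single
  variable each. The kernels may depend on the row, which is used for products that mix two kernels.
\<close>

lemma dominated_product_integrable:
  fixes P :: "'i \<Rightarrow> 'a \<Rightarrow> 'a \<Rightarrow> complex" and \<phi> \<psi> :: "'a \<Rightarrow> real"
  assumes "sigma_finite_measure \<mu>" and I: "finite I" and \<sigma>: "\<sigma> permutes I"
    and meas: "\<And>i. i \<in> I \<Longrightarrow> case_prod (P i) \<in> borel_measurable (\<mu> \<Otimes>\<^sub>M \<mu>)"
    and bound: "\<And>i x y. i \<in> I \<Longrightarrow> x \<in> space \<mu> \<Longrightarrow> y \<in> space \<mu> \<Longrightarrow> norm (P i x y) \<le> \<phi> x * \<psi> y"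
    and int: "integrable \<mu> (\<lambda>x. \<phi> x * \<psi> x)"
  shows "integrable (PiM I (\<lambda>_. \<mu>)) (\<lambda>x. \<Prod>i\<in>I. P i (x i) (x (\<sigma> i)))"
proof -
  interpret sigma_finite_measure \<mu> by fact
  interpret product_sigma_finite "\<lambda>_. \<mu>" ..
  have \<sigma>I: "\<sigma> i \<in> I" if "i \<in> I" for i
    using that permutes_in_image[OF \<sigma>] by simp
  have m: "(\<lambda>x. \<Prod>i\<in>I. P i (x i) (x (\<sigma> i))) \<in> borel_measurable (PiM I (\<lambda>_. \<mu>))"
  proof (rule borel_measurable_prod)
    fix i assume i: "i \<in> I"
    have "(\<lambda>x. (x i, x (\<sigma> i))) \<in> PiM I (\<lambda>_. \<mu>) \<rightarrow>\<^sub>M \<mu> \<Otimes>\<^sub>M \<mu>"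
      using i \<sigma>I by measurable
    from measurable_compose[OF this meas[OF i]]
    show "(\<lambda>x. P i (x i) (x (\<sigma> i))) \<in> borel_measurable (PiM I (\<lambda>_. \<mu>))" by simp
  qed
  show ?thesis
  proof (rule Bochner_Integration.integrable_bound[OF _ m])
    show "integrable (PiM I (\<lambda>_. \<mu>)) (\<lambda>x. \<Prod>i\<in>I. \<phi> (x i) * \<psi> (x i))"
      by (intro product_integrable_prod I int)
    show "AE x in PiM I (\<lambda>_. \<mu>). norm (\<Prod>i\<in>I. P i (x i) (x (\<sigma> i))) \<le> norm (\<Prod>i\<in>I. \<phi> (x i) * \<psi> (x i))"
    proof (rule AE_I2)
      fix x assume "x \<in> space (PiM I (\<lambda>_. \<mu>))"
      then have x: "x i \<in> space \<mu>" if "i \<in> I" for i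
        using that by (auto simp: space_PiM)
      have "norm (\<Prod>i\<in>I. P i (x i) (x (\<sigma> i))) \<le> (\<Prod>i\<in>I. \<phi> (x i) * \<psi> (x (\<sigma> i)))"
        unfolding prod_norm[symmetric] by (intro prod_mono conjI norm_ge_zero bound x \<sigma>I)
      also have "\<dots> = (\<Prod>i\<in>I. \<phi> (x i)) * (\<Prod>i\<in>I. \<psi> (x i))"
        using prod.permute[OF \<sigma>, of "\<lambda>i. \<psi> (x i)"] by (simp add: prod.distrib o_def)
      finally show "norm (\<Prod>i\<in>I. P i (x i) (x (\<sigma> i))) \<le> norm (\<Prod>i\<in>I. \<phi> (x i) * \<psi> (x i))"
        by (simp add: prod.distrib)
    qed
  qed
qed

lemma leibniz_det_integrable:
  fixes P :: "'a \<Rightarrow> 'a \<Rightarrow> complex" and \<phi> \<psi> :: "'a \<Rightarrow> real"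
  assumes "sigma_finite_measure \<mu>" and "finite I"
    and "case_prod P \<in> borel_measurable (\<mu> \<Otimes>\<^sub>M \<mu>)"
    and "\<And>x y. x \<in> space \<mu> \<Longrightarrow> y \<in> space \<mu> \<Longrightarrow> norm (P x y) \<le> \<phi> x * \<psi> y"
    and "integrable \<mu> (\<lambda>x. \<phi> x * \<psi> x)"
  shows "integrable (PiM I (\<lambda>_. \<mu>)) (leibniz_det I P)"
  unfolding leibniz_det_def [abs_def]
  by (intro Bochner_Integration.integrable_sum integrable_mult_right
      dominated_product_integrable[where \<phi> = \<phi> and \<psi> = \<psi>]) (use assms in auto)

lemma minor_integral_eq_sum:
  fixes P :: "'a \<Rightarrow> 'a \<Rightarrow> complex" and \<phi> \<psi> :: "'a \<Rightarrow> real"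
  assumes "sigma_finite_measure \<mu>" and "finite I"
    and "case_prod P \<in> borel_measurable (\<mu> \<Otimes>\<^sub>M \<mu>)"
    and "\<And>x y. x \<in> space \<mu> \<Longrightarrow> y \<in> space \<mu> \<Longrightarrow> norm (P x y) \<le> \<phi> x * \<psi> y"
    and "integrable \<mu> (\<lambda>x. \<phi> x * \<psi> x)"
  shows "minor_integral \<mu> I P = (\<Sum>\<sigma> | \<sigma> permutes I. of_int (sign \<sigma>) *
    (\<integral>x. (\<Prod>i\<in>I. P (x i) (x (\<sigma> i))) \<partial>PiM I (\<lambda>_. \<mu>)))"
  unfolding leibniz_det_def [abs_def] minor_integral_def
  by (subst Bochner_Integration.integral_sum; (intro integrable_mult_right)?;
      (intro dominated_product_integrable[where \<phi> = \<phi> and \<psi> = \<psi>])?)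
     (use assms in auto)

text \<open>
  A bijection of the index sets transports the product measure and conjugates the permutations;
  conjugation preserves signs. Hence only the number of rows matters.
\<close>

lemma minor_integral_reindex:
  fixes P :: "'a \<Rightarrow> 'a \<Rightarrow> complex"
  assumes "sigma_finite_measure \<mu>" and I: "finite I" and e: "bij_betw e I J"
    and meas: "case_prod P \<in> borel_measurable (\<mu> \<Otimes>\<^sub>M \<mu>)"
  shows "minor_integral \<mu> J P = minor_integral \<mu> I P"
proof -
  interpret sigma_finite_measure \<mu> by fact
  interpret product_sigma_finite "\<lambda>_. \<mu>" ..
  have J: "finite J" using bij_betw_finite[OF e] I by simp
  have eI: "e i \<in> J" if "i \<in> I" for i using e that by (auto simp: bij_betw_def)
  define R where "R x = (\<lambda>i\<in>I. x (e i))" for x :: "'c \<Rightarrow> 'a"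
  have R: "R \<in> PiM J (\<lambda>_. \<mu>) \<rightarrow>\<^sub>M PiM I (\<lambda>_. \<mu>)"
    unfolding R_def using eI by measurable
  have "distr (PiM J (\<lambda>_. \<mu>)) (PiM I (\<lambda>_. \<mu>)) R = PiM I (\<lambda>_. \<mu>)"
  proof (rule PiM_eqI[OF I])
    fix A assume A: "\<And>i. i \<in> I \<Longrightarrow> A i \<in> sets \<mu>"
    define B where "B j = A (the_inv_into I e j)" for j
    have inv: "the_inv_into I e j \<in> I" if "j \<in> J" for j
      using that e by (metis bij_betw_def bij_betw_the_inv_into imageI)
    have Be: "B (e i) = A i" if "i \<in> I" for i
      using that e by (simp add: B_def the_inv_into_f_f bij_betw_def)
    have "x \<in> R -` Pi\<^sub>E I A \<inter> space (PiM J (\<lambda>_. \<mu>)) \<longleftrightarrow> x \<in> Pi\<^sub>E J B" for x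
    proof -
      have "(\<forall>i\<in>I. x (e i) \<in> A i) \<longleftrightarrow> (\<forall>j\<in>J. x j \<in> B j)"
        using e Be by (auto simp: bij_betw_def)
      moreover have "x j \<in> space \<mu>" if "\<forall>j\<in>J. x j \<in> B j" "j \<in> J" for j
        using that A[OF inv[of j]] sets.sets_into_space unfolding B_def by blast
      ultimately show ?thesis
        by (auto simp: R_def space_PiM PiE_iff)
    qed
    then have "R -` Pi\<^sub>E I A \<inter> space (PiM J (\<lambda>_. \<mu>)) = Pi\<^sub>E J B" by blast
    then have "emeasure (distr (PiM J (\<lambda>_. \<mu>)) (PiM I (\<lambda>_. \<mu>)) R) (Pi\<^sub>E I A)
        = emeasure (PiM J (\<lambda>_. \<mu>)) (Pi\<^sub>E J B)"
      using A I R by (subst emeasure_distr) auto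
    also have "\<dots> = (\<Prod>j\<in>J. emeasure \<mu> (B j))"
      using J A inv by (subst emeasure_PiM) (auto simp: B_def)
    also have "\<dots> = (\<Prod>i\<in>I. emeasure \<mu> (A i))"
      using prod.reindex_bij_betw[OF e, of "\<lambda>j. emeasure \<mu> (B j)"] Be by simp
    finally show "emeasure (distr (PiM J (\<lambda>_. \<mu>)) (PiM I (\<lambda>_. \<mu>)) R) (Pi\<^sub>E I A)
        = (\<Prod>i\<in>I. emeasure \<mu> (A i))" .
  qed simp
  note distr = this
  have L: "leibniz_det I P (R x) = leibniz_det J P x" for x
  proof -
    have perm: "bij_betw (map_permutation I e) {\<sigma>. \<sigma> permutes I} {\<tau>. \<tau> permutes J}"
    proof -
      have "map_permutation I e = (\<lambda>\<pi> j. if j \<in> J then e (\<pi> (inv_into I e j)) else j)"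
        using e by (auto simp: map_permutation_def restrict_id_def bij_betw_def fun_eq_iff)
      then show ?thesis
        using bij_betw_permutations[OF e] by simp
    qed
    have "leibniz_det J P x = (\<Sum>\<sigma> | \<sigma> permutes I. of_int (sign (map_permutation I e \<sigma>)) *
        (\<Prod>i\<in>J. P (x i) (x (map_permutation I e \<sigma> i))))"
      unfolding leibniz_det_def
      by (rule sum.reindex_bij_betw[OF perm, symmetric,
          where g = "\<lambda>\<tau>. of_int (sign \<tau>) * (\<Prod>i\<in>J. P (x i) (x (\<tau> i)))"])
    also have "\<dots> = leibniz_det I P (R x)"
      unfolding leibniz_det_def
    proof (intro sum.cong refl)
      fix \<sigma> assume "\<sigma> \<in> {\<sigma>. \<sigma> permutes I}"
      then have \<sigma>: "\<sigma> permutes I" by simp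
      have "(\<Prod>i\<in>J. P (x i) (x (map_permutation I e \<sigma> i))) =
          (\<Prod>i\<in>I. P (x (e i)) (x (map_permutation I e \<sigma> (e i))))"
        using prod.reindex_bij_betw[OF e] by (rule sym)
      also have "\<dots> = (\<Prod>i\<in>I. P (R x i) (R x (\<sigma> i)))"
        using e permutes_in_image[OF \<sigma>]
        by (intro prod.cong) (auto simp: map_permutation_apply R_def bij_betw_def)
      finally show "of_int (sign (map_permutation I e \<sigma>)) *
        (\<Prod>i\<in>J. P (x i) (x (map_permutation I e \<sigma> i))) =
        (of_int (sign \<sigma>) :: complex) * (\<Prod>i\<in>I. P (R x i) (R x (\<sigma> i)))"
        using sign_map_permutation[of e I \<sigma>] I e \<sigma> by (simp add: bij_betw_def)
    qed
    finally show ?thesis by simp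
  qed
  have m: "leibniz_det I P \<in> borel_measurable (PiM I (\<lambda>_. \<mu>))"
  proof -
    have "(\<lambda>x. P (x i) (x (\<sigma> i))) \<in> borel_measurable (PiM I (\<lambda>_. \<mu>))"
      if "i \<in> I" "\<sigma> permutes I" for i \<sigma>
    proof -
      have \<sigma>I: "\<sigma> i \<in> I"
        using that permutes_in_image by fastforce
      have "(\<lambda>x. (x i, x (\<sigma> i))) \<in> PiM I (\<lambda>_. \<mu>) \<rightarrow>\<^sub>M \<mu> \<Otimes>\<^sub>M \<mu>"
        using that \<sigma>I by measurable
      from measurable_compose[OF this meas] show ?thesis by simp
    qed
    then show ?thesis
      unfolding leibniz_det_def [abs_def]
      by (intro borel_measurable_sum borel_measurable_times borel_measurable_prod) auto
  qed
  have "minor_integral \<mu> I P = integral\<^sup>L (distr (PiM J (\<lambda>_. \<mu>)) (PiM I (\<lambda>_. \<mu>)) R) (leibniz_det I P)"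
    unfolding distr minor_integral_def ..
  also have "\<dots> = minor_integral \<mu> J P"
    using R m by (subst integral_distr) (simp_all add: L minor_integral_def)
  finally show ?thesis by simp
qed

lemma leibniz_det_uminus:
  "leibniz_det I (\<lambda>x y. - P x y) x = (-1) ^ card I * leibniz_det I P x"
proof -
  have "(\<Prod>i\<in>I. - P (x i) (x (\<sigma> i))) = (-1) ^ card I * (\<Prod>i\<in>I. P (x i) (x (\<sigma> i)))" for \<sigma>
    using prod.distrib[of "\<lambda>_. - 1" "\<lambda>i. P (x i) (x (\<sigma> i))" I] by simp
  then show ?thesis
    unfolding leibniz_det_def by (simp add: sum_distrib_left mult_ac)
qed

lemma leibniz_det_eq_0_if_not_injective:
  fixes p :: nat
  assumes "\<not> inj_on x {..<p}"
  shows "leibniz_det {..<p} T x = 0"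
proof -
  from assms obtain i j where ij: "i < p" "j < p" "i \<noteq> j" "x i = x j"
    by (auto simp: inj_on_def)
  have "kernel_det T p x = 0"
    unfolding kernel_det_def
    by (rule det_identical_rows[of _ p i j]) (use ij in \<open>auto intro!: eq_vecI\<close>)
  then show ?thesis by (simp add: kernel_det_eq_leibniz_det)
qed

lemma minor_integral_cong:
  fixes \<mu> :: "'a measure" and I :: "'i set"
  assumes I: "finite I" and PQ: "\<And>x y. x \<in> space \<mu> \<Longrightarrow> y \<in> space \<mu> \<Longrightarrow> P x y = Q x y"
  shows "minor_integral \<mu> I P = minor_integral \<mu> I Q"
  unfolding minor_integral_def leibniz_det_def
proof (intro Bochner_Integration.integral_cong refl sum.cong arg_cong2[where f = "(*)"] prod.cong)
  fix x :: "'i \<Rightarrow> 'a" and \<sigma> i assume "x \<in> space (PiM I (\<lambda>_. \<mu>))" "\<sigma> \<in> {\<sigma>. \<sigma> permutes I}" "i \<in> I"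
  then show "P (x i) (x (\<sigma> i)) = Q (x i) (x (\<sigma> i))"
    using permutes_in_image[of \<sigma> I i] by (intro PQ) (auto simp: space_PiM PiE_iff)
qed

section \<open>Composition of kernels\<close>

lemma integrable_tensor_product:
  fixes \<alpha> :: "'a \<Rightarrow> real" and \<beta> :: "'b \<Rightarrow> real"
  assumes "sigma_finite_measure \<mu>" "sigma_finite_measure \<nu>"
    and \<alpha>: "integrable \<mu> \<alpha>" and \<beta>: "integrable \<nu> \<beta>"
  shows "integrable (\<mu> \<Otimes>\<^sub>M \<nu>) (\<lambda>(x, y). \<alpha> x * \<beta> y)"
proof -
  interpret \<mu>: sigma_finite_measure \<mu> by fact
  interpret \<nu>: sigma_finite_measure \<nu> by fact
  interpret pair_sigma_finite \<mu> \<nu> ..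
  note [measurable] = borel_measurable_integrable[OF \<alpha>] borel_measurable_integrable[OF \<beta>]
  show ?thesis
  proof (rule Fubini_integrable)
    show "(\<lambda>(x, y). \<alpha> x * \<beta> y) \<in> borel_measurable (\<mu> \<Otimes>\<^sub>M \<nu>)" by measurable
  qed (use \<alpha> \<beta> in \<open>auto simp: abs_mult\<close>)
qed

definition kernel_comp ::
  "'b measure \<Rightarrow> ('a \<Rightarrow> 'b \<Rightarrow> complex) \<Rightarrow> ('b \<Rightarrow> 'c \<Rightarrow> complex) \<Rightarrow> 'a \<Rightarrow> 'c \<Rightarrow> complex" where
  "kernel_comp \<nu> A B x z = (\<integral>y. A x y * B y z \<partial>\<nu>)"

lemma kernel_comp_measurable:
  assumes "sigma_finite_measure \<nu>"
    and [measurable]: "case_prod A \<in> borel_measurable (\<mu> \<Otimes>\<^sub>M \<nu>)" "case_prod B \<in> borel_measurable (\<nu> \<Otimes>\<^sub>M \<rho>)"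
  shows "case_prod (kernel_comp \<nu> A B) \<in> borel_measurable (\<mu> \<Otimes>\<^sub>M \<rho>)"
proof -
  interpret sigma_finite_measure \<nu> by fact
  have "(\<lambda>p. \<integral>y. A (fst p) y * B y (snd p) \<partial>\<nu>) \<in> borel_measurable (\<mu> \<Otimes>\<^sub>M \<rho>)"
    by measurable
  then show ?thesis
    by (simp add: kernel_comp_def case_prod_beta')
qed

text \<open>
  The second part shows that compositions inherit a majorant in product form, so that all results
  for dominated kernels apply to them again.
\<close>

lemma kernel_product_integrable:
  fixes A :: "'a \<Rightarrow> 'b \<Rightarrow> complex" and B :: "'b \<Rightarrow> 'c \<Rightarrow> complex"
  assumes mA: "case_prod A \<in> borel_measurable (\<mu> \<Otimes>\<^sub>M \<nu>)"
    and mB: "case_prod B \<in> borel_measurable (\<nu> \<Otimes>\<^sub>M \<rho>)"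
    and bA: "\<And>x y. x \<in> space \<mu> \<Longrightarrow> y \<in> space \<nu> \<Longrightarrow> norm (A x y) \<le> a1 x * a2 y"
    and bB: "\<And>y z. y \<in> space \<nu> \<Longrightarrow> z \<in> space \<rho> \<Longrightarrow> norm (B y z) \<le> b1 y * b2 z"
    and int: "integrable \<nu> (\<lambda>y. a2 y * b1 y)"
    and x: "x \<in> space \<mu>" and z: "z \<in> space \<rho>"
  shows "integrable \<nu> (\<lambda>y. A x y * B y z)"
    and "norm (kernel_comp \<nu> A B x z) \<le> (integral\<^sup>L \<nu> (\<lambda>y. a2 y * b1 y) * a1 x) * b2 z"
proof -
  have [measurable]: "(\<lambda>y. A x y) \<in> borel_measurable \<nu>" "(\<lambda>y. B y z) \<in> borel_measurable \<nu>"
    using measurable_compose[OF measurable_Pair1'[OF x] mA] measurable_compose[OF measurable_Pair2'[OF z] mB]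
    by simp_all
  have bnd: "norm (A x y * B y z) \<le> (a1 x * b2 z) * (a2 y * b1 y)" if "y \<in> space \<nu>" for y
  proof -
    have "norm (A x y * B y z) \<le> (a1 x * a2 y) * (b1 y * b2 z)"
      unfolding norm_mult using bA[OF x that] bB[OF that z]
      by (intro mult_mono) (auto intro: order_trans[OF norm_ge_zero])
    then show ?thesis by (simp add: mult_ac)
  qed
  have dom: "integrable \<nu> (\<lambda>y. (a1 x * b2 z) * (a2 y * b1 y))"
    by (intro integrable_mult_right int)
  show I: "integrable \<nu> (\<lambda>y. A x y * B y z)"
    by (rule Bochner_Integration.integrable_bound[OF dom])
       (use bnd in \<open>auto intro!: AE_I2 order_trans[OF _ abs_ge_self]\<close>)
  have "norm (kernel_comp \<nu> A B x z) \<le> (\<integral>y. norm (A x y * B y z) \<partial>\<nu>)"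
    unfolding kernel_comp_def by (rule integral_norm_bound)
  also have "\<dots> \<le> (\<integral>y. (a1 x * b2 z) * (a2 y * b1 y) \<partial>\<nu>)"
    by (intro integral_mono integrable_norm I dom bnd)
  also have "\<dots> = (a1 x * b2 z) * integral\<^sup>L \<nu> (\<lambda>y. a2 y * b1 y)"
    by (rule Bochner_Integration.integral_mult_right_zero)
  finally show "norm (kernel_comp \<nu> A B x z) \<le> (integral\<^sup>L \<nu> (\<lambda>y. a2 y * b1 y) * a1 x) * b2 z"
    by (simp add: mult_ac)
qed

text \<open>
  Both sides are the integral of \<open>\<Prod>i. A (x i) (y i) * B (y i) (x (\<sigma> i))\<close> over all \<open>x i\<close> and \<open>y i\<close>.
  Integrating over \<open>y\<close> first gives the left-hand side, and integrating over \<open>x\<close> first gives the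
  right-hand side, in both cases because the integrand is a product of functions of one variable
  each when the other variables are fixed.
\<close>

lemma cyclic_integral_commute:
  fixes A :: "'a \<Rightarrow> 'b \<Rightarrow> complex" and B :: "'b \<Rightarrow> 'a \<Rightarrow> complex"
  assumes "sigma_finite_measure \<mu>" "sigma_finite_measure \<nu>" and I: "finite I" and \<sigma>: "\<sigma> permutes I"
    and mA: "case_prod A \<in> borel_measurable (\<mu> \<Otimes>\<^sub>M \<nu>)"
    and mB: "case_prod B \<in> borel_measurable (\<nu> \<Otimes>\<^sub>M \<mu>)"
    and bA: "\<And>x y. x \<in> space \<mu> \<Longrightarrow> y \<in> space \<nu> \<Longrightarrow> norm (A x y) \<le> a1 x * a2 y"
    and bB: "\<And>y x. y \<in> space \<nu> \<Longrightarrow> x \<in> space \<mu> \<Longrightarrow> norm (B y x) \<le> b1 y * b2 x"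
    and int_\<mu>: "integrable \<mu> (\<lambda>x. a1 x * b2 x)" and int_\<nu>: "integrable \<nu> (\<lambda>y. a2 y * b1 y)"
  shows "(\<integral>x. (\<Prod>i\<in>I. kernel_comp \<nu> A B (x i) (x (\<sigma> i))) \<partial>PiM I (\<lambda>_. \<mu>)) =
    (\<integral>y. (\<Prod>i\<in>I. kernel_comp \<mu> B A (y i) (y (\<sigma> i))) \<partial>PiM I (\<lambda>_. \<nu>))"
proof -
  interpret \<mu>: sigma_finite_measure \<mu> by fact
  interpret \<nu>: sigma_finite_measure \<nu> by fact
  interpret M: product_sigma_finite "\<lambda>_. \<mu>" ..
  interpret N: product_sigma_finite "\<lambda>_. \<nu>" ..
  interpret MI: finite_product_sigma_finite "\<lambda>_. \<mu>" I by unfold_locales (rule I)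
  interpret NI: finite_product_sigma_finite "\<lambda>_. \<nu>" I by unfold_locales (rule I)
  interpret P: pair_sigma_finite "PiM I (\<lambda>_. \<mu>)" "PiM I (\<lambda>_. \<nu>)" ..
  have \<sigma>I: "\<sigma> i \<in> I" if "i \<in> I" for i
    using that permutes_in_image[OF \<sigma>] by simp
  define F where "F x y = (\<Prod>i\<in>I. A (x i) (y i) * B (y i) (x (\<sigma> i)))" for x y
  define \<phi> where "\<phi> x = (\<Prod>i\<in>I. a1 (x i) * b2 (x i))" for x
  define \<psi> where "\<psi> y = (\<Prod>i\<in>I. a2 (y i) * b1 (y i))" for y
  have int_\<phi>: "integrable (PiM I (\<lambda>_. \<mu>)) \<phi>"
    unfolding \<phi>_def by (intro M.product_integrable_prod I int_\<mu>)
  have int_\<psi>: "integrable (PiM I (\<lambda>_. \<nu>)) \<psi>"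
    unfolding \<psi>_def by (intro N.product_integrable_prod I int_\<nu>)
  have bound: "norm (F x y) \<le> \<phi> x * \<psi> y"
    if "x \<in> space (PiM I (\<lambda>_. \<mu>))" "y \<in> space (PiM I (\<lambda>_. \<nu>))" for x y
  proof -
    have x: "x i \<in> space \<mu>" and y: "y i \<in> space \<nu>" if "i \<in> I" for i
      using that \<open>x \<in> _\<close> \<open>y \<in> _\<close> by (auto simp: space_PiM)
    have "norm (F x y) = (\<Prod>i\<in>I. norm (A (x i) (y i)) * norm (B (y i) (x (\<sigma> i))))"
      by (simp add: F_def norm_mult flip: prod_norm)
    also have "\<dots> \<le> (\<Prod>i\<in>I. (a1 (x i) * a2 (y i)) * (b1 (y i) * b2 (x (\<sigma> i))))"
      by (intro prod_mono conjI mult_mono bA bB x y \<sigma>I mult_nonneg_nonneg norm_ge_zero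
          order_trans[OF norm_ge_zero bA])
    also have "\<dots> = \<phi> x * \<psi> y"
      using prod.permute[OF \<sigma>, of "\<lambda>i. b2 (x i)"]
      by (simp add: \<phi>_def \<psi>_def prod.distrib o_def mult_ac)
    finally show ?thesis .
  qed
  have int_F: "integrable (PiM I (\<lambda>_. \<mu>) \<Otimes>\<^sub>M PiM I (\<lambda>_. \<nu>)) (case_prod F)"
  proof (rule Bochner_Integration.integrable_bound)
    show "integrable (PiM I (\<lambda>_. \<mu>) \<Otimes>\<^sub>M PiM I (\<lambda>_. \<nu>)) (\<lambda>(x, y). \<phi> x * \<psi> y)"
      by (rule integrable_tensor_product[OF _ _ int_\<phi> int_\<psi>]) unfold_locales
    show "case_prod F \<in> borel_measurable (PiM I (\<lambda>_. \<mu>) \<Otimes>\<^sub>M PiM I (\<lambda>_. \<nu>))"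
      unfolding F_def case_prod_beta
    proof (intro borel_measurable_prod borel_measurable_times)
      fix i assume i: "i \<in> I"
      have "(\<lambda>p. (fst p i, snd p i)) \<in> PiM I (\<lambda>_. \<mu>) \<Otimes>\<^sub>M PiM I (\<lambda>_. \<nu>) \<rightarrow>\<^sub>M \<mu> \<Otimes>\<^sub>M \<nu>"
        using i by measurable
      from measurable_compose[OF this mA]
      show "(\<lambda>p. A (fst p i) (snd p i)) \<in> borel_measurable (PiM I (\<lambda>_. \<mu>) \<Otimes>\<^sub>M PiM I (\<lambda>_. \<nu>))" by simp
      have "(\<lambda>p. (snd p i, fst p (\<sigma> i))) \<in> PiM I (\<lambda>_. \<mu>) \<Otimes>\<^sub>M PiM I (\<lambda>_. \<nu>) \<rightarrow>\<^sub>M \<nu> \<Otimes>\<^sub>M \<mu>"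
        using i \<sigma>I[OF i] by measurable
      from measurable_compose[OF this mB]
      show "(\<lambda>p. B (snd p i) (fst p (\<sigma> i))) \<in> borel_measurable (PiM I (\<lambda>_. \<mu>) \<Otimes>\<^sub>M PiM I (\<lambda>_. \<nu>))" by simp
    qed
    show "AE p in PiM I (\<lambda>_. \<mu>) \<Otimes>\<^sub>M PiM I (\<lambda>_. \<nu>). norm (case_prod F p) \<le> norm (case p of (x, y) \<Rightarrow> \<phi> x * \<psi> y)"
      using bound by (intro AE_I2) (auto simp: space_pair_measure intro: order_trans[OF _ abs_ge_self])
  qed
  have 1: "(\<integral>y. F x y \<partial>PiM I (\<lambda>_. \<nu>)) = (\<Prod>i\<in>I. kernel_comp \<nu> A B (x i) (x (\<sigma> i)))"
    if "x \<in> space (PiM I (\<lambda>_. \<mu>))" for x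
  proof -
    have x: "x i \<in> space \<mu>" if "i \<in> I" for i
      using that \<open>x \<in> _\<close> by (auto simp: space_PiM)
    show ?thesis
      unfolding F_def kernel_comp_def
      by (rule N.product_integral_prod[OF I, where f = "\<lambda>i y. A (x i) y * B y (x (\<sigma> i))"])
         (rule kernel_product_integrable(1)[OF mA mB bA bB int_\<nu> x x[OF \<sigma>I]])
  qed
  have 2: "(\<integral>x. F x y \<partial>PiM I (\<lambda>_. \<mu>)) = (\<Prod>i\<in>I. kernel_comp \<mu> B A (y i) (y (\<sigma> i)))"
    if "y \<in> space (PiM I (\<lambda>_. \<nu>))" for y
  proof -
    have y: "y i \<in> space \<nu>" if "i \<in> I" for i
      using that \<open>y \<in> _\<close> by (auto simp: space_PiM)
    define g where "g i x = B (y i) x * A x (y (\<sigma> i))" for i x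
    define \<rho> where "\<rho> = inv_into UNIV \<sigma>"
    have \<rho>: "\<rho> permutes I" and [simp]: "\<sigma> (\<rho> i) = i" "\<rho> (\<sigma> i) = i" for i
      using permutes_inv[OF \<sigma>] permutes_inverses[OF \<sigma>] by (simp_all add: \<rho>_def)
    have \<rho>I: "\<rho> i \<in> I" if "i \<in> I" for i
      using permutes_in_image[OF \<rho>] that by simp
    have F: "F x y = (\<Prod>i\<in>I. g (\<rho> i) (x i))" for x
    proof -
      have "F x y = (\<Prod>i\<in>I. B (y i) (x (\<sigma> i))) * (\<Prod>i\<in>I. A (x i) (y i))"
        by (simp add: F_def prod.distrib mult_ac)
      also have "(\<Prod>i\<in>I. A (x i) (y i)) = (\<Prod>i\<in>I. A (x (\<sigma> i)) (y (\<sigma> i)))"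
        using prod.permute[OF \<sigma>, of "\<lambda>i. A (x i) (y i)"] by (simp add: o_def)
      also have "(\<Prod>i\<in>I. B (y i) (x (\<sigma> i))) * (\<Prod>i\<in>I. A (x (\<sigma> i)) (y (\<sigma> i))) = (\<Prod>i\<in>I. g i (x (\<sigma> i)))"
        by (simp add: g_def prod.distrib)
      also have "\<dots> = (\<Prod>i\<in>I. g (\<rho> i) (x i))"
        using prod.permute[OF \<rho>, of "\<lambda>i. g i (x (\<sigma> i))"]
        by (simp add: o_def)
      finally show ?thesis .
    qed
    have "(\<integral>x. F x y \<partial>PiM I (\<lambda>_. \<mu>)) = (\<Prod>i\<in>I. integral\<^sup>L \<mu> (g (\<rho> i)))"
      unfolding F
    proof (rule M.product_integral_prod[OF I])
      fix i assume i: "i \<in> I"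
      have int': "integrable \<mu> (\<lambda>x. b2 x * a1 x)" using int_\<mu> by (simp add: mult.commute)
      show "integrable \<mu> (g (\<rho> i))"
        unfolding g_def
        by (rule kernel_product_integrable(1)[OF mB mA bB bA int' y[OF \<rho>I[OF i]]])
           (use y i in auto)
    qed
    also have "\<dots> = (\<Prod>i\<in>I. integral\<^sup>L \<mu> (g i))"
      using prod.permute[OF \<sigma>, of "\<lambda>i. integral\<^sup>L \<mu> (g (\<rho> i))"] by (simp add: o_def)
    also have "\<dots> = (\<Prod>i\<in>I. kernel_comp \<mu> B A (y i) (y (\<sigma> i)))"
      by (simp add: g_def [abs_def] kernel_comp_def)
    finally show ?thesis .
  qed
  have "(\<integral>x. (\<Prod>i\<in>I. kernel_comp \<nu> A B (x i) (x (\<sigma> i))) \<partial>PiM I (\<lambda>_. \<mu>)) =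
      (\<integral>x. (\<integral>y. F x y \<partial>PiM I (\<lambda>_. \<nu>)) \<partial>PiM I (\<lambda>_. \<mu>))"
    by (rule Bochner_Integration.integral_cong) (simp_all add: 1)
  also have "\<dots> = (\<integral>y. (\<integral>x. F x y \<partial>PiM I (\<lambda>_. \<mu>)) \<partial>PiM I (\<lambda>_. \<nu>))"
    using P.Fubini_integral[OF int_F] by simp
  also have "\<dots> = (\<integral>y. (\<Prod>i\<in>I. kernel_comp \<mu> B A (y i) (y (\<sigma> i))) \<partial>PiM I (\<lambda>_. \<nu>))"
    by (rule Bochner_Integration.integral_cong) (simp_all add: 2)
  finally show ?thesis .
qed

text \<open>
  This is the identity \<open>det (1 + A B) = det (1 + B A)\<close>, one term of the Fredholm series at a time.
\<close>

lemma minor_integral_commute: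
  fixes A :: "'a \<Rightarrow> 'b \<Rightarrow> complex" and B :: "'b \<Rightarrow> 'a \<Rightarrow> complex"
  assumes sf: "sigma_finite_measure \<mu>" "sigma_finite_measure \<nu>" and I: "finite I"
    and mA: "case_prod A \<in> borel_measurable (\<mu> \<Otimes>\<^sub>M \<nu>)"
    and mB: "case_prod B \<in> borel_measurable (\<nu> \<Otimes>\<^sub>M \<mu>)"
    and bA: "\<And>x y. x \<in> space \<mu> \<Longrightarrow> y \<in> space \<nu> \<Longrightarrow> norm (A x y) \<le> a1 x * a2 y"
    and bB: "\<And>y x. y \<in> space \<nu> \<Longrightarrow> x \<in> space \<mu> \<Longrightarrow> norm (B y x) \<le> b1 y * b2 x"
    and int_\<mu>: "integrable \<mu> (\<lambda>x. a1 x * b2 x)" and int_\<nu>: "integrable \<nu> (\<lambda>y. a2 y * b1 y)"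
  shows "minor_integral \<mu> I (kernel_comp \<nu> A B) = minor_integral \<nu> I (kernel_comp \<mu> B A)"
proof -
  have int_\<mu>': "integrable \<mu> (\<lambda>x. b2 x * a1 x)" and int_\<nu>': "integrable \<nu> (\<lambda>y. b1 y * a2 y)"
    using int_\<mu> int_\<nu> by (simp_all add: mult.commute)
  have "minor_integral \<mu> I (kernel_comp \<nu> A B) = (\<Sum>\<sigma> | \<sigma> permutes I. of_int (sign \<sigma>) *
    (\<integral>x. (\<Prod>i\<in>I. kernel_comp \<nu> A B (x i) (x (\<sigma> i))) \<partial>PiM I (\<lambda>_. \<mu>)))"
    by (rule minor_integral_eq_sum[OF sf(1) I kernel_comp_measurable[OF sf(2) mA mB]
          kernel_product_integrable(2)[OF mA mB bA bB int_\<nu>]])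
       (use integrable_mult_right[OF int_\<mu>] in \<open>auto simp: mult.assoc\<close>)
  also have "\<dots> = (\<Sum>\<sigma> | \<sigma> permutes I. of_int (sign \<sigma>) *
    (\<integral>x. (\<Prod>i\<in>I. kernel_comp \<mu> B A (x i) (x (\<sigma> i))) \<partial>PiM I (\<lambda>_. \<nu>)))"
    using cyclic_integral_commute[OF sf I _ mA mB bA bB int_\<mu> int_\<nu>] by (intro sum.cong) auto
  also have "\<dots> = minor_integral \<nu> I (kernel_comp \<mu> B A)"
    by (rule minor_integral_eq_sum[OF sf(2) I kernel_comp_measurable[OF sf(1) mB mA]
          kernel_product_integrable(2)[OF mB mA bB bA int_\<mu>'], symmetric])
       (use integrable_mult_right[OF int_\<nu>'] in \<open>auto simp: mult.assoc\<close>)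
  finally show ?thesis .
qed

lemma kernel_comp_assoc:
  fixes A :: "'a \<Rightarrow> 'b \<Rightarrow> complex" and B :: "'b \<Rightarrow> 'c \<Rightarrow> complex" and E :: "'c \<Rightarrow> 'd \<Rightarrow> complex"
  assumes "sigma_finite_measure \<nu>" "sigma_finite_measure \<kappa>"
    and mA: "case_prod A \<in> borel_measurable (\<mu> \<Otimes>\<^sub>M \<nu>)"
    and mB: "case_prod B \<in> borel_measurable (\<nu> \<Otimes>\<^sub>M \<kappa>)"
    and mE: "case_prod E \<in> borel_measurable (\<kappa> \<Otimes>\<^sub>M \<rho>)"
    and bA: "\<And>x y. x \<in> space \<mu> \<Longrightarrow> y \<in> space \<nu> \<Longrightarrow> norm (A x y) \<le> a1 x * a2 y"
    and bB: "\<And>y n. y \<in> space \<nu> \<Longrightarrow> n \<in> space \<kappa> \<Longrightarrow> norm (B y n) \<le> b1 y * b2 n"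
    and bE: "\<And>n z. n \<in> space \<kappa> \<Longrightarrow> z \<in> space \<rho> \<Longrightarrow> norm (E n z) \<le> e1 n * e2 z"
    and int_\<nu>: "integrable \<nu> (\<lambda>y. a2 y * b1 y)" and int_\<kappa>: "integrable \<kappa> (\<lambda>n. b2 n * e1 n)"
    and x: "x \<in> space \<mu>" and z: "z \<in> space \<rho>"
  shows "kernel_comp \<nu> A (kernel_comp \<kappa> B E) x z = kernel_comp \<kappa> (kernel_comp \<nu> A B) E x z"
proof -
  interpret \<nu>: sigma_finite_measure \<nu> by fact
  interpret \<kappa>: sigma_finite_measure \<kappa> by fact
  interpret P: pair_sigma_finite \<nu> \<kappa> ..
  define F where "F y n = A x y * B y n * E n z" for y n
  have [measurable]: "(\<lambda>y. A x y) \<in> borel_measurable \<nu>" "(\<lambda>n. E n z) \<in> borel_measurable \<kappa>"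
    using measurable_compose[OF measurable_Pair1'[OF x] mA] measurable_compose[OF measurable_Pair2'[OF z] mE]
    by simp_all
  note [measurable] = mB borel_measurable_integrable[OF int_\<nu>] borel_measurable_integrable[OF int_\<kappa>]
  have "integrable (\<nu> \<Otimes>\<^sub>M \<kappa>) (\<lambda>(y, n). (a2 y * b1 y) * (b2 n * e1 n))"
    by (rule integrable_tensor_product) fact+
  then have dom: "integrable (\<nu> \<Otimes>\<^sub>M \<kappa>) (\<lambda>p. (a1 x * e2 z) * (case p of (y, n) \<Rightarrow> (a2 y * b1 y) * (b2 n * e1 n)))"
    by (rule integrable_mult_right)
  have int: "integrable (\<nu> \<Otimes>\<^sub>M \<kappa>) (case_prod F)"
  proof (rule Bochner_Integration.integrable_bound[OF dom])
    show "case_prod F \<in> borel_measurable (\<nu> \<Otimes>\<^sub>M \<kappa>)" unfolding F_def by measurable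
    show "AE p in \<nu> \<Otimes>\<^sub>M \<kappa>. norm (case_prod F p) \<le>
        norm ((a1 x * e2 z) * (case p of (y, n) \<Rightarrow> (a2 y * b1 y) * (b2 n * e1 n)))"
    proof (rule AE_I2, clarsimp simp: space_pair_measure)
      fix y n assume yn: "y \<in> space \<nu>" "n \<in> space \<kappa>"
      have "norm (F y n) \<le> (a1 x * a2 y) * (b1 y * b2 n) * (e1 n * e2 z)"
        unfolding F_def norm_mult using bA[OF x yn(1)] bB[OF yn] bE[OF yn(2) z]
        by (intro mult_mono mult_nonneg_nonneg norm_ge_zero order_trans[OF norm_ge_zero bA[OF x yn(1)]]
            order_trans[OF norm_ge_zero bB[OF yn]])
      also have "\<dots> \<le> \<bar>(a1 x * e2 z) * ((a2 y * b1 y) * (b2 n * e1 n))\<bar>"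
        by (rule order_trans[OF _ abs_ge_self]) (simp add: mult_ac)
      finally show "norm (F y n) \<le> \<bar>a1 x * e2 z * (a2 y * b1 y * (b2 n * e1 n))\<bar>" .
    qed
  qed
  have "kernel_comp \<nu> A (kernel_comp \<kappa> B E) x z = (\<integral>y. (\<integral>n. F y n \<partial>\<kappa>) \<partial>\<nu>)"
    by (simp add: kernel_comp_def F_def mult.assoc)
  also have "\<dots> = (\<integral>n. (\<integral>y. F y n \<partial>\<nu>) \<partial>\<kappa>)"
    by (rule P.Fubini_integral[OF int, symmetric])
  also have "\<dots> = kernel_comp \<kappa> (kernel_comp \<nu> A B) E x z"
    by (simp add: kernel_comp_def F_def)
  finally show ?thesis .
qed

section \<open>Permutations that exchange two halves of a set\<close>

text \<open>
  The involution is a product of \<open>card S\<close> disjoint transpositions, hence its sign.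
\<close>

lemma involution_exchanging_sets:
  assumes "finite S" "finite T" "S \<inter> T = {}" "card S = card T"
  obtains \<tau> where "\<tau> permutes S \<union> T" "\<tau> ` S = T" "\<And>x. \<tau> (\<tau> x) = x" "sign \<tau> = (-1) ^ card S"
proof -
  have "\<exists>\<tau>. \<tau> permutes S \<union> T \<and> \<tau> ` S = T \<and> (\<forall>x. \<tau> (\<tau> x) = x) \<and> sign \<tau> = (-1) ^ card S"
    using assms
  proof (induction S arbitrary: T rule: finite_induct)
    case empty
    then have "T = {}" by simp
    then show ?case by (intro exI[of _ id]) (simp add: permutes_id flip: id_def)
  next
    case (insert a S)
    have "T \<noteq> {}" using insert.prems insert.hyps by auto
    then obtain b where b: "b \<in> T" by blast
    define T' where "T' = T - {b}"
    have T: "T = insert b T'" "b \<notin> T'" using b by (auto simp: T'_def)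
    have "card T' = card S"
      using insert.prems insert.hyps b by (simp add: T'_def)
    then obtain \<tau> where \<tau>: "\<tau> permutes S \<union> T'" "\<tau> ` S = T'" "\<And>x. \<tau> (\<tau> x) = x"
        "sign \<tau> = (-1) ^ card S"
    proof -
      have "finite T'" "S \<inter> T' = {}" using insert.prems T by auto
      then show ?thesis using that insert.IH[of T'] \<open>card T' = card S\<close> by metis
    qed
    have ab: "a \<noteq> b" "a \<notin> S \<union> T'" "b \<notin> S \<union> T'"
      using insert.hyps insert.prems T by auto
    have fix_ab: "\<tau> a = a" "\<tau> b = b"
      using \<tau>(1) ab by (auto simp: permutes_not_in)
    have ne: "\<tau> x \<noteq> a" "\<tau> x \<noteq> b" if "x \<noteq> a" "x \<noteq> b" for x
      using \<tau>(3)[of x] fix_ab that by auto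
    define \<tau>' where "\<tau>' = Transposition.transpose a b \<circ> \<tau>"
    have 1: "\<tau>' permutes insert a S \<union> T"
      unfolding \<tau>'_def using T
      by (intro permutes_compose permutes_subset[OF \<tau>(1)] permutes_swap_id) auto
    have 2: "\<tau>' ` insert a S = T"
    proof -
      have "\<tau>' ` S = Transposition.transpose a b ` T'"
        by (simp only: \<tau>'_def image_comp[symmetric] \<tau>(2))
      also have "\<dots> = T'"
        using ab by (intro equalityI subsetI) (force simp: Transposition.transpose_def image_iff split: if_splits)+
      finally show ?thesis
        using T by (simp add: \<tau>'_def fix_ab)
    qed
    have 3: "\<tau>' (\<tau>' x) = x" for x
      using fix_ab ne[of x] \<tau>(3)[of x] by (auto simp: \<tau>'_def Transposition.transpose_def)
    have 4: "sign \<tau>' = (-1) ^ card (insert a S)"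
    proof -
      have "permutation \<tau>"
        using \<tau>(1) insert.hyps insert.prems T by (intro permutes_imp_permutation[of "S \<union> T'"]) auto
      then show ?thesis
        using insert.hyps ab \<tau>(4)
        by (simp add: \<tau>'_def sign_compose permutation_swap_id sign_swap_id)
    qed
    show ?case using 1 2 3 4 by blast
  qed
  then show ?thesis using that by blast
qed

text \<open>
  A permutation that exchanges \<open>S\<close> with its complement \<open>T\<close> consists of a bijection from \<open>S\<close> to \<open>T\<close> and
  a bijection from \<open>T\<close> to \<open>S\<close>. Identifying \<open>T\<close> with \<open>S\<close> by a fixed involution \<open>\<tau>\<close> turns these into two
  permutations of \<open>S\<close>.
\<close>

lemma bij_betw_permutations_exchanging:
  assumes \<tau>: "\<tau> permutes I" "\<And>x. \<tau> (\<tau> x) = x" "\<tau> ` S = I - S" and S: "S \<subseteq> I"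
  shows "bij_betw (\<lambda>(\<pi>, \<rho>). \<pi> \<circ> \<tau> \<circ> \<rho>) ({\<pi>. \<pi> permutes S} \<times> {\<rho>. \<rho> permutes S})
    {\<sigma>. \<sigma> permutes I \<and> \<sigma> ` S = I - S}"
proof -
  have \<tau>S: "\<tau> y \<in> I - S" if "y \<in> S" for y using \<tau>(3) that by blast
  have \<tau>T': "\<tau> ` (I - S) = S"
    by (simp add: \<tau>(2) image_image flip: \<tau>(3))
  then have \<tau>T: "\<tau> y \<in> S" if "y \<in> I - S" for y
    using that by blast
  show ?thesis
  proof (rule bij_betw_imageI)
    show "inj_on (\<lambda>(\<pi>, \<rho>). \<pi> \<circ> \<tau> \<circ> \<rho>) ({\<pi>. \<pi> permutes S} \<times> {\<rho>. \<rho> permutes S})"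
    proof (rule inj_onI, clarsimp)
      fix \<pi> \<rho> \<pi>' \<rho>'
      assume p: "\<pi> permutes S" "\<rho> permutes S" "\<pi>' permutes S" "\<rho>' permutes S"
        and eq: "\<pi> \<circ> \<tau> \<circ> \<rho> = \<pi>' \<circ> \<tau> \<circ> \<rho>'"
      have eq': "\<pi> (\<tau> (\<rho> y)) = \<pi>' (\<tau> (\<rho>' y))" for y
        using fun_cong[OF eq, of y] by simp
      have "\<pi> y = \<pi>' y" for y
      proof (cases "y \<in> S")
        case True
        have "\<rho> (\<tau> y) = \<tau> y" "\<rho>' (\<tau> y) = \<tau> y"
          using \<tau>S[OF True] permutes_not_in[OF p(2)] permutes_not_in[OF p(4)] by blast+
        then show ?thesis using eq'[of "\<tau> y"] by (simp add: \<tau>(2))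
      qed (use permutes_not_in[OF p(1)] permutes_not_in[OF p(3)] in simp)
      then have \<pi>: "\<pi> = \<pi>'" by blast
      moreover have "\<rho> y = \<rho>' y" for y
        using eq'[of y] unfolding \<pi> inj_eq[OF permutes_inj[OF p(3)]] inj_eq[OF permutes_inj[OF \<tau>(1)]] .
      ultimately show "\<pi> = \<pi>' \<and> \<rho> = \<rho>'" by blast
    qed
    show "(\<lambda>(\<pi>, \<rho>). \<pi> \<circ> \<tau> \<circ> \<rho>) ` ({\<pi>. \<pi> permutes S} \<times> {\<rho>. \<rho> permutes S}) =
        {\<sigma>. \<sigma> permutes I \<and> \<sigma> ` S = I - S}" (is "?f ` ?X = ?Y")
    proof
      show "?f ` ?X \<subseteq> ?Y"
      proof clarsimp
        fix \<pi> \<rho> assume p: "\<pi> permutes S" "\<rho> permutes S"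
        have "\<pi> \<circ> \<tau> \<circ> \<rho> permutes I"
          by (intro permutes_compose \<tau> permutes_subset[OF p(1) S] permutes_subset[OF p(2) S])
        moreover have "(\<lambda>y. \<pi> (\<tau> (\<rho> y))) ` S = I - S"
        proof -
          have "(\<lambda>y. \<pi> (\<tau> (\<rho> y))) ` S = \<pi> ` \<tau> ` \<rho> ` S" by (simp add: image_image)
          also have "\<dots> = \<pi> ` (I - S)" using p \<tau>(3) by (simp only: permutes_image)
          also have "\<dots> = (\<lambda>y. y) ` (I - S)"
            using p by (intro image_cong refl) (simp add: permutes_not_in)
          finally show ?thesis by simp
        qed
        ultimately show "\<pi> \<circ> \<tau> \<circ> \<rho> permutes I \<and> (\<lambda>y. \<pi> (\<tau> (\<rho> y))) ` S = I - S" by blast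
      qed
      show "?Y \<subseteq> ?f ` ?X"
      proof
        fix \<sigma> assume "\<sigma> \<in> ?Y"
        then have \<sigma>: "\<sigma> permutes I" "\<sigma> ` S = I - S" by auto
        have \<sigma>T: "\<sigma> ` (I - S) = S"
          using image_set_diff[OF permutes_inj[OF \<sigma>(1)], of I S] permutes_image[OF \<sigma>(1)] \<sigma>(2) S
          by (simp add: double_diff)
        define \<pi> where "\<pi> y = (if y \<in> S then \<sigma> (\<tau> y) else y)" for y
        define \<rho> where "\<rho> y = (if y \<in> S then \<tau> (\<sigma> y) else y)" for y
        have inj: "inj \<sigma>" "inj \<tau>" using \<sigma>(1) \<tau>(1) by (simp_all add: permutes_inj)
        have "bij_betw \<pi> S S"
        proof (rule bij_betw_imageI)
          show "inj_on \<pi> S"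
            by (rule inj_onI) (simp add: \<pi>_def inj_eq[OF inj(1)] inj_eq[OF inj(2)])
          have "\<pi> ` S = \<sigma> ` \<tau> ` S"
            unfolding image_image by (rule image_cong) (simp_all add: \<pi>_def)
          then show "\<pi> ` S = S" unfolding \<tau>(3) \<sigma>T .
        qed
        then have \<pi>: "\<pi> permutes S" by (rule bij_imp_permutes) (simp add: \<pi>_def)
        have "bij_betw \<rho> S S"
        proof (rule bij_betw_imageI)
          show "inj_on \<rho> S"
            by (rule inj_onI) (simp add: \<rho>_def inj_eq[OF inj(1)] inj_eq[OF inj(2)])
          have "\<rho> ` S = \<tau> ` \<sigma> ` S"
            unfolding image_image by (rule image_cong) (simp_all add: \<rho>_def)
          then show "\<rho> ` S = S" unfolding \<sigma>(2) \<tau>T' .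
        qed
        then have \<rho>: "\<rho> permutes S" by (rule bij_imp_permutes) (simp add: \<rho>_def)
        have "\<sigma> y = \<pi> (\<tau> (\<rho> y))" for y
        proof -
          consider "y \<in> S" | "y \<in> I - S" | "y \<notin> I" using S by blast
          then show ?thesis
          proof cases
            case 1
            then have "\<sigma> y \<in> I - S" using \<sigma> by blast
            then show ?thesis using 1 by (simp add: \<rho>_def \<pi>_def \<tau>(2))
          next
            case 2
            then show ?thesis using \<tau>T[OF 2] by (simp add: \<rho>_def \<pi>_def \<tau>(2))
          next
            case 3
            moreover from this have "y \<notin> S" using S by blast
            ultimately show ?thesis
              using permutes_not_in[OF \<sigma>(1)] permutes_not_in[OF \<tau>(1)] by (simp add: \<rho>_def \<pi>_def)
          qed
        qed
        then have "\<sigma> = ?f (\<pi>, \<rho>)" by auto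
        then show "\<sigma> \<in> ?f ` ?X" using \<pi> \<rho> by blast
      qed
    qed
  qed
qed

text \<open>
  On \<open>S\<close>, the square of \<open>\<pi> \<circ> \<tau> \<circ> \<rho>\<close> is \<open>\<pi> \<circ> \<rho>\<close>. Summing over pairs \<open>(\<pi>, \<rho>)\<close> therefore gives every
  permutation of \<open>S\<close> exactly \<open>fact (card S)\<close> times.
\<close>

lemma sum_permutations_exchanging:
  fixes J :: "('i \<Rightarrow> 'i) \<Rightarrow> complex"
  assumes I: "finite I" and S: "S \<subseteq> I" and card: "card (I - S) = card S"
    and J: "\<And>\<pi> \<pi>'. (\<And>i. i \<in> S \<Longrightarrow> \<pi> i = \<pi>' i) \<Longrightarrow> J \<pi> = J \<pi>'"
  shows "(\<Sum>\<sigma> | \<sigma> permutes I \<and> \<sigma> ` S = I - S. of_int (sign \<sigma>) * J (\<sigma> \<circ> \<sigma>)) =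
    (-1) ^ card S * fact (card S) * (\<Sum>\<pi> | \<pi> permutes S. of_int (sign \<pi>) * J \<pi>)"
proof -
  have fin: "finite S" "finite (I - S)" using I S finite_subset by auto
  have "S \<inter> (I - S) = {}" "S \<union> (I - S) = I" using S by auto
  then obtain \<tau> where \<tau>: "\<tau> permutes I" "\<tau> ` S = I - S" "\<And>x. \<tau> (\<tau> x) = x" "sign \<tau> = (-1) ^ card S"
    using involution_exchanging_sets[OF fin _ card[symmetric]] by auto
  have summand: "of_int (sign (\<pi> \<circ> \<tau> \<circ> \<rho>)) * J ((\<pi> \<circ> \<tau> \<circ> \<rho>) \<circ> (\<pi> \<circ> \<tau> \<circ> \<rho>)) =
      (-1) ^ card S * (of_int (sign (\<pi> \<circ> \<rho>)) * J (\<pi> \<circ> \<rho>))"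
    if p: "\<pi> permutes S" "\<rho> permutes S" for \<pi> \<rho>
  proof -
    have perm: "permutation \<pi>" "permutation \<rho>" "permutation \<tau>"
      using permutes_imp_permutation fin I p \<tau> by blast+
    have "J ((\<pi> \<circ> \<tau> \<circ> \<rho>) \<circ> (\<pi> \<circ> \<tau> \<circ> \<rho>)) = J (\<pi> \<circ> \<rho>)"
    proof (rule J)
      fix i assume "i \<in> S"
      then have "\<rho> i \<in> S" using p permutes_in_image by fastforce
      then have "\<tau> (\<rho> i) \<notin> S" using \<tau>(2) by blast
      then show "((\<pi> \<circ> \<tau> \<circ> \<rho>) \<circ> (\<pi> \<circ> \<tau> \<circ> \<rho>)) i = (\<pi> \<circ> \<rho>) i"
        using p by (simp add: permutes_not_in \<tau>(3))
    qed
    moreover have "sign (\<pi> \<circ> \<tau> \<circ> \<rho>) = (-1) ^ card S * sign (\<pi> \<circ> \<rho>)"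
      using perm by (simp add: sign_compose permutation_compose \<tau>(4))
    ultimately show ?thesis by simp
  qed
  have "(\<Sum>\<sigma> | \<sigma> permutes I \<and> \<sigma> ` S = I - S. of_int (sign \<sigma>) * J (\<sigma> \<circ> \<sigma>)) =
      (\<Sum>(\<pi>, \<rho>) \<in> {\<pi>. \<pi> permutes S} \<times> {\<rho>. \<rho> permutes S}.
        (-1) ^ card S * (of_int (sign (\<pi> \<circ> \<rho>)) * J (\<pi> \<circ> \<rho>)))"
    by (subst sum.reindex_bij_betw[OF bij_betw_permutations_exchanging[OF \<tau>(1,3,2) S], symmetric])
       (use summand in \<open>auto intro!: sum.cong\<close>)
  also have "\<dots> = (\<Sum>\<rho> | \<rho> permutes S. \<Sum>\<pi> | \<pi> permutes S.
        (-1) ^ card S * (of_int (sign (\<pi> \<circ> \<rho>)) * J (\<pi> \<circ> \<rho>)))"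
    by (subst sum.swap) (simp add: sum.cartesian_product)
  also have "\<dots> = (\<Sum>\<rho> | \<rho> permutes S. \<Sum>\<pi> | \<pi> permutes S.
        (-1) ^ card S * (of_int (sign \<pi>) * J \<pi>))"
    by (intro sum.cong refl sum_permutations_compose_right
        [of _ S "\<lambda>\<pi>. (-1) ^ card S * (of_int (sign \<pi>) * J \<pi>)", symmetric]) simp
  also have "\<dots> = (-1) ^ card S * fact (card S) * (\<Sum>\<pi> | \<pi> permutes S. of_int (sign \<pi>) * J \<pi>)"
    using card_permutations[OF refl fin(1)] by (simp add: sum_distrib_left mult_ac)
  finally show ?thesis .
qed

section \<open>Off-diagonal kernels\<close>

text \<open>
  This is the Schur complement identity \<open>det (1 + A + B) = det (1 - A B)\<close> for kernels that exchange \<open>U\<close>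
  with its complement, one term of the Fredholm series at a time. In the proof, \<open>S\<close> is the
  index set of the variables that lie in \<open>U\<close>; the binomial coefficient counts its possible positions and combines with the
  factor \<open>fact (card S)\<close> from the permutations to \<open>fact (card I) / fact (card S)\<close>.
\<close>

lemma minor_integral_off_diagonal:
  fixes A B :: "'a \<Rightarrow> 'a \<Rightarrow> complex" and U :: "'a set" and I :: "'i set"
  assumes sf: "sigma_finite_measure \<mu>" and I: "finite I"
    and mA: "case_prod A \<in> borel_measurable (\<mu> \<Otimes>\<^sub>M \<mu>)"
    and mB: "case_prod B \<in> borel_measurable (\<mu> \<Otimes>\<^sub>M \<mu>)"
    and bA: "\<And>x y. x \<in> space \<mu> \<Longrightarrow> y \<in> space \<mu> \<Longrightarrow> norm (A x y) \<le> \<phi> x * \<psi> y"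
    and bB: "\<And>x y. x \<in> space \<mu> \<Longrightarrow> y \<in> space \<mu> \<Longrightarrow> norm (B x y) \<le> \<phi> x * \<psi> y"
    and int: "integrable \<mu> (\<lambda>x. \<phi> x * \<psi> x)"
    and suppA: "\<And>x y. A x y \<noteq> 0 \<Longrightarrow> x \<in> U \<and> y \<notin> U"
    and suppB: "\<And>x y. B x y \<noteq> 0 \<Longrightarrow> x \<notin> U \<and> y \<in> U"
  shows "minor_integral \<mu> I (\<lambda>x y. A x y + B x y) =
    (if even (card I) then (-1) ^ (card I div 2) * (fact (card I) / fact (card I div 2)) *
       minor_integral \<mu> {..<card I div 2} (kernel_comp \<mu> A B) else 0)"
proof -
  interpret sigma_finite_measure \<mu> by fact
  interpret product_sigma_finite "\<lambda>_. \<mu>" ..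
  define C where "C = kernel_comp \<mu> A B"
  have mC: "case_prod C \<in> borel_measurable (\<mu> \<Otimes>\<^sub>M \<mu>)"
    unfolding C_def by (rule kernel_comp_measurable[OF sf mA mB])
  have int': "integrable \<mu> (\<lambda>x. \<psi> x * \<phi> x)"
    using int by (simp add: mult.commute)
  have bC: "norm (C x y) \<le> (integral\<^sup>L \<mu> (\<lambda>y. \<psi> y * \<phi> y) * \<phi> x) * \<psi> y"
    if "x \<in> space \<mu>" "y \<in> space \<mu>" for x y
    unfolding C_def by (rule kernel_product_integrable(2)[OF mA mB bA bB int' that])
  have int_C: "integrable \<mu> (\<lambda>x. (integral\<^sup>L \<mu> (\<lambda>y. \<psi> y * \<phi> y) * \<phi> x) * \<psi> x)"
    using integrable_mult_right[OF int] by (simp add: mult.assoc)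
  define F where "F S \<sigma> x = (\<Prod>i\<in>I. (if i \<in> S then A else B) (x i) (x (\<sigma> i)))" for S :: "'i set" and \<sigma> x
  define J where "J S \<pi> = (\<integral>x. (\<Prod>i\<in>S. C (x i) (x (\<pi> i))) \<partial>PiM S (\<lambda>_. \<mu>))" for S :: "'i set" and \<pi>
  have int_F: "integrable (PiM I (\<lambda>_. \<mu>)) (F S \<sigma>)" if "\<sigma> permutes I" for S \<sigma>
    unfolding F_def
    by (rule dominated_product_integrable[OF sf I that, where \<phi> = \<phi> and \<psi> = \<psi>])
       (use mA mB bA bB int in auto)

  \<comment> \<open>Expand the product of sums. In a nonzero summand the variables in \<open>U\<close> are those with index
    in \<open>S\<close>, and the supports of the kernels force \<open>\<sigma>\<close> to exchange \<open>S\<close> with its complement.\<close>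
  have split: "(\<Prod>i\<in>I. A (x i) (x (\<sigma> i)) + B (x i) (x (\<sigma> i))) =
      (\<Sum>S | S \<subseteq> I \<and> \<sigma> ` S = I - S. F S \<sigma> x)" if \<sigma>: "\<sigma> permutes I" for \<sigma> x
  proof -
    have "(\<Prod>i\<in>I. A (x i) (x (\<sigma> i)) + B (x i) (x (\<sigma> i))) = (\<Sum>S\<in>Pow I. F S \<sigma> x)"
    proof (subst prod_add[OF I], intro sum.cong refl)
      fix S assume "S \<in> Pow I"
      then have S: "S \<subseteq> I" by simp
      have "F S \<sigma> x = (\<Prod>i\<in>S. (if i \<in> S then A else B) (x i) (x (\<sigma> i))) *
          (\<Prod>i\<in>I - S. (if i \<in> S then A else B) (x i) (x (\<sigma> i)))"
        unfolding F_def by (subst prod.subset_diff[OF S I]) (rule mult.commute)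
      then show "(\<Prod>i\<in>S. A (x i) (x (\<sigma> i))) * (\<Prod>i\<in>I - S. B (x i) (x (\<sigma> i))) = F S \<sigma> x"
        by simp
    qed
    also have "\<dots> = (\<Sum>S | S \<subseteq> I \<and> \<sigma> ` S = I - S. F S \<sigma> x)"
    proof (rule sum.mono_neutral_right)
      show "finite (Pow I)" using I by simp
      show "{S. S \<subseteq> I \<and> \<sigma> ` S = I - S} \<subseteq> Pow I" by auto
      show "\<forall>S\<in>Pow I - {S. S \<subseteq> I \<and> \<sigma> ` S = I - S}. F S \<sigma> x = 0"
      proof (rule ballI, rule ccontr)
        fix S assume S: "S \<in> Pow I - {S. S \<subseteq> I \<and> \<sigma> ` S = I - S}" and "F S \<sigma> x \<noteq> 0"
        then have ne: "(if i \<in> S then A else B) (x i) (x (\<sigma> i)) \<noteq> 0" if "i \<in> I" for i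
          using I that by (auto simp: F_def)
        have loc: "x i \<in> U \<longleftrightarrow> i \<in> S" "x (\<sigma> i) \<in> U \<longleftrightarrow> i \<notin> S" if "i \<in> I" for i
          using ne[OF that] suppA[of "x i" "x (\<sigma> i)"] suppB[of "x i" "x (\<sigma> i)"]
          by (auto split: if_splits)
        have \<sigma>I: "\<sigma> i \<in> I" if "i \<in> I" for i
          using that permutes_in_image[OF \<sigma>] by simp
        have flip: "\<sigma> i \<in> S \<longleftrightarrow> i \<notin> S" if "i \<in> I" for i
          using loc(1)[OF \<sigma>I[OF that]] loc(2)[OF that] by simp
        have "\<sigma> ` S = I - S"
        proof
          show "\<sigma> ` S \<subseteq> I - S"
            using S \<sigma>I flip by auto
          show "I - S \<subseteq> \<sigma> ` S"
          proof
            fix j assume j: "j \<in> I - S"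
            then obtain i where i: "i \<in> I" "j = \<sigma> i"
              using permutes_image[OF \<sigma>] by blast
            then show "j \<in> \<sigma> ` S" using flip[OF i(1)] j by blast
          qed
        qed
        then show False using S by auto
      qed
    qed
    finally show ?thesis .
  qed

  \<comment> \<open>Integrate out the variables outside \<open>S\<close>. Each of them links exactly two variables in \<open>S\<close>, so
    \<open>A\<close> and \<open>B\<close> are composed and \<open>\<sigma>\<close> is replaced by its square.\<close>
  have integrate: "(\<integral>x. F S \<sigma> x \<partial>PiM I (\<lambda>_. \<mu>)) = J S (\<sigma> \<circ> \<sigma>)"
    if \<sigma>: "\<sigma> permutes I" and S: "S \<subseteq> I" and \<sigma>S: "\<sigma> ` S = I - S" for S \<sigma>
  proof -
    have fin: "finite S" "finite (I - S)" using I S finite_subset by auto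
    have ST: "S \<inter> (I - S) = {}" "S \<union> (I - S) = I" using S by auto
    have \<sigma>T: "\<sigma> i \<in> S" if "i \<in> I - S" for i
    proof -
      have "\<sigma> ` (I - S) = S"
        unfolding image_set_diff[OF permutes_inj[OF \<sigma>]] permutes_image[OF \<sigma>] \<sigma>S
        using S by blast
      then show ?thesis using that by blast
    qed
    have \<sigma>S': "\<sigma> i \<in> I - S" if "i \<in> S" for i
      using imageI[OF that, of \<sigma>] unfolding \<sigma>S .
    have bij: "bij_betw \<sigma> S (I - S)"
      unfolding bij_betw_def using \<sigma>S permutes_inj_on[OF \<sigma>] by blast
    define \<rho> where "\<rho> = inv_into UNIV \<sigma>"
    have [simp]: "\<sigma> (\<rho> i) = i" "\<rho> (\<sigma> i) = i" for i
      using permutes_inverses[OF \<sigma>] by (simp_all add: \<rho>_def)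
    have \<rho>T: "\<rho> k \<in> S" if "k \<in> I - S" for k
      using that unfolding \<sigma>S[symmetric] by (elim imageE) simp
    have "(\<integral>x. F S \<sigma> x \<partial>PiM I (\<lambda>_. \<mu>)) =
        (\<integral>x. (\<integral>y. F S \<sigma> (merge S (I - S) (x, y)) \<partial>PiM (I - S) (\<lambda>_. \<mu>)) \<partial>PiM S (\<lambda>_. \<mu>))"
      using product_integral_fold[OF ST(1) fin, of "F S \<sigma>"] int_F[OF \<sigma>, of S] unfolding ST(2) by blast
    also have "\<dots> = J S (\<sigma> \<circ> \<sigma>)"
      unfolding J_def
    proof (rule Bochner_Integration.integral_cong[OF refl])
      fix x assume x: "x \<in> space (PiM S (\<lambda>_. \<mu>))"
      then have xS: "x i \<in> space \<mu>" if "i \<in> S" for i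
        using that by (auto simp: space_PiM)
      have F: "F S \<sigma> (merge S (I - S) (x, y)) =
          (\<Prod>k\<in>I - S. A (x (\<rho> k)) (y k) * B (y k) (x (\<sigma> k)))" for y
      proof -
        have "F S \<sigma> (merge S (I - S) (x, y)) =
            (\<Prod>i\<in>S. A (x i) (y (\<sigma> i))) * (\<Prod>i\<in>I - S. B (y i) (x (\<sigma> i)))"
        proof -
          have "F S \<sigma> (merge S (I - S) (x, y)) =
            (\<Prod>i\<in>S. (if i \<in> S then A else B) (merge S (I - S) (x, y) i) (merge S (I - S) (x, y) (\<sigma> i))) *
            (\<Prod>i\<in>I - S. (if i \<in> S then A else B) (merge S (I - S) (x, y) i) (merge S (I - S) (x, y) (\<sigma> i)))"
            unfolding F_def by (subst prod.subset_diff[OF S I]) (rule mult.commute)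
          also have "\<dots> = (\<Prod>i\<in>S. A (x i) (y (\<sigma> i))) * (\<Prod>i\<in>I - S. B (y i) (x (\<sigma> i)))"
            using \<sigma>S' \<sigma>T by (intro arg_cong2[where f = "(*)"] prod.cong) (auto simp: merge_def)
          finally show ?thesis .
        qed
        also have "(\<Prod>i\<in>S. A (x i) (y (\<sigma> i))) = (\<Prod>k\<in>I - S. A (x (\<rho> k)) (y k))"
          using prod.reindex_bij_betw[OF bij, of "\<lambda>k. A (x (\<rho> k)) (y k)"] by simp
        finally show ?thesis by (simp only: prod.distrib)
      qed
      have "(\<integral>y. F S \<sigma> (merge S (I - S) (x, y)) \<partial>PiM (I - S) (\<lambda>_. \<mu>)) =
          (\<Prod>k\<in>I - S. C (x (\<rho> k)) (x (\<sigma> k)))"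
        unfolding F C_def kernel_comp_def
        by (rule product_integral_prod[OF fin(2), where f = "\<lambda>k y. A (x (\<rho> k)) y * B y (x (\<sigma> k))"])
           (rule kernel_product_integrable(1)[OF mA mB bA bB int' xS[OF \<rho>T] xS[OF \<sigma>T]])
      also have "\<dots> = (\<Prod>i\<in>S. C (x i) (x ((\<sigma> \<circ> \<sigma>) i)))"
        using prod.reindex_bij_betw[OF bij, of "\<lambda>k. C (x (\<rho> k)) (x (\<sigma> k))"] by simp
      finally show "(\<integral>y. F S \<sigma> (merge S (I - S) (x, y)) \<partial>PiM (I - S) (\<lambda>_. \<mu>)) =
          (\<Prod>i\<in>S. C (x i) (x ((\<sigma> \<circ> \<sigma>) i)))" .
    qed
    finally show ?thesis .
  qed

  have block: "(\<Sum>\<sigma> | \<sigma> permutes I \<and> \<sigma> ` S = I - S. of_int (sign \<sigma>) * J S (\<sigma> \<circ> \<sigma>)) =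
      (if card I = 2 * card S then (-1) ^ card S * fact (card S) * minor_integral \<mu> {..<card S} C else 0)"
    if S: "S \<subseteq> I" for S
  proof -
    have fin: "finite S" using I S finite_subset by auto
    have card: "card (I - S) = card I - card S" "card S \<le> card I"
      using S I fin by (auto simp: card_Diff_subset card_mono)
    show ?thesis
    proof (cases "card I = 2 * card S")
      case True
      have "(\<Sum>\<sigma> | \<sigma> permutes I \<and> \<sigma> ` S = I - S. of_int (sign \<sigma>) * J S (\<sigma> \<circ> \<sigma>)) =
          (-1) ^ card S * fact (card S) * (\<Sum>\<pi> | \<pi> permutes S. of_int (sign \<pi>) * J S \<pi>)"
        by (rule sum_permutations_exchanging[OF I S])
           (use True card in \<open>auto simp: J_def intro!: Bochner_Integration.integral_cong prod.cong\<close>)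
      also have "(\<Sum>\<pi> | \<pi> permutes S. of_int (sign \<pi>) * J S \<pi>) = minor_integral \<mu> S C"
        unfolding J_def by (rule minor_integral_eq_sum[OF sf fin mC bC int_C, symmetric])
      also have "\<dots> = minor_integral \<mu> {..<card S} C"
      proof -
        obtain e where "bij_betw e {..<card S} S"
          using ex_bij_betw_nat_finite[OF fin] by (auto simp: atLeast0LessThan)
        then show ?thesis by (intro minor_integral_reindex[OF sf _ _ mC]) auto
      qed
      finally show ?thesis unfolding if_P[OF True] .
    next
      case False
      have no: "\<not> (\<sigma> permutes I \<and> \<sigma> ` S = I - S)" for \<sigma>
      proof
        assume "\<sigma> permutes I \<and> \<sigma> ` S = I - S"
        then have "card (I - S) = card S"
          using card_image[OF permutes_inj_on[of \<sigma> I S]] by simp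
        then show False using card False by simp
      qed
      show ?thesis unfolding if_not_P[OF False] by (rule sum.neutral) (use no in blast)
    qed
  qed

  have "minor_integral \<mu> I (\<lambda>x y. A x y + B x y) = (\<Sum>\<sigma> | \<sigma> permutes I. of_int (sign \<sigma>) *
      (\<integral>x. (\<Prod>i\<in>I. A (x i) (x (\<sigma> i)) + B (x i) (x (\<sigma> i))) \<partial>PiM I (\<lambda>_. \<mu>)))"
  proof (rule minor_integral_eq_sum[OF sf I, where \<phi> = "\<lambda>x. 2 * \<phi> x" and \<psi> = \<psi>])
    show "(\<lambda>(x, y). A x y + B x y) \<in> borel_measurable (\<mu> \<Otimes>\<^sub>M \<mu>)"
      using borel_measurable_add[OF mA mB] by (simp add: case_prod_beta')
    show "norm (A x y + B x y) \<le> 2 * \<phi> x * \<psi> y" if "x \<in> space \<mu>" "y \<in> space \<mu>" for x y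
      using norm_triangle_ineq[of "A x y" "B x y"] bA[OF that] bB[OF that] by simp
    show "integrable \<mu> (\<lambda>x. 2 * \<phi> x * \<psi> x)"
      using integrable_mult_right[OF int, of 2] by (simp add: mult.assoc)
  qed
  also have "\<dots> = (\<Sum>\<sigma> | \<sigma> permutes I. \<Sum>S | S \<subseteq> I \<and> \<sigma> ` S = I - S. of_int (sign \<sigma>) * J S (\<sigma> \<circ> \<sigma>))"
  proof (intro sum.cong refl)
    fix \<sigma> assume "\<sigma> \<in> {\<sigma>. \<sigma> permutes I}"
    then have \<sigma>: "\<sigma> permutes I" by simp
    have "(\<integral>x. (\<Prod>i\<in>I. A (x i) (x (\<sigma> i)) + B (x i) (x (\<sigma> i))) \<partial>PiM I (\<lambda>_. \<mu>)) =
        (\<Sum>S | S \<subseteq> I \<and> \<sigma> ` S = I - S. J S (\<sigma> \<circ> \<sigma>))"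
      unfolding split[OF \<sigma>]
      by (subst Bochner_Integration.integral_sum) (use int_F[OF \<sigma>] integrate[OF \<sigma>] in auto)
    then show "of_int (sign \<sigma>) * (\<integral>x. (\<Prod>i\<in>I. A (x i) (x (\<sigma> i)) + B (x i) (x (\<sigma> i))) \<partial>PiM I (\<lambda>_. \<mu>)) =
        (\<Sum>S | S \<subseteq> I \<and> \<sigma> ` S = I - S. of_int (sign \<sigma>) * J S (\<sigma> \<circ> \<sigma>))"
      by (simp add: sum_distrib_left)
  qed
  also have "\<dots> = (\<Sum>S\<in>Pow I. \<Sum>\<sigma> | \<sigma> permutes I \<and> \<sigma> ` S = I - S. of_int (sign \<sigma>) * J S (\<sigma> \<circ> \<sigma>))"
    using sum.swap_restrict[of "{\<sigma>. \<sigma> permutes I}" "Pow I" "\<lambda>\<sigma> S. of_int (sign \<sigma>) * J S (\<sigma> \<circ> \<sigma>)"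
        "\<lambda>\<sigma> S. \<sigma> ` S = I - S"] I finite_permutations[OF I] by simp
  also have "\<dots> = (\<Sum>S\<in>Pow I. if card I = 2 * card S
      then (-1) ^ card S * fact (card S) * minor_integral \<mu> {..<card S} C else 0)"
    by (intro sum.cong refl block) simp
  also have "\<dots> = (\<Sum>S | S \<subseteq> I \<and> card I = 2 * card S.
      (-1) ^ card S * fact (card S) * minor_integral \<mu> {..<card S} C)"
    using I by (intro sum.mono_neutral_cong_right) auto
  also have "\<dots> = (if even (card I) then (-1) ^ (card I div 2) * (fact (card I) / fact (card I div 2)) *
       minor_integral \<mu> {..<card I div 2} C else 0)"
  proof (cases "even (card I)")
    case True
    define m where "m = card I div 2"
    have m: "card I = 2 * m" using True by (simp add: m_def)
    have "(\<Sum>S | S \<subseteq> I \<and> card I = 2 * card S.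
        (-1) ^ card S * fact (card S) * minor_integral \<mu> {..<card S} C) =
        (\<Sum>S | S \<subseteq> I \<and> card S = m. (-1) ^ m * fact m * minor_integral \<mu> {..<m} C)"
      by (rule sum.cong) (auto simp: m)
    also have "\<dots> = of_nat ((2 * m) choose m) * ((-1) ^ m * fact m * minor_integral \<mu> {..<m} C)"
      using n_subsets[OF I, of m] by (simp add: m)
    also have "\<dots> = (-1) ^ m * (fact (2 * m) / fact m) * minor_integral \<mu> {..<m} C"
      by (subst binomial_fact) (simp_all add: field_simps)
    finally show ?thesis using True by (simp add: m)
  next
    case False
    then have empty: "{S. S \<subseteq> I \<and> card I = 2 * card S} = {}" by auto
    show ?thesis unfolding empty using False by simp
  qed
  finally show ?thesis by (simp add: C_def)
qed

section \<open>Velocity of a Lipschitz path\<close>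

lemma has_vector_derivative_iff_quotient_tendsto:
  fixes f :: "real \<Rightarrow> complex"
  shows "(f has_vector_derivative L) (at t) \<longleftrightarrow> ((\<lambda>h. (f (t + h) - f t) / of_real h) \<longlongrightarrow> L) (at 0)"
proof -
  have "(f has_vector_derivative L) (at t) \<longleftrightarrow>
      ((\<lambda>h. norm (f (t + h) - f t - h *\<^sub>R L) / norm h) \<longlongrightarrow> 0) (at 0)"
    unfolding has_vector_derivative_def has_derivative_at by (simp add: bounded_linear_scaleR_left)
  also have "\<dots> \<longleftrightarrow> ((\<lambda>h. norm ((f (t + h) - f t) / of_real h - L)) \<longlongrightarrow> 0) (at 0)"
  proof (rule filterlim_cong[OF refl refl])
    have "norm (f (t + h) - f t - h *\<^sub>R L) / norm h = norm ((f (t + h) - f t) / of_real h - L)"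
      if "h \<noteq> 0" for h
    proof -
      have "(f (t + h) - f t) / of_real h - L = (f (t + h) - f t - h *\<^sub>R L) / of_real h"
        using that by (simp add: field_simps scaleR_conv_of_real)
      then show ?thesis by (simp add: norm_divide)
    qed
    then show "\<forall>\<^sub>F h in at 0. norm (f (t + h) - f t - h *\<^sub>R L) / norm h =
        norm ((f (t + h) - f t) / of_real h - L)"
      by (intro eventually_at_filter[THEN iffD2] always_eventually) simp
  qed
  also have "\<dots> \<longleftrightarrow> ((\<lambda>h. (f (t + h) - f t) / of_real h) \<longlongrightarrow> L) (at 0)"
    by (simp add: tendsto_norm_zero_iff LIM_zero_iff)
  finally show ?thesis .
qed

text \<open>
  Differentiability at \<open>t\<close> is the Cauchy condition for the difference quotients as the increment tends
  to 0. For fixed bounds on the increments and on the oscillation, this condition defines a closed set, since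
  each quotient is continuous in \<open>t\<close>; only countably many bounds are needed.
\<close>

lemma differentiability_set_borel:
  fixes f :: "real \<Rightarrow> complex"
  assumes f: "continuous_on UNIV f"
  shows "{t. \<exists>L. (f has_vector_derivative L) (at t)} \<in> sets borel"
proof -
  define q where "q h t = (f (t + h) - f t) / of_real h" for h t
  define \<delta> where "\<delta> k = inverse (real (Suc k))" for k
  have \<delta>: "\<delta> k > 0" for k by (simp add: \<delta>_def)
  have \<delta>0: "\<delta> \<longlonglongrightarrow> 0" unfolding \<delta>_def by (rule LIMSEQ_inverse_real_of_nat)
  define E where "E n k = (\<Inter>h\<in>{h. h \<noteq> 0 \<and> \<bar>h\<bar> < \<delta> k}. \<Inter>h'\<in>{h. h \<noteq> 0 \<and> \<bar>h\<bar> < \<delta> k}.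
      {t. norm (q h t - q h' t) \<le> \<delta> n})" for n k
  have closed: "closed (E n k)" for n k
    unfolding E_def
  proof (intro closed_INT ballI)
    fix h h' assume "h \<in> {h. h \<noteq> 0 \<and> \<bar>h\<bar> < \<delta> k}" "h' \<in> {h. h \<noteq> 0 \<and> \<bar>h\<bar> < \<delta> k}"
    then show "closed {t. norm (q h t - q h' t) \<le> \<delta> n}"
      unfolding q_def
      by (intro closed_Collect_le continuous_intros continuous_on_compose2[OF f]) auto
  qed
  have "(\<exists>L. (f has_vector_derivative L) (at t)) \<longleftrightarrow> t \<in> (\<Inter>n. \<Union>k. E n k)" for t
  proof
    assume "\<exists>L. (f has_vector_derivative L) (at t)"
    then obtain L where L: "((\<lambda>h. q h t) \<longlongrightarrow> L) (at 0)"
      unfolding has_vector_derivative_iff_quotient_tendsto q_def by blast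
    show "t \<in> (\<Inter>n. \<Union>k. E n k)"
    proof
      fix n
      obtain d where d: "d > 0" "\<And>h. h \<noteq> 0 \<Longrightarrow> \<bar>h\<bar> < d \<Longrightarrow> dist (q h t) L < \<delta> n / 2"
        using tendstoD[OF L, of "\<delta> n / 2"] \<delta>[of n] unfolding eventually_at by auto
      obtain k where k: "\<delta> k < d"
        unfolding \<delta>_def using reals_Archimedean[OF d(1)] by blast
      have "norm (q h t - q h' t) \<le> \<delta> n" if "h \<noteq> 0" "\<bar>h\<bar> < \<delta> k" "h' \<noteq> 0" "\<bar>h'\<bar> < \<delta> k" for h h'
      proof -
        have "dist (q h t) L < \<delta> n / 2" "dist (q h' t) L < \<delta> n / 2"
          using d(2) that k by auto
        then have "dist (q h t) (q h' t) < \<delta> n" by (rule dist_triangle_half_l)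
        then show ?thesis by (simp add: dist_norm)
      qed
      then show "t \<in> (\<Union>k. E n k)" by (auto simp: E_def)
    qed
  next
    assume t: "t \<in> (\<Inter>n. \<Union>k. E n k)"
    have *: "\<exists>k. \<forall>h h'. h \<noteq> 0 \<longrightarrow> \<bar>h\<bar> < \<delta> k \<longrightarrow> h' \<noteq> 0 \<longrightarrow> \<bar>h'\<bar> < \<delta> k \<longrightarrow> norm (q h t - q h' t) \<le> \<delta> n" for n
    proof -
      obtain k where "t \<in> E n k" using t by blast
      then show ?thesis by (intro exI[of _ k]) (simp add: E_def)
    qed
    have small: "\<exists>N. \<forall>m\<ge>N. \<delta> m < \<delta> k" for k
      using order_tendstoD(2)[OF \<delta>0 \<delta>[of k]] by (simp add: eventually_sequentially)
    have "Cauchy (\<lambda>m. q (\<delta> m) t)"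
    proof (rule metric_CauchyI)
      fix e :: real assume "e > 0"
      then obtain n where n: "\<delta> n < e" unfolding \<delta>_def using reals_Archimedean by blast
      obtain k where k: "\<And>h h'. h \<noteq> 0 \<Longrightarrow> \<bar>h\<bar> < \<delta> k \<Longrightarrow> h' \<noteq> 0 \<Longrightarrow> \<bar>h'\<bar> < \<delta> k \<Longrightarrow> norm (q h t - q h' t) \<le> \<delta> n"
        using *[of n] by blast
      obtain N where N: "\<And>m. m \<ge> N \<Longrightarrow> \<delta> m < \<delta> k" using small[of k] by blast
      have "dist (q (\<delta> m) t) (q (\<delta> m') t) < e" if "m \<ge> N" "m' \<ge> N" for m m'
      proof -
        have "norm (q (\<delta> m) t - q (\<delta> m') t) \<le> \<delta> n"
          using N[OF that(1)] N[OF that(2)] \<delta>[of m] \<delta>[of m'] by (intro k) auto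
        then show ?thesis using n by (simp add: dist_norm)
      qed
      then show "\<exists>M. \<forall>m\<ge>M. \<forall>n\<ge>M. dist (q (\<delta> m) t) (q (\<delta> n) t) < e" by blast
    qed
    then obtain L where L: "(\<lambda>m. q (\<delta> m) t) \<longlonglongrightarrow> L"
      using Cauchy_convergent convergent_def by blast
    have "((\<lambda>h. q h t) \<longlongrightarrow> L) (at 0)"
    proof (rule tendstoI)
      fix e :: real assume "e > 0"
      then obtain n where n: "\<delta> n < e" unfolding \<delta>_def using reals_Archimedean by blast
      obtain k where k: "\<And>h h'. h \<noteq> 0 \<Longrightarrow> \<bar>h\<bar> < \<delta> k \<Longrightarrow> h' \<noteq> 0 \<Longrightarrow> \<bar>h'\<bar> < \<delta> k \<Longrightarrow> norm (q h t - q h' t) \<le> \<delta> n"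
        using *[of n] by blast
      obtain N where N: "\<And>m. m \<ge> N \<Longrightarrow> \<delta> m < \<delta> k" using small[of k] by blast
      have "dist (q h t) L < e" if h: "h \<noteq> 0" "\<bar>h\<bar> < \<delta> k" for h
      proof -
        have "norm (q h t - L) \<le> \<delta> n"
        proof (rule tendsto_upperbound)
          show "(\<lambda>m. norm (q h t - q (\<delta> m) t)) \<longlonglongrightarrow> norm (q h t - L)"
            by (intro tendsto_intros L)
          show "\<forall>\<^sub>F m in sequentially. norm (q h t - q (\<delta> m) t) \<le> \<delta> n"
          proof (rule eventually_sequentiallyI)
            fix m assume "m \<ge> N"
            then show "norm (q h t - q (\<delta> m) t) \<le> \<delta> n"
              using N[of m] \<delta>[of m] by (intro k h) auto
          qed
        qed simp
        then show ?thesis using n by (simp add: dist_norm)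
      qed
      then show "\<forall>\<^sub>F h in at 0. dist (q h t) L < e"
        unfolding eventually_at using \<delta>[of k] by (intro exI[of _ "\<delta> k"]) auto
    qed
    then show "\<exists>L. (f has_vector_derivative L) (at t)"
      unfolding has_vector_derivative_iff_quotient_tendsto q_def by blast
  qed
  then have "{t. \<exists>L. (f has_vector_derivative L) (at t)} = (\<Inter>n. \<Union>k. E n k)" by blast
  moreover have "(\<Inter>n. \<Union>k. E n k) \<in> sets borel"
    by (intro sets.countable_INT'' sets.countable_UN) (auto intro: borel_closed closed)
  ultimately show ?thesis by simp
qed

text \<open>
  The choice operator gives the same default value at every point where the path is not differentiable.
\<close>

lemma velocity_cases:
  obtains L where "(c has_vector_derivative L) (at t within {0..1})" "velocity c t = L"
  | "velocity c t = (SOME L. False)"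
proof (cases "\<exists>L. (c has_vector_derivative L) (at t within {0..1})")
  case True
  then have "(c has_vector_derivative velocity c t) (at t within {0..1})"
    unfolding velocity_def vector_derivative_def by (rule someI_ex)
  then show ?thesis using that(1) by blast
next
  case False
  then show ?thesis using that(2) by (simp add: velocity_def vector_derivative_def)
qed

text \<open>
  On the Borel set of points of differentiability the velocity is a limit of continuous difference
  quotients, and off that set it is constant.
\<close>

lemma velocity_measurable:
  assumes c: "continuous_on {0..1} c"
  shows "velocity c \<in> borel_measurable (lebesgue_on {0..1})"
proof -
  \<comment> \<open>A continuous extension to the real line, with the same derivative in the open interval.\<close>
  define f where "f t = c (max 0 (min 1 t))" for t
  have f: "continuous_on UNIV f"
    unfolding f_def by (intro continuous_on_compose2[OF c] continuous_intros) auto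
  define D where "D = {t. \<exists>L. (f has_vector_derivative L) (at t)}"
  have [measurable]: "D \<in> sets borel"
    unfolding D_def by (rule differentiability_set_borel[OF f])
  have [measurable]: "f \<in> borel_measurable borel"
    by (rule borel_measurable_continuous_onI[OF f])
  define \<delta> where "\<delta> k = inverse (real (Suc k))" for k
  have \<delta>: "filterlim \<delta> (at 0) sequentially"
    unfolding \<delta>_def by (intro filterlim_atI LIMSEQ_inverse_real_of_nat) simp
  define v where "v t = (if t = 0 then velocity c 0 else if t = 1 then velocity c 1
      else if t \<in> D then lim (\<lambda>k. (f (t + \<delta> k) - f t) / of_real (\<delta> k)) else (SOME L. False))" for t
  have v: "v \<in> borel_measurable borel"
    unfolding v_def by measurable
  have eq: "velocity c t = v t" if t: "t \<in> {0..1}" for t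
  proof (cases "t = 0 \<or> t = 1")
    case False
    then have t01: "t \<in> {0<..<1}" using t by auto
    have at: "at t within {0..1} = at t"
      using t01 by (intro at_within_interior) (simp add: interior_atLeastAtMost_real)
    have iff: "(c has_vector_derivative L) (at t within {0..1}) \<longleftrightarrow> (f has_vector_derivative L) (at t)" for L
      unfolding at
      using has_vector_derivative_transform_within_open[of c L t "{0<..<1}" f]
        has_vector_derivative_transform_within_open[of f L t "{0<..<1}" c] t01
      by (auto simp: f_def)
    show ?thesis
    proof (cases "t \<in> D")
      case True
      then obtain L where L: "(f has_vector_derivative L) (at t)" by (auto simp: D_def)
      then have "velocity c t = L"
        using iff[of L] vector_derivative_within_cbox[of 0 1 t c L] t by (simp add: velocity_def)
      moreover have "lim (\<lambda>k. (f (t + \<delta> k) - f t) / of_real (\<delta> k)) = L"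
        using L unfolding has_vector_derivative_iff_quotient_tendsto
        by (intro limI filterlim_compose[OF _ \<delta>])
      ultimately show ?thesis using True False by (simp add: v_def)
    next
      case False': False
      then have "\<not> (c has_vector_derivative L) (at t within {0..1})" for L
        unfolding iff by (auto simp: D_def)
      then show ?thesis using False False'
        by (simp add: v_def velocity_def vector_derivative_def)
    qed
  qed (auto simp: v_def)
  have "v \<in> borel_measurable (lebesgue_on {0..1})"
    using v by (intro measurable_restrict_space1 measurable_completion) simp
  then show ?thesis
    by (rule measurable_cong[THEN iffD1, rotated]) (simp add: eq)
qed

text \<open>
  The Lipschitz constant bounds the derivative, and the default value is the same everywhere.
\<close>

lemma velocity_bounded:
  assumes L: "L-lipschitz_on {0..1} c"
  obtains B where "B \<ge> 0" "\<And>t. t \<in> {0..1} \<Longrightarrow> norm (velocity c t) \<le> B"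
proof -
  have "norm (velocity c t) \<le> max L (norm (SOME L::complex. False))" if t: "t \<in> {0..1}" for t
  proof (cases rule: velocity_cases[of c t])
    case (1 D)
    have lim: "((\<lambda>y. norm ((1 / norm (y - t)) *\<^sub>R (c y - (c t + (y - t) *\<^sub>R D))) + L) \<longlongrightarrow> 0 + L) (at t within {0..1})"
      using 1(1) unfolding has_vector_derivative_def has_derivative_within
      by (intro tendsto_intros tendsto_norm_zero) auto
    have "norm D \<le> 0 + L"
    proof (rule tendsto_lowerbound[OF lim])
      show "\<forall>\<^sub>F y in at t within {0..1}. norm D \<le> norm ((1 / norm (y - t)) *\<^sub>R (c y - (c t + (y - t) *\<^sub>R D))) + L"
        unfolding eventually_at_filter
      proof (rule always_eventually, intro allI impI)
        fix y assume y: "y \<noteq> t" "y \<in> {0..1}"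
        have "norm ((y - t) *\<^sub>R D) \<le> norm (c y - (c t + (y - t) *\<^sub>R D)) + norm (c y - c t)"
          using norm_triangle_ineq4[of "c y - c t" "c y - (c t + (y - t) *\<^sub>R D)"]
          by (simp add: algebra_simps)
        also have "norm (c y - c t) \<le> L * \<bar>y - t\<bar>"
          using lipschitz_onD[OF L y(2) t] by (simp add: dist_norm)
        finally have "\<bar>y - t\<bar> * norm D \<le> norm (c y - (c t + (y - t) *\<^sub>R D)) + L * \<bar>y - t\<bar>"
          by simp
        then have "norm D \<le> norm (c y - (c t + (y - t) *\<^sub>R D)) / \<bar>y - t\<bar> + L"
          using y(1) by (simp add: field_simps del: scaleR_left_diff_distrib)
        then show "norm D \<le> norm ((1 / norm (y - t)) *\<^sub>R (c y - (c t + (y - t) *\<^sub>R D))) + L"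
          by (simp only: norm_scaleR) simp
      qed
      show "at t within {0..1} \<noteq> bot"
        using t by (simp add: trivial_limit_within islimpt_Icc)
    qed
    then show ?thesis using 1 by simp
  qed simp
  then show ?thesis
    using that[of "max L (norm (SOME L::complex. False))"] by (simp add: le_max_iff_disj)
qed

text \<open>
  The second part follows from square-integrability because the path has finite length. The majorants
  of the kernels on the contours are built from these integrable functions.
\<close>

lemma L2_on_composition:
  assumes L: "L-lipschitz_on {0..1} c" and f: "f \<in> L2_on c"
  shows "(\<lambda>t. f (c t)) \<in> borel_measurable (lebesgue_on {0..1})"
    and "integrable (lebesgue_on {0..1}) (\<lambda>t. norm (f (c t)) * norm (velocity c t))"
proof -
  have cont: "continuous_on {0..1} c" by (rule lipschitz_on_continuous_on[OF L])
  note [measurable] = velocity_measurable[OF cont]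
  have "c \<in> borel_measurable (lebesgue_on {0..1})"
    by (rule continuous_imp_measurable_on_sets_lebesgue[OF cont]) simp
  then have c [measurable]: "c \<in> lebesgue_on {0..1} \<rightarrow>\<^sub>M restrict_space borel (path_image c)"
    by (intro measurable_restrict_space2) (auto simp: path_image_def)
  have f' [measurable]: "f \<in> borel_measurable (restrict_space borel (path_image c))"
    using f by (simp add: L2_on_def arc_length_measure_def)
  show meas [measurable]: "(\<lambda>t. f (c t)) \<in> borel_measurable (lebesgue_on {0..1})"
    by measurable
  have "integrable (arc_length_measure c) (\<lambda>z. (norm (f z))\<^sup>2)"
    using f by (simp add: L2_on_def)
  then have "integrable (density (lebesgue_on {0..1}) (\<lambda>t. ennreal (norm (velocity c t)))) (\<lambda>t. (norm (f (c t)))\<^sup>2)"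
    unfolding arc_length_measure_def by (subst (asm) integrable_distr_eq) auto
  then have sq: "integrable (lebesgue_on {0..1}) (\<lambda>t. norm (velocity c t) * (norm (f (c t)))\<^sup>2)"
    by (subst (asm) integrable_density) auto
  interpret finite_measure "lebesgue_on {0..1::real}"
    by (rule finite_measure_lebesgue_on) auto
  obtain B where B: "\<And>t. t \<in> {0..1} \<Longrightarrow> norm (velocity c t) \<le> B"
    using velocity_bounded[OF L] by blast
  have "integrable (lebesgue_on {0..1}) (\<lambda>t. norm (velocity c t))"
    by (rule integrable_const_bound[of _ B]) (auto intro!: AE_I2 B)
  then have dom: "integrable (lebesgue_on {0..1}) (\<lambda>t. norm (velocity c t) * (norm (f (c t)))\<^sup>2 + norm (velocity c t))"
    using sq by (intro Bochner_Integration.integrable_add)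
  show "integrable (lebesgue_on {0..1}) (\<lambda>t. norm (f (c t)) * norm (velocity c t))"
  proof (rule Bochner_Integration.integrable_bound[OF dom])
    have "a * b \<le> b * a\<^sup>2 + b" if "a \<ge> 0" "b \<ge> 0" for a b :: real
    proof -
      have "a \<le> a\<^sup>2 + 1" using sum_squares_bound[of a 1] that by (simp add: power2_eq_square)
      then have "b * a \<le> b * (a\<^sup>2 + 1)" using that by (intro mult_left_mono)
      then show ?thesis by (simp add: algebra_simps)
    qed
    then show "AE t in lebesgue_on {0..1}. norm (norm (f (c t)) * norm (velocity c t))
        \<le> norm (norm (velocity c t) * (norm (f (c t)))\<^sup>2 + norm (velocity c t))"
      by (intro AE_I2) simp
  qed measurable
qed

section \<open>Kernels on the integers with geometrically decaying rows\<close>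

text \<open>
  Distinct integers above \<open>a\<close> are at total distance at least \<open>0 + 1 + \<dots> + (p - 1)\<close> from \<open>a\<close>.
\<close>

lemma sum_int_injective_lower_bound:
  fixes x :: "nat \<Rightarrow> int"
  assumes inj: "inj_on x {..<p}" and a: "\<And>i. i < p \<Longrightarrow> a \<le> x i"
  shows "\<Sum>{0..<p} \<le> (\<Sum>i<p. nat (x i - a))"
proof -
  have inj': "inj_on (\<lambda>i. nat (x i - a)) {..<p}"
  proof (rule inj_onI)
    fix i j assume "i \<in> {..<p}" "j \<in> {..<p}" "nat (x i - a) = nat (x j - a)"
    then show "i = j" using a[of i] a[of j] inj_onD[OF inj, of i j] by simp
  qed
  have "\<Sum>{0..<p} \<le> \<Sum>((\<lambda>i. nat (x i - a)) ` {..<p})"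
    using card_sum_le_nat_sum[of "(\<lambda>i. nat (x i - a)) ` {..<p}"] card_image[OF inj'] by simp
  also have "\<dots> = (\<Sum>i<p. nat (x i - a))"
    using sum.reindex[OF inj', of "\<lambda>n. n"] by simp
  finally show ?thesis .
qed

lemma summable_power_triangular:
  fixes X s :: real
  assumes X: "X \<ge> 0" and s: "0 \<le> s" "s < 1"
  shows "summable (\<lambda>p. X ^ p * s ^ \<Sum>{0..<p})"
proof -
  have "(\<lambda>p. X * s ^ p) \<longlonglongrightarrow> X * 0"
    using s by (intro tendsto_intros LIMSEQ_power_zero) auto
  then have "\<forall>\<^sub>F p in sequentially. X * s ^ p < 1 / 2"
    by (rule order_tendstoD) simp
  then obtain N where N: "\<And>p. p \<ge> N \<Longrightarrow> X * s ^ p < 1 / 2"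
    by (auto simp: eventually_sequentially)
  show ?thesis
  proof (rule summable_ratio_test[of "1/2" N])
    fix p assume "p \<ge> N"
    then have "(X * s ^ p) * (X ^ p * s ^ \<Sum>{0..<p}) \<le> 1 / 2 * (X ^ p * s ^ \<Sum>{0..<p})"
      using N[of p] X s by (intro mult_right_mono) auto
    then show "norm (X ^ Suc p * s ^ \<Sum>{0..<Suc p}) \<le> 1 / 2 * norm (X ^ p * s ^ \<Sum>{0..<p})"
      using X s by (simp add: power_add abs_mult mult_ac)
  qed simp
qed

definition geometric_weight :: "int \<Rightarrow> real \<Rightarrow> int \<Rightarrow> real" where
  "geometric_weight a s n = (if a \<le> n then s ^ nat (n - a) else 0)"

lemma geometric_weight_nonneg: "0 \<le> s \<Longrightarrow> 0 \<le> geometric_weight a s n"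
  by (simp add: geometric_weight_def)

lemma geometric_weight_integrable:
  assumes s: "0 \<le> s" "s < 1"
  shows "integrable (count_space UNIV) (geometric_weight a s)"
proof -
  have "Infinite_Sum.abs_summable_on (\<lambda>n::nat. s ^ n) UNIV"
    using s by (auto intro!: norm_summable_imp_summable_on simp: summable_geometric)
  moreover have "bij_betw (\<lambda>n. nat (n - a)) {a..} UNIV"
    by (rule bij_betw_byWitness[of _ "\<lambda>m. a + int m"]) auto
  ultimately have "Infinite_Sum.abs_summable_on (\<lambda>n. s ^ nat (n - a)) {a..}"
    using summable_on_reindex_bij_betw[of "\<lambda>n. nat (n - a)" "{a..}" UNIV "\<lambda>n. norm (s ^ n)"] by simp
  then have "Infinite_Sum.abs_summable_on (geometric_weight a s) UNIV"
    by (rule summable_on_cong_neutral[THEN iffD1, rotated -1]) (auto simp: geometric_weight_def)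
  then show ?thesis
    unfolding abs_summable_equivalent Infinite_Set_Sum.abs_summable_on_def .
qed

lemma sigma_finite_count_int: "sigma_finite_measure (count_space (UNIV :: int set))"
  by (rule sigma_finite_measure_count_space)

text \<open>
  The \<open>p!\<close> terms of the Leibniz expansion cancel the factor \<open>1 / p!\<close>, and convergence comes from the
  rows being distinct. The weight \<open>s\<^sup>2\<close> per unit of distance is split into two halves: one yields the
  factor \<open>s ^ \<Sum>{0..<p}\<close> by distinctness, the other is summed over all rows.
\<close>

lemma minor_integral_geometric_rows_bound:
  fixes T :: "int \<Rightarrow> int \<Rightarrow> complex" and p :: nat
  assumes s: "0 \<le> s" "s < 1" and C: "C \<ge> 0"
    and T: "\<And>n n'. norm (T n n') \<le> C * geometric_weight a (s\<^sup>2) n"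
  shows "norm (1 / fact p * minor_integral (count_space UNIV) {..<p} T) \<le>
    (C * integral\<^sup>L (count_space UNIV) (geometric_weight a s)) ^ p * s ^ \<Sum>{0..<p}"
proof -
  let ?Z = "count_space (UNIV :: int set)"
  interpret sigma_finite_measure ?Z by (rule sigma_finite_count_int)
  interpret product_sigma_finite "\<lambda>_. ?Z" ..
  have s2: "0 \<le> s\<^sup>2" "s\<^sup>2 < 1" using s by (auto simp: power_less_one_iff abs_square_less_1)
  have int: "integrable ?Z (\<lambda>n. C * geometric_weight a (s\<^sup>2) n * 1)"
    using geometric_weight_integrable[OF s2] by simp
  have int_w: "integrable ?Z (\<lambda>n. C * geometric_weight a s n)"
    using geometric_weight_integrable[OF s] by simp
  have dom: "integrable (PiM {..<p} (\<lambda>_. ?Z)) (\<lambda>x. \<Prod>i<p. C * geometric_weight a s (x i))"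
    by (rule product_integrable_prod[OF _ int_w]) simp
  have bound: "norm (leibniz_det {..<p} T x) \<le> (fact p * s ^ \<Sum>{0..<p}) * (\<Prod>i<p. C * geometric_weight a s (x i))" for x
  proof (cases "inj_on x {..<p} \<and> (\<forall>i<p. a \<le> x i)")
    case True
    have "norm (leibniz_det {..<p} T x) \<le> (\<Sum>\<sigma> | \<sigma> permutes {..<p}. norm (of_int (sign \<sigma>) * (\<Prod>i<p. T (x i) (x (\<sigma> i)))))"
      unfolding leibniz_det_def by (rule norm_sum)
    also have "\<dots> \<le> (\<Sum>\<sigma> | \<sigma> permutes {..<p}. \<Prod>i<p. C * geometric_weight a (s\<^sup>2) (x i))"
    proof (rule sum_mono)
      fix \<sigma>
      have "norm (of_int (sign \<sigma>) * (\<Prod>i<p. T (x i) (x (\<sigma> i)))) = (\<Prod>i<p. norm (T (x i) (x (\<sigma> i))))"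
        by (cases \<sigma> rule: sign_cases) (simp_all add: norm_mult flip: prod_norm)
      also have "\<dots> \<le> (\<Prod>i<p. C * geometric_weight a (s\<^sup>2) (x i))"
        by (intro prod_mono conjI norm_ge_zero T)
      finally show "norm (of_int (sign \<sigma>) * (\<Prod>i<p. T (x i) (x (\<sigma> i)))) \<le> (\<Prod>i<p. C * geometric_weight a (s\<^sup>2) (x i))" .
    qed
    also have "\<dots> = fact p * (\<Prod>i<p. C * geometric_weight a (s\<^sup>2) (x i))"
      using card_permutations[of "{..<p}" p] by simp
    also have "(\<Prod>i<p. C * geometric_weight a (s\<^sup>2) (x i)) =
        s ^ (\<Sum>i<p. nat (x i - a)) * (\<Prod>i<p. C * geometric_weight a s (x i))"
    proof -
      have "(\<Prod>i<p. C * geometric_weight a (s\<^sup>2) (x i)) =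
          (\<Prod>i<p. s ^ nat (x i - a) * (C * geometric_weight a s (x i)))"
        using True by (intro prod.cong refl)
          (auto simp: geometric_weight_def power2_eq_square power_mult_distrib)
      then show ?thesis by (simp add: prod.distrib power_sum)
    qed
    also have "fact p * (s ^ (\<Sum>i<p. nat (x i - a)) * (\<Prod>i<p. C * geometric_weight a s (x i))) \<le>
        fact p * (s ^ \<Sum>{0..<p} * (\<Prod>i<p. C * geometric_weight a s (x i)))"
      using sum_int_injective_lower_bound[of x p a] True s C
      by (intro mult_left_mono mult_right_mono power_decreasing prod_nonneg)
         (auto simp: geometric_weight_nonneg)
    finally show ?thesis by (simp add: mult.assoc)
  next
    case False
    have "leibniz_det {..<p} T x = 0"
    proof (cases "inj_on x {..<p}")
      case inj: True
      then obtain i where i: "i < p" "\<not> a \<le> x i" using False by blast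
      have "T (x i) n' = 0" for n'
        using T[of "x i" n'] i by (simp add: geometric_weight_def)
      then have zero: "(\<Prod>i<p. T (x i) (x (\<sigma> i))) = 0" for \<sigma>
        using i(1) by (intro prod_zero) auto
      show ?thesis unfolding leibniz_det_def zero by simp
    next
      case False
      then show ?thesis by (rule leibniz_det_eq_0_if_not_injective)
    qed
    then show ?thesis
      using s C by (auto intro!: mult_nonneg_nonneg prod_nonneg simp: geometric_weight_nonneg)
  qed
  have "norm (minor_integral ?Z {..<p} T) \<le> (\<integral>x. norm (leibniz_det {..<p} T x) \<partial>PiM {..<p} (\<lambda>_. ?Z))"
    unfolding minor_integral_def by (rule integral_norm_bound)
  also have "\<dots> \<le> (\<integral>x. (fact p * s ^ \<Sum>{0..<p}) * (\<Prod>i<p. C * geometric_weight a s (x i)) \<partial>PiM {..<p} (\<lambda>_. ?Z))"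
  proof (rule integral_mono)
    show "integrable (PiM {..<p} (\<lambda>_. ?Z)) (\<lambda>x. norm (leibniz_det {..<p} T x))"
      by (intro integrable_norm leibniz_det_integrable[OF sigma_finite_count_int _ _ _ int])
         (use T in \<open>auto simp: pair_measure_countable\<close>)
    show "integrable (PiM {..<p} (\<lambda>_. ?Z)) (\<lambda>x. (fact p * s ^ \<Sum>{0..<p}) * (\<Prod>i<p. C * geometric_weight a s (x i)))"
      by (intro integrable_mult_right dom)
  qed (rule bound)
  also have "\<dots> = (fact p * s ^ \<Sum>{0..<p}) * (\<integral>x. (\<Prod>i<p. C * geometric_weight a s (x i)) \<partial>PiM {..<p} (\<lambda>_. ?Z))"
    by (rule Bochner_Integration.integral_mult_right_zero)
  also have "(\<integral>x. (\<Prod>i<p. C * geometric_weight a s (x i)) \<partial>PiM {..<p} (\<lambda>_. ?Z)) =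
      (C * integral\<^sup>L ?Z (geometric_weight a s)) ^ p"
    by (subst product_integral_prod[OF _ int_w]) simp_all
  finally show ?thesis
    by (simp add: norm_divide field_simps)
qed

lemma minor_integral_count_space:
  fixes T :: "int \<Rightarrow> int \<Rightarrow> complex" and p :: nat
  assumes bound: "\<And>n n'. norm (T n n') \<le> \<phi> n" and int: "integrable (count_space UNIV) \<phi>"
  shows "leibniz_det {..<p} T summable_on ({..<p} \<rightarrow>\<^sub>E UNIV)"
    and "(\<Sum>\<^sub>\<infinity>x\<in>{..<p} \<rightarrow>\<^sub>E UNIV. leibniz_det {..<p} T x) = minor_integral (count_space UNIV) {..<p} T"
proof -
  have PiM: "PiM {..<p} (\<lambda>_. count_space (UNIV :: int set)) = count_space ({..<p} \<rightarrow>\<^sub>E UNIV)"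
    by (rule count_space_PiM_finite) auto
  have "integrable (PiM {..<p} (\<lambda>_. count_space (UNIV :: int set))) (leibniz_det {..<p} T)"
    by (rule leibniz_det_integrable[OF sigma_finite_count_int, where \<phi> = \<phi> and \<psi> = "\<lambda>_. 1"])
       (use bound int in \<open>auto simp: pair_measure_countable\<close>)
  then have "Infinite_Set_Sum.abs_summable_on (leibniz_det {..<p} T) ({..<p} \<rightarrow>\<^sub>E UNIV)"
    unfolding PiM Infinite_Set_Sum.abs_summable_on_def .
  then have abs: "Infinite_Sum.abs_summable_on (leibniz_det {..<p} T) ({..<p} \<rightarrow>\<^sub>E UNIV)"
    by (simp add: abs_summable_equivalent)
  then show "leibniz_det {..<p} T summable_on ({..<p} \<rightarrow>\<^sub>E UNIV)"
    by (rule abs_summable_summable)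
  show "(\<Sum>\<^sub>\<infinity>x\<in>{..<p} \<rightarrow>\<^sub>E UNIV. leibniz_det {..<p} T x) = minor_integral (count_space UNIV) {..<p} T"
    using infsetsum_infsum[OF abs[unfolded abs_summable_equivalent]]
    by (simp add: minor_integral_def PiM infsetsum_def)
qed

section \<open>Integration over a union of contours\<close>

abbreviation unit_interval_measure :: "real measure" where
  "unit_interval_measure \<equiv> lebesgue_on {0..1}"

lemma finite_unit_interval_measure: "finite_measure unit_interval_measure"
  by (rule finite_measure_lebesgue_on) auto

lemma sigma_finite_contour_parameters:
  assumes "finite J"
  shows "sigma_finite_measure (contour_parameters J)"
  unfolding contour_parameters_def
  by (intro sigma_finite_pair_measure sigma_finite_measure_count_space_finite assms
      finite_measure.axioms(1)[OF finite_unit_interval_measure])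

lemma space_contour_parameters: "space (contour_parameters J) = J \<times> {0..1}"
  by (simp add: contour_parameters_def space_pair_measure)

lemma contour_parameters_fst: "fst \<in> contour_parameters J \<rightarrow>\<^sub>M count_space UNIV"
proof -
  have "fst \<in> contour_parameters J \<rightarrow>\<^sub>M count_space J"
    unfolding contour_parameters_def by measurable
  from measurable_compose[OF this, of "\<lambda>x. x" "count_space UNIV"] show ?thesis by simp
qed

lemma contour_parameters_snd: "snd \<in> contour_parameters J \<rightarrow>\<^sub>M unit_interval_measure"
  unfolding contour_parameters_def by measurable

lemma integral_over_one_contour:
  fixes f :: "real \<Rightarrow> 'b::{banach, second_countable_topology}"
  assumes J: "finite J" "j \<in> J" and f: "integrable unit_interval_measure f"
  shows "integrable (contour_parameters J) (\<lambda>x. if fst x = j then f (snd x) else 0)"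
    and "(\<integral>x. (if fst x = j then f (snd x) else 0) \<partial>contour_parameters J) = integral\<^sup>L unit_interval_measure f"
proof -
  interpret \<Lambda>: finite_measure unit_interval_measure by (rule finite_unit_interval_measure)
  interpret J: sigma_finite_measure "count_space J"
    by (rule sigma_finite_measure_count_space_finite[OF J(1)])
  interpret pair_sigma_finite "count_space J" unit_interval_measure ..
  note [measurable] = borel_measurable_integrable[OF f] contour_parameters_fst contour_parameters_snd
  let ?f = "\<lambda>x. if fst x = j then f (snd x) else 0"
  have inner: "integrable unit_interval_measure (\<lambda>t. ?f (i, t))" for i
    using f by (cases "i = j") auto
  have "integrable (count_space J \<Otimes>\<^sub>M unit_interval_measure) ?f"
  proof (rule Fubini_integrable)
    show "?f \<in> borel_measurable (count_space J \<Otimes>\<^sub>M unit_interval_measure)"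
      unfolding contour_parameters_def[symmetric] by measurable
  qed (use inner J in \<open>auto simp: integrable_count_space\<close>)
  then show int: "integrable (contour_parameters J) ?f"
    by (simp add: contour_parameters_def)
  have "integral\<^sup>L (contour_parameters J) ?f = (\<integral>i. (\<integral>t. ?f (i, t) \<partial>unit_interval_measure) \<partial>count_space J)"
    using int unfolding contour_parameters_def by (rule integral_fst'[symmetric])
  also have "\<dots> = (\<Sum>i\<in>J. \<integral>t. ?f (i, t) \<partial>unit_interval_measure)"
    by (rule lebesgue_integral_count_space_finite[OF J(1)])
  also have "\<dots> = (\<Sum>i\<in>J. if i = j then integral\<^sup>L unit_interval_measure f else 0)"
    by (intro sum.cong) auto
  also have "\<dots> = integral\<^sup>L unit_interval_measure f"
    using J by simp
  finally show "integral\<^sup>L (contour_parameters J) ?f = integral\<^sup>L unit_interval_measure f" .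
qed

text \<open>
  The contour integral is a gauge integral against the same velocity.
\<close>

lemma contour_integral_eq_lebesgue:
  assumes "integrable unit_interval_measure (\<lambda>t. f (c t) * velocity c t)"
  shows "contour_integral c f = (\<integral>t. f (c t) * velocity c t \<partial>unit_interval_measure)"
  using has_integral_integral_lebesgue_on[OF assms]
  by (intro contour_integral_unique) (simp add: has_contour_integral_def velocity_def)

section \<open>Factorization through the unit circle, the outer contour and the modes\<close>

text \<open>
  The bound \<open>r > 1\<close> keeps the contours apart and gives the geometric decay in \<open>n\<close>, which also needs
  \<open>\<Gamma>\<close> to vanish to the left of some integer \<open>a\<close>.
\<close>

locale circle_and_outer_contour =
  fixes c :: "nat \<Rightarrow> real \<Rightarrow> complex" and d :: nat and g h :: "nat \<Rightarrow> complex \<Rightarrow> complex"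
    and r :: real and \<Gamma> :: "int \<Rightarrow> complex" and C\<^sub>\<Gamma> :: real and a :: int
  assumes lipschitz: "\<And>j. j \<in> {1, 2} \<Longrightarrow> \<exists>L. L-lipschitz_on {0..1} (c j)"
    and circle: "\<And>t. t \<in> {0..1} \<Longrightarrow> norm (c 1 t) = 1"
    and outer: "\<And>t. t \<in> {0..1} \<Longrightarrow> r \<le> norm (c 2 t)" and r: "1 < r"
    and g_L2: "\<And>i. i \<in> {1..d} \<Longrightarrow> g i \<in> L2_on (c 2)"
    and h_L2: "\<And>i. i \<in> {1..d} \<Longrightarrow> h i \<in> L2_on (c 1)"
    and \<Gamma>_bound: "\<And>n. norm (\<Gamma> n) \<le> (if a \<le> n then C\<^sub>\<Gamma> else 0)"
begin

abbreviation "G \<equiv> finite_rank_symbol d g h"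
abbreviation "X \<equiv> contour_parameters {1, 2 :: nat}"
abbreviation "Z \<equiv> count_space (UNIV :: int set)"

text \<open>
  The first argument of a kernel is its row. The velocity of the row variable is included in the
  kernels below, which turns integration along the contours into integration over parameters.
  The constant \<open>1 / (2 * pi * \<i>)\<close> is put into the kernels with rows on a contour.
\<close>

definition outer_to_circle :: "nat \<times> real \<Rightarrow> nat \<times> real \<Rightarrow> complex" where
  "outer_to_circle x y = (if fst x = 2 \<and> fst y = 1
     then G (c 2 (snd x)) (c 1 (snd y)) / (2 * of_real pi * \<i> * (c 2 (snd x) - c 1 (snd y))) *
       velocity (c 2) (snd x) else 0)"

definition circle_to_mode :: "nat \<times> real \<Rightarrow> int \<Rightarrow> complex" where
  "circle_to_mode y n = (if fst y = 1
     then velocity (c 1) (snd y) * c 1 (snd y) powi n / (2 * of_real pi * \<i>) else 0)"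

definition mode_to_outer :: "int \<Rightarrow> nat \<times> real \<Rightarrow> complex" where
  "mode_to_outer n z = (if fst z = 2 then \<Gamma> n * c 2 (snd z) powi (- n - 1) else 0)"

abbreviation "circle_to_outer \<equiv> kernel_comp Z circle_to_mode mode_to_outer"

text \<open>
  This kernel equals \<open>\<Gamma> n * K n n'\<close>, see \<open>sequence_kernel_eq\<close>.
\<close>

definition sequence_kernel :: "int \<Rightarrow> int \<Rightarrow> complex" where
  "sequence_kernel = kernel_comp X mode_to_outer (kernel_comp X outer_to_circle circle_to_mode)"

lemma sigma_finite_X: "sigma_finite_measure X"
  by (rule sigma_finite_contour_parameters) simp

lemma contour_indices: "1 \<in> {1, 2 :: nat}" "2 \<in> {1, 2 :: nat}"
  by simp_all

lemma param_continuous: "j \<in> {1, 2} \<Longrightarrow> continuous_on {0..1} (c j)"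
  using lipschitz lipschitz_on_continuous_on by blast

lemma param_measurable: "j \<in> {1, 2} \<Longrightarrow> c j \<in> borel_measurable unit_interval_measure"
  by (rule continuous_imp_measurable_on_sets_lebesgue[OF param_continuous]) auto

lemmas [measurable] = contour_parameters_fst contour_parameters_snd
  param_measurable[OF contour_indices(1)] param_measurable[OF contour_indices(2)]
  velocity_measurable[OF param_continuous[OF contour_indices(1)]]
  velocity_measurable[OF param_continuous[OF contour_indices(2)]]

lemma param_distance:
  assumes "s \<in> {0..1}" "t \<in> {0..1}"
  shows "r - 1 \<le> norm (c 2 s - c 1 t)"
  using norm_triangle_ineq2[of "c 2 s" "c 1 t"] outer[OF assms(1)] circle[OF assms(2)] by simp

definition g_abs :: "real \<Rightarrow> real" where "g_abs s = (\<Sum>i=1..d. norm (g i (c 2 s)))"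
definition h_abs :: "real \<Rightarrow> real" where "h_abs t = (\<Sum>i=1..d. norm (h i (c 1 t)))"

lemma G_bound: "norm (G (c 2 s) (c 1 t)) \<le> g_abs s * h_abs t"
proof -
  have "norm (G (c 2 s) (c 1 t)) \<le> (\<Sum>i=1..d. norm (g i (c 2 s)) * norm (h i (c 1 t)))"
    unfolding finite_rank_symbol_def by (rule order_trans[OF norm_sum]) (simp add: norm_mult)
  also have "\<dots> \<le> (\<Sum>i=1..d. norm (g i (c 2 s)) * h_abs t)"
    unfolding h_abs_def by (intro sum_mono mult_left_mono member_le_sum) auto
  finally show ?thesis by (simp add: g_abs_def sum_distrib_right)
qed

lemma g_composition_measurable: "i \<in> {1..d} \<Longrightarrow> (\<lambda>s. g i (c 2 s)) \<in> borel_measurable unit_interval_measure"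
  using lipschitz[of 2] L2_on_composition(1)[OF _ g_L2] contour_indices by blast

lemma h_composition_measurable: "i \<in> {1..d} \<Longrightarrow> (\<lambda>t. h i (c 1 t)) \<in> borel_measurable unit_interval_measure"
  using lipschitz[of 1] L2_on_composition(1)[OF _ h_L2] contour_indices by blast

lemma g_abs_integrable: "integrable unit_interval_measure (\<lambda>s. g_abs s * norm (velocity (c 2) s))"
proof -
  obtain L where L: "L-lipschitz_on {0..1} (c 2)" using lipschitz contour_indices by blast
  show ?thesis
    unfolding g_abs_def sum_distrib_right
    by (intro Bochner_Integration.integrable_sum L2_on_composition(2)[OF L] g_L2)
qed

lemma h_abs_integrable: "integrable unit_interval_measure (\<lambda>t. h_abs t * norm (velocity (c 1) t))"
proof -
  obtain L where L: "L-lipschitz_on {0..1} (c 1)" using lipschitz contour_indices by blast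
  show ?thesis
    unfolding h_abs_def sum_distrib_right
    by (intro Bochner_Integration.integrable_sum L2_on_composition(2)[OF L] h_L2)
qed

lemma outer_to_circle_measurable: "case_prod outer_to_circle \<in> borel_measurable (X \<Otimes>\<^sub>M X)"
proof -
  have [measurable]: "(\<lambda>p. G (c 2 (snd (fst p))) (c 1 (snd (snd p)))) \<in> borel_measurable (X \<Otimes>\<^sub>M X)"
    unfolding finite_rank_symbol_def
  proof (intro borel_measurable_sum borel_measurable_times)
    fix i assume i: "i \<in> {1..d}"
    show "(\<lambda>p. g i (c 2 (snd (fst p)))) \<in> borel_measurable (X \<Otimes>\<^sub>M X)"
      by (rule measurable_compose[OF _ g_composition_measurable[OF i]]) measurable
    show "(\<lambda>p. h i (c 1 (snd (snd p)))) \<in> borel_measurable (X \<Otimes>\<^sub>M X)"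
      by (rule measurable_compose[OF _ h_composition_measurable[OF i]]) measurable
  qed
  show ?thesis
    unfolding outer_to_circle_def case_prod_beta' by measurable
qed

lemma circle_to_mode_measurable: "case_prod circle_to_mode \<in> borel_measurable (X \<Otimes>\<^sub>M Z)"
proof -
  have "(\<lambda>p. circle_to_mode (fst p) (snd p)) \<in> borel_measurable (X \<Otimes>\<^sub>M Z)"
  proof (rule measurable_compose_countable'[where f = "\<lambda>n p. circle_to_mode (fst p) n" and g = snd and I = UNIV])
    show "(\<lambda>p. circle_to_mode (fst p) n) \<in> borel_measurable (X \<Otimes>\<^sub>M Z)" for n
      unfolding circle_to_mode_def power_int_def by measurable
  qed auto
  then show ?thesis by (simp add: case_prod_beta')
qed

lemma mode_to_outer_measurable: "case_prod mode_to_outer \<in> borel_measurable (Z \<Otimes>\<^sub>M X)"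
proof (rule measurable_pair_measure_countable1)
  show "(\<lambda>z. case_prod mode_to_outer (n, z)) \<in> borel_measurable X" for n
    unfolding mode_to_outer_def power_int_def prod.case by measurable
qed auto

text \<open>
  The next three functions are the factors of majorants of the kernels in product form.
\<close>

definition dom_outer :: "nat \<times> real \<Rightarrow> real" where
  "dom_outer x = (if fst x = 2
     then g_abs (snd x) * norm (velocity (c 2) (snd x)) / (2 * pi * (r - 1)) else 0)"
definition dom_circle :: "nat \<times> real \<Rightarrow> real" where
  "dom_circle y = (if fst y = 1 then h_abs (snd y) else 0)"
definition dom_speed :: "nat \<times> real \<Rightarrow> real" where
  "dom_speed y = (if fst y = 1 then norm (velocity (c 1) (snd y)) / (2 * pi) else 0)"
abbreviation on_outer :: "nat \<times> real \<Rightarrow> real" where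
  "on_outer z \<equiv> (if fst z = 2 then 1 else 0)"

lemma outer_to_circle_bound:
  assumes "x \<in> space X" "y \<in> space X"
  shows "norm (outer_to_circle x y) \<le> dom_outer x * dom_circle y"
proof (cases "fst x = 2 \<and> fst y = 1")
  case True
  define s t where "s = snd x" and "t = snd y"
  have st: "s \<in> {0..1}" "t \<in> {0..1}" using assms by (auto simp: space_contour_parameters s_def t_def)
  have "norm (outer_to_circle x y) =
      norm (G (c 2 s) (c 1 t)) / (2 * pi * norm (c 2 s - c 1 t)) * norm (velocity (c 2) s)"
    using True by (simp add: outer_to_circle_def norm_mult norm_divide s_def t_def)
  also have "\<dots> \<le> (g_abs s * h_abs t) / (2 * pi * (r - 1)) * norm (velocity (c 2) s)"
    using param_distance[OF st] r G_bound[of s t]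
    by (intro mult_right_mono frac_le) (auto intro: mult_left_mono order_trans[OF norm_ge_zero])
  finally show ?thesis
    using True by (simp add: dom_outer_def dom_circle_def s_def t_def mult_ac)
qed (auto simp: outer_to_circle_def dom_outer_def dom_circle_def)

lemma circle_to_mode_bound:
  assumes "y \<in> space X"
  shows "norm (circle_to_mode y n) \<le> dom_speed y * 1"
  using assms circle[of "snd y"]
  by (auto simp: circle_to_mode_def dom_speed_def norm_mult norm_divide norm_power_int space_contour_parameters)

lemma outer_powi_bounded:
  obtains D where "D \<ge> 0" "\<And>t. t \<in> {0..1} \<Longrightarrow> norm (c 2 t powi m) \<le> D"
proof -
  have nz: "c 2 t \<noteq> 0" if "t \<in> {0..1}" for t using outer[OF that] r by auto
  have "continuous_on {0..1} (\<lambda>t. c 2 t powi m)"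
    using nz by (intro continuous_intros param_continuous) auto
  then have "bounded ((\<lambda>t. c 2 t powi m) ` {0..1})"
    by (intro compact_imp_bounded compact_continuous_image) auto
  then obtain D where D: "\<And>t. t \<in> {0..1} \<Longrightarrow> norm (c 2 t powi m) \<le> D"
    unfolding bounded_iff by blast
  moreover have "D \<ge> 0" using order_trans[OF norm_ge_zero D[of 0]] by simp
  ultimately show ?thesis using that by blast
qed

text \<open>
  Since \<open>u\<close> stays in a compact set, \<open>u powi (- n - 1)\<close> is comparable to \<open>u powi (- (n - a))\<close>, and the modulus
  of the latter is at most \<open>(1 / r) ^ (n - a)\<close> for \<open>n \<ge> a\<close>.
\<close>

lemma mode_to_outer_bound:
  obtains C where "C \<ge> 0"
    and "\<And>n z. z \<in> space X \<Longrightarrow> norm (mode_to_outer n z) \<le> (C * geometric_weight a (1 / r) n) * on_outer z"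
proof -
  have C\<Gamma>: "0 \<le> C\<^sub>\<Gamma>" using order_trans[OF norm_ge_zero \<Gamma>_bound[of a]] by simp
  have nz: "c 2 t \<noteq> 0" if "t \<in> {0..1}" for t using outer[OF that] r by auto
  obtain D where D0: "D \<ge> 0" and D: "\<And>t. t \<in> {0..1} \<Longrightarrow> norm (c 2 t powi (- a - 1)) \<le> D"
    using outer_powi_bounded by blast
  have "norm (mode_to_outer n z) \<le> ((C\<^sub>\<Gamma> * D) * geometric_weight a (1 / r) n) * on_outer z"
    if z: "z \<in> space X" for n z
  proof (cases "fst z = 2 \<and> a \<le> n")
    case True
    define u where "u = c 2 (snd z)"
    have t: "snd z \<in> {0..1}" using z by (auto simp: space_contour_parameters)
    have u: "u \<noteq> 0" "r \<le> norm u" using nz[OF t] outer[OF t] by (simp_all add: u_def)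
    define m where "m = nat (n - a)"
    have "- n - 1 = (- a - 1) + (- int m)"
      using True by (simp add: m_def)
    then have "u powi (- n - 1) = u powi ((- a - 1) + (- int m))"
      by (simp only:)
    also have "\<dots> = u powi (- a - 1) * inverse (u ^ m)"
      using u by (subst power_int_add) (auto simp: power_int_minus)
    finally have "norm (u powi (- n - 1)) = norm (u powi (- a - 1)) * inverse (norm u ^ m)"
      by (simp add: norm_mult norm_inverse norm_power)
    also have "\<dots> \<le> D * (1 / r) ^ m"
      using D[OF t] u r D0
      by (intro mult_mono) (auto simp: u_def power_one_over inverse_eq_divide intro!: frac_le power_mono)
    finally have "norm (\<Gamma> n) * norm (u powi (- n - 1)) \<le> C\<^sub>\<Gamma> * (D * (1 / r) ^ m)"
      using \<Gamma>_bound[of n] True C\<Gamma> by (intro mult_mono) auto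
    then show ?thesis
      using True by (simp add: mode_to_outer_def geometric_weight_def norm_mult u_def m_def)
  next
    case False
    then show ?thesis
      using \<Gamma>_bound[of n] by (auto simp: mode_to_outer_def geometric_weight_def)
  qed
  then show ?thesis using that[of "C\<^sub>\<Gamma> * D"] C\<Gamma> D0 by simp
qed

lemma dom_outer_integrable: "integrable X dom_outer"
  unfolding dom_outer_def
  using integral_over_one_contour(1)[of "{1, 2 :: nat}" 2, OF _ _ integrable_divide[OF g_abs_integrable, of "2 * pi * (r - 1)"]]
  by simp

lemma dom_circle_speed_integrable: "integrable X (\<lambda>y. dom_circle y * dom_speed y)"
proof -
  have "(\<lambda>y. dom_circle y * dom_speed y) =
      (\<lambda>y. if fst y = 1 then h_abs (snd y) * norm (velocity (c 1) (snd y)) / (2 * pi) else 0)"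
    by (auto simp: dom_circle_def dom_speed_def)
  then show ?thesis
    using integral_over_one_contour(1)[of "{1, 2 :: nat}" 1, OF _ _ integrable_divide[OF h_abs_integrable, of "2 * pi"]]
    by simp
qed

lemma geometric_weight_ratio_integrable: "integrable Z (\<lambda>n. C * geometric_weight a (1 / r) n)"
  using r by (intro integrable_mult_right geometric_weight_integrable) auto

lemma dom_nonneg: "0 \<le> dom_outer x" "0 \<le> dom_circle x" "0 \<le> dom_speed x"
  using r by (auto simp: dom_outer_def dom_circle_def dom_speed_def g_abs_def h_abs_def
      intro!: divide_nonneg_nonneg mult_nonneg_nonneg sum_nonneg)

lemma circle_to_outer_measurable: "case_prod circle_to_outer \<in> borel_measurable (X \<Otimes>\<^sub>M X)"
  by (rule kernel_comp_measurable[OF sigma_finite_count_int circle_to_mode_measurable mode_to_outer_measurable])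

lemma circle_to_outer_integrable:
  assumes "x \<in> space X" "y \<in> space X"
  shows "integrable Z (\<lambda>n. circle_to_mode x n * mode_to_outer n y)"
proof -
  obtain C where C: "C \<ge> 0"
    "\<And>n z. z \<in> space X \<Longrightarrow> norm (mode_to_outer n z) \<le> (C * geometric_weight a (1 / r) n) * on_outer z"
    using mode_to_outer_bound by blast
  show ?thesis
    by (rule kernel_product_integrable(1)[OF circle_to_mode_measurable mode_to_outer_measurable
          circle_to_mode_bound C(2) _ assms])
       (use geometric_weight_ratio_integrable in auto)
qed

lemma contour_kernel_domination:
  obtains \<phi> \<psi> where "integrable X (\<lambda>x. \<phi> x * \<psi> x)"
    and "\<And>x y. x \<in> space X \<Longrightarrow> y \<in> space X \<Longrightarrow> norm (outer_to_circle x y) \<le> \<phi> x * \<psi> y"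
    and "\<And>x y. x \<in> space X \<Longrightarrow> y \<in> space X \<Longrightarrow> norm (circle_to_outer x y) \<le> \<phi> x * \<psi> y"
proof -
  obtain C where C: "C \<ge> 0"
    "\<And>n z. z \<in> space X \<Longrightarrow> norm (mode_to_outer n z) \<le> (C * geometric_weight a (1 / r) n) * on_outer z"
    using mode_to_outer_bound by blast
  define S where "S = (\<integral>n. 1 * (C * geometric_weight a (1 / r) n) \<partial>Z)"
  have S: "S \<ge> 0"
    unfolding S_def using C r by (intro integral_nonneg_AE AE_I2) (simp add: geometric_weight_nonneg)
  have bound: "norm (circle_to_outer x y) \<le> (S * dom_speed x) * on_outer y" if "x \<in> space X" "y \<in> space X" for x y
    unfolding S_def
    by (rule kernel_product_integrable(2)[OF circle_to_mode_measurable mode_to_outer_measurable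
          circle_to_mode_bound C(2) _ that])
       (use geometric_weight_ratio_integrable in auto)
  define \<phi> where "\<phi> x = dom_outer x + S * dom_speed x" for x
  define \<psi> where "\<psi> y = dom_circle y + on_outer y" for y
  have prod: "\<phi> x * \<psi> x = dom_outer x + S * (dom_circle x * dom_speed x)" for x
    by (simp add: \<phi>_def \<psi>_def dom_outer_def dom_circle_def dom_speed_def)
  have int: "integrable X (\<lambda>x. \<phi> x * \<psi> x)"
    unfolding prod by (intro Bochner_Integration.integrable_add integrable_mult_right
        dom_outer_integrable dom_circle_speed_integrable)
  have 1: "norm (outer_to_circle x y) \<le> \<phi> x * \<psi> y" if "x \<in> space X" "y \<in> space X" for x y
  proof -
    have "dom_outer x * dom_circle y \<le> \<phi> x * \<psi> y"
      using dom_nonneg[of x] dom_nonneg[of y] S by (intro mult_mono) (auto simp: \<phi>_def \<psi>_def)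
    then show ?thesis using outer_to_circle_bound[OF that] by linarith
  qed
  have 2: "norm (circle_to_outer x y) \<le> \<phi> x * \<psi> y" if "x \<in> space X" "y \<in> space X" for x y
  proof -
    have "(S * dom_speed x) * on_outer y \<le> \<phi> x * \<psi> y"
      using dom_nonneg[of x] dom_nonneg[of y] S by (intro mult_mono) (auto simp: \<phi>_def \<psi>_def)
    then show ?thesis using bound[OF that] by linarith
  qed
  show ?thesis using that[OF int 1 2] .
qed

lemma contour_minors_integrable:
  "integrable (PiM {..<p :: nat} (\<lambda>_. X)) (leibniz_det {..<p} (\<lambda>x y. outer_to_circle x y + circle_to_outer x y))"
proof -
  obtain \<phi> \<psi> where int: "integrable X (\<lambda>x. \<phi> x * \<psi> x)"
    and b1: "\<And>x y. x \<in> space X \<Longrightarrow> y \<in> space X \<Longrightarrow> norm (outer_to_circle x y) \<le> \<phi> x * \<psi> y"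
    and b2: "\<And>x y. x \<in> space X \<Longrightarrow> y \<in> space X \<Longrightarrow> norm (circle_to_outer x y) \<le> \<phi> x * \<psi> y"
    using contour_kernel_domination by blast
  show ?thesis
  proof (rule leibniz_det_integrable[OF sigma_finite_X, where \<phi> = "\<lambda>x. 2 * \<phi> x" and \<psi> = \<psi>])
    show "(\<lambda>(x, y). outer_to_circle x y + circle_to_outer x y) \<in> borel_measurable (X \<Otimes>\<^sub>M X)"
      using borel_measurable_add[OF outer_to_circle_measurable circle_to_outer_measurable]
      by (simp add: case_prod_beta')
    show "norm (outer_to_circle x y + circle_to_outer x y) \<le> 2 * \<phi> x * \<psi> y" if "x \<in> space X" "y \<in> space X" for x y
      using norm_triangle_ineq[of "outer_to_circle x y" "circle_to_outer x y"] b1[OF that] b2[OF that] by simp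
    show "integrable X (\<lambda>x. 2 * \<phi> x * \<psi> x)"
      using integrable_mult_right[OF int, of 2] by (simp add: mult.assoc)
  qed simp
qed

text \<open>
  After the Schur complement the composition of the three kernels is bracketed differently, so that
  cyclicity moves it from the outer contour to the integers.
\<close>

lemma minor_integral_contours:
  "minor_integral X {..<p :: nat} (\<lambda>x y. outer_to_circle x y + circle_to_outer x y) =
    (if even p then (-1) ^ (p div 2) * (fact p / fact (p div 2)) *
       minor_integral Z {..<p div 2} sequence_kernel else 0)"
proof -
  obtain \<phi> \<psi> where int: "integrable X (\<lambda>x. \<phi> x * \<psi> x)"
    and b1: "\<And>x y. x \<in> space X \<Longrightarrow> y \<in> space X \<Longrightarrow> norm (outer_to_circle x y) \<le> \<phi> x * \<psi> y"
    and b2: "\<And>x y. x \<in> space X \<Longrightarrow> y \<in> space X \<Longrightarrow> norm (circle_to_outer x y) \<le> \<phi> x * \<psi> y"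
    using contour_kernel_domination by blast
  obtain C where C: "C \<ge> 0"
    "\<And>n z. z \<in> space X \<Longrightarrow> norm (mode_to_outer n z) \<le> (C * geometric_weight a (1 / r) n) * on_outer z"
    using mode_to_outer_bound by blast
  have int_Z: "integrable Z (\<lambda>n. 1 * (C * geometric_weight a (1 / r) n))"
    using geometric_weight_ratio_integrable by simp
  let ?A = "kernel_comp X outer_to_circle circle_to_mode"
  have A: "case_prod ?A \<in> borel_measurable (X \<Otimes>\<^sub>M Z)"
    by (rule kernel_comp_measurable[OF sigma_finite_X outer_to_circle_measurable circle_to_mode_measurable])
  have bA: "norm (?A x n) \<le> ((\<integral>y. dom_circle y * dom_speed y \<partial>X) * dom_outer x) * 1"
    if "x \<in> space X" "n \<in> space Z" for x n
    by (rule kernel_product_integrable(2)[OF outer_to_circle_measurable circle_to_mode_measurable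
          outer_to_circle_bound circle_to_mode_bound dom_circle_speed_integrable that])
  have "minor_integral X {..<p} (\<lambda>x y. outer_to_circle x y + circle_to_outer x y) =
    (if even (card {..<p}) then (-1) ^ (card {..<p} div 2) * (fact (card {..<p}) / fact (card {..<p} div 2)) *
       minor_integral X {..<card {..<p} div 2} (kernel_comp X outer_to_circle circle_to_outer) else 0)"
  proof (rule minor_integral_off_diagonal[OF sigma_finite_X _ outer_to_circle_measurable
        circle_to_outer_measurable b1 b2 int, where U = "{x. fst x = 2}"])
    show "x \<in> {x. fst x = 2} \<and> y \<notin> {x. fst x = 2}" if "outer_to_circle x y \<noteq> 0" for x y
      using that by (auto simp: outer_to_circle_def split: if_splits)
    show "x \<notin> {x. fst x = 2} \<and> y \<in> {x. fst x = 2}" if "circle_to_outer x y \<noteq> 0" for x y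
      using that by (cases "fst x = 1"; cases "fst y = 2")
        (auto simp: kernel_comp_def circle_to_mode_def mode_to_outer_def)
  qed auto
  also have "minor_integral X {..<card {..<p} div 2} (kernel_comp X outer_to_circle circle_to_outer) =
      minor_integral X {..<card {..<p} div 2} (kernel_comp Z ?A mode_to_outer)"
  proof (rule minor_integral_cong)
    show "kernel_comp X outer_to_circle circle_to_outer x y = kernel_comp Z ?A mode_to_outer x y"
      if "x \<in> space X" "y \<in> space X" for x y
      by (rule kernel_comp_assoc[OF sigma_finite_X sigma_finite_count_int outer_to_circle_measurable
          circle_to_mode_measurable mode_to_outer_measurable outer_to_circle_bound circle_to_mode_bound C(2)
          dom_circle_speed_integrable int_Z that])
  qed simp
  also have "\<dots> = minor_integral Z {..<card {..<p} div 2} sequence_kernel"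
    unfolding sequence_kernel_def
  proof (rule minor_integral_commute[OF sigma_finite_X sigma_finite_count_int _ A mode_to_outer_measurable bA C(2)])
    have "(\<lambda>x. (\<integral>y. dom_circle y * dom_speed y \<partial>X) * dom_outer x * on_outer x) =
        (\<lambda>x. (\<integral>y. dom_circle y * dom_speed y \<partial>X) * dom_outer x)"
      by (auto simp: dom_outer_def)
    then show "integrable X (\<lambda>x. (\<integral>y. dom_circle y * dom_speed y \<partial>X) * dom_outer x * on_outer x)"
      using integrable_mult_right[OF dom_outer_integrable] by simp
  qed (use int_Z in auto)
  finally show ?thesis by simp
qed

lemma sequence_kernel_bound:
  obtains C where "C \<ge> 0" "\<And>n n'. norm (sequence_kernel n n') \<le> C * geometric_weight a (1 / r) n"
proof -
  obtain C where C: "C \<ge> 0"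
    "\<And>n z. z \<in> space X \<Longrightarrow> norm (mode_to_outer n z) \<le> (C * geometric_weight a (1 / r) n) * on_outer z"
    using mode_to_outer_bound by blast
  let ?A = "kernel_comp X outer_to_circle circle_to_mode"
  define K where "K = (\<integral>y. dom_circle y * dom_speed y \<partial>X)"
  have K: "K \<ge> 0"
    unfolding K_def by (intro integral_nonneg_AE AE_I2 mult_nonneg_nonneg dom_nonneg)
  have A: "case_prod ?A \<in> borel_measurable (X \<Otimes>\<^sub>M Z)"
    by (rule kernel_comp_measurable[OF sigma_finite_X outer_to_circle_measurable circle_to_mode_measurable])
  have bA: "norm (?A x n) \<le> (K * dom_outer x) * 1" if "x \<in> space X" "n \<in> space Z" for x n
    unfolding K_def
    by (rule kernel_product_integrable(2)[OF outer_to_circle_measurable circle_to_mode_measurable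
          outer_to_circle_bound circle_to_mode_bound dom_circle_speed_integrable that])
  have eq: "(\<lambda>x. on_outer x * (K * dom_outer x)) = (\<lambda>x. K * dom_outer x)"
    by (auto simp: dom_outer_def)
  have int: "integrable X (\<lambda>x. on_outer x * (K * dom_outer x))"
    unfolding eq by (intro integrable_mult_right dom_outer_integrable)
  define D where "D = (\<integral>x. on_outer x * (K * dom_outer x) \<partial>X)"
  have D: "D \<ge> 0"
    unfolding D_def eq using K by (intro integral_nonneg_AE AE_I2 mult_nonneg_nonneg dom_nonneg)
  have "norm (sequence_kernel n n') \<le> (D * C) * geometric_weight a (1 / r) n" for n n'
    unfolding sequence_kernel_def D_def
    using kernel_product_integrable(2)[OF mode_to_outer_measurable A C(2) bA int, of n n'] by (simp add: mult_ac)
  then show ?thesis using that[of "D * C"] C D by simp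
qed

text \<open>
  The two parameter integrals in the definition of the sequence kernel are the inner integral along
  the circle and the outer integral along the other contour in the definition of \<open>K\<close>. Integrability has to be
  checked for each of them, as contour integrals are defined as gauge integrals.
\<close>

lemma sequence_kernel_eq: "sequence_kernel n n' = \<Gamma> n * K_kernel (c 1) (c 2) G n n'"
proof -
  let ?A = "kernel_comp X outer_to_circle circle_to_mode"
  let ?w = "2 * of_real pi * \<i> :: complex"
  have A: "case_prod ?A \<in> borel_measurable (X \<Otimes>\<^sub>M Z)"
    by (rule kernel_comp_measurable[OF sigma_finite_X outer_to_circle_measurable circle_to_mode_measurable])
  have inner: "contour_integral (c 1) (\<lambda>v. c 2 s powi (- n - 1) * v powi n' * G (c 2 s) v / (c 2 s - v)) *
      velocity (c 2) s = ?w\<^sup>2 * (c 2 s powi (- n - 1) * ?A (2, s) n')" if s: "s \<in> {0..1}" for s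
  proof -
    define f where "f t = c 1 t powi n' * G (c 2 s) (c 1 t) / (c 2 s - c 1 t) * velocity (c 1) t" for t
    have f: "integrable unit_interval_measure f"
    proof (rule Bochner_Integration.integrable_bound)
      show "integrable unit_interval_measure (\<lambda>t. g_abs s / (r - 1) * (h_abs t * norm (velocity (c 1) t)))"
        by (intro integrable_mult_right h_abs_integrable)
      have [measurable]: "(\<lambda>t. G (c 2 s) (c 1 t)) \<in> borel_measurable unit_interval_measure"
        unfolding finite_rank_symbol_def
        by (intro borel_measurable_sum borel_measurable_times h_composition_measurable) auto
      show "f \<in> borel_measurable unit_interval_measure"
        unfolding f_def power_int_def by measurable
      show "AE t in unit_interval_measure. norm (f t) \<le> norm (g_abs s / (r - 1) * (h_abs t * norm (velocity (c 1) t)))"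
      proof (rule AE_I2)
        fix t assume "t \<in> space unit_interval_measure"
        then have t: "t \<in> {0..1}" by simp
        have "norm (f t) = norm (G (c 2 s) (c 1 t)) / norm (c 2 s - c 1 t) * norm (velocity (c 1) t)"
          using circle[OF t] by (simp add: f_def norm_mult norm_divide norm_power_int)
        also have "\<dots> \<le> (g_abs s * h_abs t) / (r - 1) * norm (velocity (c 1) t)"
          using param_distance[OF s t] r G_bound[of s t]
          by (intro mult_right_mono frac_le) (auto intro: order_trans[OF norm_ge_zero])
        also have "\<dots> = g_abs s / (r - 1) * (h_abs t * norm (velocity (c 1) t))"
          by simp
        finally show "norm (f t) \<le> norm (g_abs s / (r - 1) * (h_abs t * norm (velocity (c 1) t)))"
          unfolding real_norm_def by (rule order_trans[OF _ abs_ge_self])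
      qed
    qed
    have "contour_integral (c 1) (\<lambda>v. c 2 s powi (- n - 1) * v powi n' * G (c 2 s) v / (c 2 s - v)) =
        (\<integral>t. c 2 s powi (- n - 1) * f t \<partial>unit_interval_measure)"
    proof (subst contour_integral_eq_lebesgue)
      have *: "c 2 s powi (- n - 1) * c 1 t powi n' * G (c 2 s) (c 1 t) / (c 2 s - c 1 t) * velocity (c 1) t =
          c 2 s powi (- n - 1) * f t" for t
        by (simp add: f_def)
      show "integrable unit_interval_measure (\<lambda>t. c 2 s powi (- n - 1) * c 1 t powi n' * G (c 2 s) (c 1 t) /
          (c 2 s - c 1 t) * velocity (c 1) t)"
        unfolding * by (intro integrable_mult_right f)
      show "(\<integral>t. c 2 s powi (- n - 1) * c 1 t powi n' * G (c 2 s) (c 1 t) / (c 2 s - c 1 t) *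
          velocity (c 1) t \<partial>unit_interval_measure) = (\<integral>t. c 2 s powi (- n - 1) * f t \<partial>unit_interval_measure)"
        unfolding * ..
    qed
    also have "\<dots> = c 2 s powi (- n - 1) * integral\<^sup>L unit_interval_measure f"
      by (rule Bochner_Integration.integral_mult_right_zero)
    finally have 1: "contour_integral (c 1) (\<lambda>v. c 2 s powi (- n - 1) * v powi n' * G (c 2 s) v / (c 2 s - v)) =
        c 2 s powi (- n - 1) * integral\<^sup>L unit_interval_measure f" .
    have "?A (2, s) n' = (\<integral>y. (if fst y = 1 then velocity (c 2) s / ?w\<^sup>2 * f (snd y) else 0) \<partial>X)"
      unfolding kernel_comp_def
      by (intro Bochner_Integration.integral_cong refl)
         (simp add: outer_to_circle_def circle_to_mode_def f_def power2_eq_square mult_ac)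
    also have "\<dots> = (\<integral>t. velocity (c 2) s / ?w\<^sup>2 * f t \<partial>unit_interval_measure)"
      using f by (intro integral_over_one_contour(2)) auto
    also have "\<dots> = velocity (c 2) s / ?w\<^sup>2 * integral\<^sup>L unit_interval_measure f"
      by (rule Bochner_Integration.integral_mult_right_zero)
    finally show ?thesis unfolding 1 by (simp add: field_simps)
  qed
  have int: "integrable unit_interval_measure (\<lambda>s. c 2 s powi (- n - 1) * ?A (2, s) n')"
  proof -
    obtain D where D: "D \<ge> 0" "\<And>t. t \<in> {0..1} \<Longrightarrow> norm (c 2 t powi (- n - 1)) \<le> D"
      using outer_powi_bounded by blast
    define K where "K = (\<integral>y. dom_circle y * dom_speed y \<partial>X)"
    have bA: "norm (?A x n') \<le> (K * dom_outer x) * 1" if "x \<in> space X" for x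
      unfolding K_def
      by (rule kernel_product_integrable(2)[OF outer_to_circle_measurable circle_to_mode_measurable
            outer_to_circle_bound circle_to_mode_bound dom_circle_speed_integrable that]) auto
    have "(\<lambda>s. ((2, s), n')) \<in> unit_interval_measure \<rightarrow>\<^sub>M X \<Otimes>\<^sub>M Z"
      unfolding contour_parameters_def by measurable
    from measurable_compose[OF this A]
    have [measurable]: "(\<lambda>s. ?A (2, s) n') \<in> borel_measurable unit_interval_measure" by simp
    have dom: "integrable unit_interval_measure (\<lambda>s. D * K / (2 * pi * (r - 1)) * (g_abs s * norm (velocity (c 2) s)))"
      by (intro integrable_mult_right g_abs_integrable)
    show ?thesis
    proof (rule Bochner_Integration.integrable_bound[OF dom])
      show "(\<lambda>s. c 2 s powi (- n - 1) * ?A (2, s) n') \<in> borel_measurable unit_interval_measure"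
        unfolding power_int_def by measurable
      show "AE s in unit_interval_measure. norm (c 2 s powi (- n - 1) * ?A (2, s) n') \<le>
          norm (D * K / (2 * pi * (r - 1)) * (g_abs s * norm (velocity (c 2) s)))"
      proof (rule AE_I2)
        fix s assume "s \<in> space unit_interval_measure"
        then have s: "s \<in> {0..1}" by simp
        have "norm (c 2 s powi (- n - 1) * ?A (2, s) n') \<le> D * (K * dom_outer (2, s) * 1)"
          unfolding norm_mult using s by (intro mult_mono D bA) (auto simp: space_contour_parameters)
        also have "\<dots> = D * K / (2 * pi * (r - 1)) * (g_abs s * norm (velocity (c 2) s))"
          by (simp add: dom_outer_def)
        finally show "norm (c 2 s powi (- n - 1) * ?A (2, s) n') \<le>
          norm (D * K / (2 * pi * (r - 1)) * (g_abs s * norm (velocity (c 2) s)))"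
          unfolding real_norm_def by (rule order_trans[OF _ abs_ge_self])
      qed
    qed
  qed
  have "K_kernel (c 1) (c 2) G n n' =
      1 / ?w\<^sup>2 * (\<integral>s. ?w\<^sup>2 * (c 2 s powi (- n - 1) * ?A (2, s) n') \<partial>unit_interval_measure)"
    unfolding K_kernel_def
  proof (subst contour_integral_eq_lebesgue)
    show "integrable unit_interval_measure (\<lambda>s. contour_integral (c 1) (\<lambda>v. c 2 s powi (- n - 1) * v powi n' *
        G (c 2 s) v / (c 2 s - v)) * velocity (c 2) s)"
      by (subst Bochner_Integration.integrable_cong[OF refl inner]) (use int in \<open>auto intro: integrable_mult_right\<close>)
  qed (rule arg_cong[where f = "\<lambda>z. 1 / ?w\<^sup>2 * z"],
       rule Bochner_Integration.integral_cong[OF refl], rule inner, simp)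
  then have K: "K_kernel (c 1) (c 2) G n n' = (\<integral>s. c 2 s powi (- n - 1) * ?A (2, s) n' \<partial>unit_interval_measure)"
    by simp
  have "sequence_kernel n n' =
      (\<integral>z. (if fst z = 2 then \<Gamma> n * (c 2 (snd z) powi (- n - 1) * ?A (2, snd z) n') else 0) \<partial>X)"
    unfolding sequence_kernel_def kernel_comp_def[of X mode_to_outer]
    by (intro Bochner_Integration.integral_cong refl) (auto simp: mode_to_outer_def)
  also have "\<dots> = (\<integral>s. \<Gamma> n * (c 2 s powi (- n - 1) * ?A (2, s) n') \<partial>unit_interval_measure)"
    using int by (intro integral_over_one_contour(2)) auto
  also have "\<dots> = \<Gamma> n * K_kernel (c 1) (c 2) G n n'"
    unfolding K by (rule Bochner_Integration.integral_mult_right_zero)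
  finally show ?thesis .
qed

end

section \<open>Geometric sums over clusters\<close>

lemma powi_quotient:
  fixes u v :: complex
  assumes "u \<noteq> 0"
  shows "v powi n * u powi (- n - 1) = (v / u) powi n / u"
proof -
  have "u powi (- n - 1) = inverse (u powi (n + 1))"
    using power_int_minus[of u "n + 1"] by simp
  also have "\<dots> = inverse (u powi n * u)"
    using assms by (subst power_int_add_1) auto
  finally have "v powi n * u powi (- n - 1) = v powi n / u powi n / u"
    by (simp add: divide_inverse mult_ac)
  then show ?thesis
    by (simp only: power_int_divide_distrib)
qed

text \<open>
  Multiplied by \<open>u - v\<close>, the summand becomes a difference of consecutive powers of \<open>v / u\<close>.
\<close>

lemma telescoping_powi_sum:
  fixes v u :: complex
  assumes uv: "u \<noteq> 0" "v \<noteq> 0" "u \<noteq> v" and "a \<le> b"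
  shows "(\<Sum>n\<in>{a..b}. v powi n * u powi (- n - 1)) = ((v / u) powi a - (v / u) powi (1 + b)) / (u - v)"
proof -
  have telescope: "v powi n * u powi (- n - 1) = ((v / u) powi n - (v / u) powi (1 + n)) / (u - v)" for n
  proof -
    have divide: "W / u = (W - v / u * W) / (u - v)" for W
      using uv by (simp add: field_simps)
    have "(v / u) powi (1 + n) = v / u * (v / u) powi n"
      using uv by (subst power_int_add) auto
    then show ?thesis
      using powi_quotient[OF uv(1), of v n] divide[of "(v / u) powi n"] by (simp only:)
  qed
  show ?thesis
    using \<open>a \<le> b\<close>
  proof (induction b rule: int_ge_induct)
    case base
    show ?case using telescope[of a] by simp
  next
    case (step b)
    have "{a..b + 1} = insert (b + 1) {a..b}" using step.hyps by auto
    then have "(\<Sum>n\<in>{a..b + 1}. v powi n * u powi (- n - 1)) =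
        ((v / u) powi (1 + b) - (v / u) powi (1 + (b + 1))) / (u - v) +
        ((v / u) powi a - (v / u) powi (1 + b)) / (u - v)"
      using step.IH telescope[of "b + 1"] by (simp add: add.commute[of b 1])
    also have "\<dots> = ((v / u) powi a - (v / u) powi (1 + (b + 1))) / (u - v)"
      by (simp add: diff_divide_distrib)
    finally show ?case .
  qed
qed

lemma powi_tail_sum:
  fixes v u :: complex
  assumes uv: "v \<noteq> 0" "norm v < norm u"
  shows "((\<lambda>n. v powi n * u powi (- n - 1)) has_sum (v / u) powi a / (u - v)) {a..}"
proof -
  have u: "u \<noteq> 0" "u \<noteq> v" using uv by auto
  define w where "w = v / u"
  have w: "norm w < 1" "w \<noteq> 0" using uv u by (auto simp: w_def norm_divide)
  have "((\<lambda>m::nat. w ^ m) has_sum 1 / (1 - w)) UNIV"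
    using w by (intro norm_summable_imp_has_sum geometric_sums) (simp_all add: norm_power summable_geometric)
  then have "((\<lambda>m::nat. w powi a / u * w ^ m) has_sum w powi a / u * (1 / (1 - w))) UNIV"
    by (rule has_sum_cmult_right)
  also have "w powi a / u * (1 / (1 - w)) = w powi a / (u - v)"
    using u by (simp add: w_def field_simps)
  finally have sum: "((\<lambda>m::nat. w powi a / u * w ^ m) has_sum w powi a / (u - v)) UNIV" .
  have term_eq: "w powi a / u * w ^ m = v powi (a + int m) * u powi (- (a + int m) - 1)" for m
  proof -
    have "w powi (a + int m) = w powi a * w ^ m"
      using w by (subst power_int_add) auto
    then show ?thesis
      unfolding powi_quotient[OF u(1)] w_def by simp
  qed
  have bij: "bij_betw (\<lambda>m. a + int m) UNIV {a..}"
    by (rule bij_betw_byWitness[of _ "\<lambda>n. nat (n - a)"]) auto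
  show ?thesis
    using sum unfolding term_eq
    using has_sum_reindex_bij_betw[OF bij, of "\<lambda>n. v powi n * u powi (- n - 1)"] by (simp add: w_def)
qed

lemma cluster_endpoint_cases:
  assumes "cluster_endpoints q k" "j \<in> {0..q}"
  obtains a b where "k (2 * j + 1) = Fin a" "k (2 * j) = Fin b" "a \<le> b" "cluster k j = {a..b}"
  | a where "k (2 * j + 1) = Fin a" "k (2 * j) = Pinf" "cluster k j = {a..}"
proof -
  have "2 * j + 1 \<in> {1..2 * q + 1}" using assms(2) by auto
  then obtain a where a: "k (2 * j + 1) = Fin a"
    using assms(1) unfolding cluster_endpoints_def by blast
  have le: "k (2 * j + 1) \<le> k (2 * j)"
    using assms unfolding cluster_endpoints_def by blast
  show ?thesis
  proof (cases "k (2 * j)")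
    case (Fin b)
    show ?thesis
      by (rule that(1)[OF a Fin]) (use le a Fin in \<open>auto simp: cluster_def\<close>)
  next
    case Pinf
    show ?thesis
      by (rule that(2)[OF a Pinf]) (use a Pinf in \<open>auto simp: cluster_def\<close>)
  next
    case Minf
    then show ?thesis using le a by simp
  qed
qed

text \<open>
  For a half-infinite cluster the convention that the power with exponent \<open>\<infinity>\<close> is 0 is exactly the limit
  of the finite formula, as \<open>\<bar>v / u\<bar> < 1\<close>.
\<close>

lemma cluster_has_sum:
  fixes v u :: complex
  assumes k: "cluster_endpoints q k" "j \<in> {0..q}" and uv: "v \<noteq> 0" "norm v < norm u"
  shows "((\<lambda>n. v powi n * u powi (- n - 1)) has_sum
    (ext_powi (v / u) (k (2 * j + 1)) - ext_powi (v / u) (1 + k (2 * j))) / (u - v)) (cluster k j)"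
proof (cases rule: cluster_endpoint_cases[OF k])
  case (1 a b)
  have "u \<noteq> 0" "u \<noteq> v" using uv by auto
  then have "(\<Sum>n\<in>{a..b}. v powi n * u powi (- n - 1)) = ((v / u) powi a - (v / u) powi (1 + b)) / (u - v)"
    using telescoping_powi_sum[OF _ uv(1)] 1(3) by blast
  then show ?thesis
    using has_sum_finite[of "{a..b}" "\<lambda>n. v powi n * u powi (- n - 1)"] 1
    by (simp add: one_extended_def)
next
  case (2 a)
  then show ?thesis
    using powi_tail_sum[OF uv, of a] by (simp add: one_extended_def)
qed

definition cluster_coefficient ::
  "nat \<Rightarrow> (nat \<Rightarrow> int extended) \<Rightarrow> (nat \<Rightarrow> complex) \<Rightarrow> int \<Rightarrow> complex" where
  "cluster_coefficient q k \<gamma> n = (\<Sum>j=0..q. \<gamma> j * (if n \<in> cluster k j then 1 else 0))"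

lemma cluster_coefficient_bound:
  assumes k: "cluster_endpoints q k"
  obtains a where "\<And>n. norm (cluster_coefficient q k \<gamma> n) \<le> (if a \<le> n then (\<Sum>j=0..q. norm (\<gamma> j)) else 0)"
proof -
  have "\<exists>a. \<forall>n\<in>cluster k j. a \<le> n" if "j \<in> {0..q}" for j
    by (cases rule: cluster_endpoint_cases[OF k that]) auto
  then obtain a where a: "\<And>j n. j \<in> {0..q} \<Longrightarrow> n \<in> cluster k j \<Longrightarrow> a j \<le> n"
    by metis
  define a0 where "a0 = Min (a ` {0..q})"
  have "norm (cluster_coefficient q k \<gamma> n) \<le> (if a0 \<le> n then (\<Sum>j=0..q. norm (\<gamma> j)) else 0)" for n
  proof (cases "a0 \<le> n")
    case True
    have "norm (cluster_coefficient q k \<gamma> n) \<le> (\<Sum>j=0..q. norm (\<gamma> j * (if n \<in> cluster k j then 1 else 0)))"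
      unfolding cluster_coefficient_def by (rule norm_sum)
    also have "\<dots> \<le> (\<Sum>j=0..q. norm (\<gamma> j))"
      by (intro sum_mono) auto
    finally show ?thesis using True by simp
  next
    case False
    have "n \<notin> cluster k j" if "j \<in> {0..q}" for j
    proof
      assume "n \<in> cluster k j"
      then have "a j \<le> n" using a that by blast
      moreover have "a0 \<le> a j" unfolding a0_def using that by (intro Min_le) auto
      ultimately show False using False by simp
    qed
    then have "cluster_coefficient q k \<gamma> n = 0"
      unfolding cluster_coefficient_def by (intro sum.neutral) auto
    then show ?thesis using False by simp
  qed
  then show ?thesis using that by blast
qed

lemma has_sum_sum:
  fixes f :: "'j \<Rightarrow> 'a \<Rightarrow> complex"
  assumes "finite J" "\<And>j. j \<in> J \<Longrightarrow> (f j has_sum s j) A"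
  shows "((\<lambda>x. \<Sum>j\<in>J. f j x) has_sum (\<Sum>j\<in>J. s j)) A"
  using assms by (induction J rule: finite_induct) (auto intro: has_sum_add)

text \<open>
  The right-hand side is \<open>- 2 * pi * \<i>\<close> times the part of \<open>M\<close> with row \<open>v\<close> on the circle and column \<open>u\<close> on the
  outer contour.
\<close>

lemma cluster_coefficient_has_sum:
  fixes v u :: complex
  assumes k: "cluster_endpoints q k" and uv: "v \<noteq> 0" "norm v < norm u"
  shows "((\<lambda>n. cluster_coefficient q k \<gamma> n * (v powi n * u powi (- n - 1))) has_sum
    (\<Sum>j=0..q. \<gamma> j * (ext_powi (v / u) (k (2 * j + 1)) - ext_powi (v / u) (1 + k (2 * j)))) / (u - v)) UNIV"
proof -
  define t where "t n = v powi n * u powi (- n - 1)" for n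
  define S where "S j = (ext_powi (v / u) (k (2 * j + 1)) - ext_powi (v / u) (1 + k (2 * j))) / (u - v)" for j
  have "((\<lambda>n. \<Sum>j=0..q. \<gamma> j * (if n \<in> cluster k j then t n else 0)) has_sum (\<Sum>j=0..q. \<gamma> j * S j)) UNIV"
  proof (intro has_sum_sum has_sum_cmult_right finite_atLeastAtMost)
    fix j assume j: "j \<in> {0..q}"
    show "((\<lambda>n. if n \<in> cluster k j then t n else 0) has_sum S j) UNIV"
      using cluster_has_sum[OF k j uv] unfolding t_def[symmetric] S_def[symmetric]
      by (rule has_sum_cong_neutral[THEN iffD1, rotated -1]) auto
  qed
  also have "(\<lambda>n. \<Sum>j=0..q. \<gamma> j * (if n \<in> cluster k j then t n else 0)) =
      (\<lambda>n. cluster_coefficient q k \<gamma> n * t n)"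
    unfolding cluster_coefficient_def sum_distrib_right
    by (intro ext sum.cong) auto
  finally show ?thesis
    unfolding S_def t_def by (simp add: sum_divide_distrib)
qed

lemma kernel_of_cluster_operator:
  "kernel_of (\<lambda>\<sigma> n. - (\<Sum>j=0..q. \<gamma> j * (restrict_seq (cluster k j) \<circ> kernel_operator K) \<sigma> n)) n n' =
    - (cluster_coefficient q k \<gamma> n * K n n')"
proof -
  have "kernel_operator K (\<lambda>m. if m = n' then 1 else 0) n = (\<Sum>\<^sub>\<infinity>m\<in>{n'}. K n m * (if m = n' then 1 else 0))"
    unfolding kernel_operator_def by (rule infsum_cong_neutral) auto
  then have "kernel_operator K (\<lambda>m. if m = n' then 1 else 0) n = K n n'" by simp
  then show ?thesis
    by (auto simp: kernel_of_def restrict_seq_def cluster_coefficient_def sum_distrib_right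
        simp flip: sum_negf intro!: sum.cong)
qed

section \<open>Equality of the two determinants\<close>

lemma circlepath_lipschitz: "(2 * pi * \<bar>\<rho>\<bar>)-lipschitz_on S (circlepath z \<rho>)"
proof -
  have "(2 * pi * \<bar>\<rho>\<bar>)-lipschitz_on UNIV (circlepath z \<rho>)"
  proof (rule bounded_derivative_imp_lipschitz)
    fix t :: real
    show "(circlepath z \<rho> has_derivative
        (\<lambda>h. h *\<^sub>R (2 * of_real pi * \<i> * of_real \<rho> * exp (2 * of_real pi * \<i> * of_real t)))) (at t within UNIV)"
      using has_vector_derivative_circlepath[of z \<rho> t UNIV] by (simp add: has_vector_derivative_def)
    show "onorm (\<lambda>h. h *\<^sub>R (2 * of_real pi * \<i> * of_real \<rho> * exp (2 * of_real pi * \<i> * of_real t)) :: complex)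
        \<le> 2 * pi * \<bar>\<rho>\<bar>"
      by (rule onorm_le) (simp add: norm_mult norm_exp_eq_Re mult_ac)
  qed auto
  then show ?thesis by (rule lipschitz_on_subset) simp
qed

theorem proposition3p2:
  fixes c :: "nat \<Rightarrow> real \<Rightarrow> complex"
    and d q :: nat
    and g h :: "nat \<Rightarrow> complex \<Rightarrow> complex"
    and k :: "nat \<Rightarrow> int extended"
    and \<gamma> :: "nat \<Rightarrow> complex"
  defines "G \<equiv> finite_rank_symbol d g h"
  defines "\<K> \<equiv> kernel_operator (K_kernel (c 1) (c 2) G)"
  defines "T \<equiv> (\<lambda>\<sigma> n. \<Sum>j=0..q. \<gamma> j * (restrict_seq (cluster k j) \<circ> \<K>) \<sigma> n)"
  defines "M \<equiv> M_kernel (path_image (c 1)) (path_image (c 2)) G q k \<gamma>"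
  assumes "c 1 = circlepath 0 1"
    and "positively_oriented_contour (c 2)" and "path_image (c 2) \<subseteq> {z. norm z > 1}"
    and "d \<ge> 1"
    and "\<forall>i\<in>{1..d}. g i \<in> L2_on (c 2)" and "\<forall>i\<in>{1..d}. h i \<in> L2_on (c 1)"
    and "cluster_endpoints q k"
  shows "fredholm_converges_seq (\<lambda>\<sigma> n. - T \<sigma> n) \<and>
    fredholm_converges_contours c {1, 2} (\<lambda>z z'. - M z z') \<and>
    fredholm_det_seq (\<lambda>\<sigma> n. - T \<sigma> n) = fredholm_det_contours c {1, 2} (\<lambda>z z'. - M z z')"
proof -
  note k = \<open>cluster_endpoints q k\<close>
  obtain L2 where L2: "L2-lipschitz_on {0..1} (c 2)"
    using \<open>positively_oriented_contour (c 2)\<close> by (auto simp: positively_oriented_contour_def)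
  have c1: "c 1 t = exp (2 * of_real pi * \<i> * of_real t)" for t
    using \<open>c 1 = circlepath 0 1\<close> by (simp add: circlepath)
  have L1: "\<exists>L. L-lipschitz_on {0..1} (c 1)"
    unfolding \<open>c 1 = circlepath 0 1\<close> using circlepath_lipschitz by blast
  have circle: "norm (c 1 t) = 1" for t
    unfolding c1 by (simp add: norm_exp_eq_Re)
  have "\<exists>r>1. \<forall>t\<in>{0..1}. r \<le> norm (c 2 t)"
  proof -
    have "continuous_on {0..1} (\<lambda>t. norm (c 2 t))"
      by (intro continuous_intros lipschitz_on_continuous_on[OF L2])
    then obtain t0 where "t0 \<in> {0..1}" "\<And>t. t \<in> {0..1} \<Longrightarrow> norm (c 2 t0) \<le> norm (c 2 t)"
      using continuous_attains_inf[of "{0..1}" "\<lambda>t. norm (c 2 t)"] by auto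
    moreover have "norm (c 2 t0) > 1"
      using \<open>path_image (c 2) \<subseteq> _\<close> imageI[OF calculation(1), of "c 2"] unfolding path_image_def by blast
    ultimately show ?thesis by blast
  qed
  then obtain r where r: "r > 1" "\<And>t. t \<in> {0..1} \<Longrightarrow> r \<le> norm (c 2 t)" by blast
  obtain a where a: "\<And>n. norm (cluster_coefficient q k \<gamma> n) \<le> (if a \<le> n then (\<Sum>j=0..q. norm (\<gamma> j)) else 0)"
    using cluster_coefficient_bound[OF k] by blast
  interpret circle_and_outer_contour c d g h r "cluster_coefficient q k \<gamma>" "\<Sum>j=0..q. norm (\<gamma> j)" a
  proof
    show "\<exists>L. L-lipschitz_on {0..1} (c j)" if "j \<in> {1, 2}" for j
      using that L1 L2 by blast
    show "g i \<in> L2_on (c 2)" "h i \<in> L2_on (c 1)" if "i \<in> {1..d}" for i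
      using that \<open>\<forall>i\<in>{1..d}. g i \<in> L2_on (c 2)\<close> \<open>\<forall>i\<in>{1..d}. h i \<in> L2_on (c 1)\<close> by blast+
  qed (use circle r a in auto)

  \<comment> \<open>Minors of \<open>- T\<close> are minors of the sequence kernel up to sign.\<close>
  have kernel_T: "kernel_of (\<lambda>\<sigma> n. - T \<sigma> n) = (\<lambda>n n'. - sequence_kernel n n')"
    unfolding T_def \<K>_def G_def by (intro ext) (simp only: kernel_of_cluster_operator sequence_kernel_eq)
  obtain C where C: "C \<ge> 0" "\<And>n n'. norm (sequence_kernel n n') \<le> C * geometric_weight a (1 / r) n"
    using sequence_kernel_bound by blast
  have det_T: "kernel_det (kernel_of (\<lambda>\<sigma> n. - T \<sigma> n)) p = leibniz_det {..<p} (\<lambda>n n'. - sequence_kernel n n')" for p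
    unfolding kernel_T by (rule ext) (rule kernel_det_eq_leibniz_det)
  have neg_bound: "norm (- sequence_kernel n n') \<le> C * geometric_weight a (1 / r) n" for n n'
    using C(2) by simp
  have summable_T: "kernel_det (kernel_of (\<lambda>\<sigma> n. - T \<sigma> n)) p summable_on ({..<p} \<rightarrow>\<^sub>E UNIV)" for p
    unfolding det_T by (rule minor_integral_count_space(1)[OF neg_bound geometric_weight_ratio_integrable])
  have term_T: "fredholm_term_seq (\<lambda>\<sigma> n. - T \<sigma> n) p = 1 / fact p * minor_integral Z {..<p} (\<lambda>n n'. - sequence_kernel n n')" for p
    unfolding fredholm_term_seq_def det_T
    by (subst minor_integral_count_space(2)[OF neg_bound geometric_weight_ratio_integrable]) (rule refl)
  have summable_terms: "fredholm_term_seq (\<lambda>\<sigma> n. - T \<sigma> n) summable_on {1..}"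
  proof -
    \<comment> \<open>Rows decay like \<open>(1 / r) ^ n\<close>; half of this decay is needed for each factor of the bound.\<close>
    define s where "s = sqrt (1 / r)"
    have s: "0 \<le> s" "s < 1" "s\<^sup>2 = 1 / r"
      using r by (simp_all add: s_def)
    have bound: "norm (fredholm_term_seq (\<lambda>\<sigma> n. - T \<sigma> n) p) \<le>
        (C * integral\<^sup>L Z (geometric_weight a s)) ^ p * s ^ \<Sum>{0..<p}" for p
      unfolding term_T by (rule minor_integral_geometric_rows_bound[OF s(1,2) C(1)])
         (unfold s(3), rule neg_bound)
    have "summable (\<lambda>p. (C * integral\<^sup>L Z (geometric_weight a s)) ^ p * s ^ \<Sum>{0..<p})"
      by (intro summable_power_triangular mult_nonneg_nonneg integral_nonneg_AE AE_I2 always_eventually allI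
          s C(1) geometric_weight_nonneg)
    then have "summable (\<lambda>p. norm (fredholm_term_seq (\<lambda>\<sigma> n. - T \<sigma> n) p))"
      by (rule summable_comparison_test'[where N = 0]) (simp only: real_norm_def abs_norm_cancel bound)
    then have "fredholm_term_seq (\<lambda>\<sigma> n. - T \<sigma> n) summable_on UNIV"
      by (rule norm_summable_imp_summable_on)
    then show ?thesis by (rule summable_on_subset_banach) simp
  qed

  have M: "- M (c (fst x) (snd x)) (c (fst y) (snd y)) * velocity (c (fst x)) (snd x) =
      outer_to_circle x y + circle_to_outer x y" if xy: "x \<in> space X" "y \<in> space X" for x y
  proof -
    obtain i s where x: "x = (i, s)" "i = 1 \<or> i = 2" "s \<in> {0..1}"
      using xy by (auto simp: space_contour_parameters)
    obtain j t where y: "y = (j, t)" "j = 1 \<or> j = 2" "t \<in> {0..1}"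
      using xy by (auto simp: space_contour_parameters)
    have ind: "indicator (path_image (c 1)) (c 1 t) = (1 :: complex)" "indicator (path_image (c 2)) (c 1 t) = (0 :: complex)"
      "indicator (path_image (c 1)) (c 2 t) = (0 :: complex)" "indicator (path_image (c 2)) (c 2 t) = (1 :: complex)"
      if t: "t \<in> {0..1}" for t
    proof -
      have in_image: "c 1 t \<in> path_image (c 1)" "c 2 t \<in> path_image (c 2)"
        unfolding path_image_def using t by (rule imageI)+
      have "path_image (c 1) \<inter> path_image (c 2) = {}"
      proof -
        have "norm z = 1" if "z \<in> path_image (c 1)" for z
          using that circle unfolding path_image_def by blast
        then show ?thesis using \<open>path_image (c 2) \<subseteq> _\<close> by force
      qed
      then have "c 1 t \<notin> path_image (c 2)" "c 2 t \<notin> path_image (c 1)"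
        using in_image by blast+
      then show "indicator (path_image (c 1)) (c 1 t) = (1 :: complex)" "indicator (path_image (c 2)) (c 1 t) = (0 :: complex)"
        "indicator (path_image (c 1)) (c 2 t) = (0 :: complex)" "indicator (path_image (c 2)) (c 2 t) = (1 :: complex)"
        using in_image by (simp_all only: indicator_def of_bool_eq)
    qed
    have zero: "circle_to_outer x y = 0" if "\<not> (i = 1 \<and> j = 2)"
      using that x y by (auto simp: kernel_comp_def circle_to_mode_def mode_to_outer_def)
    show ?thesis
    proof (cases "i = 1 \<and> j = 2")
      case True
      have t: "norm (c 1 s) < norm (c 2 t)" "c 1 s \<noteq> 0"
      proof -
        show "norm (c 1 s) < norm (c 2 t)"
          unfolding circle[OF x(3)] using r outer[OF y(3)] by (rule less_le_trans)
        show "c 1 s \<noteq> 0"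
          using circle[OF x(3)] by (metis norm_zero zero_neq_one)
      qed
      define v u where "v = c 1 s" and "u = c 2 t"
      define S where "S = (\<Sum>j=0..q. \<gamma> j * (ext_powi (v / u) (k (2 * j + 1)) - ext_powi (v / u) (1 + k (2 * j))))"
      define w where "w = velocity (c 1) s / (2 * of_real pi * \<i>)"
      have sum: "((\<lambda>n. w * (cluster_coefficient q k \<gamma> n * (v powi n * u powi (- n - 1)))) has_sum w * (S / (u - v))) UNIV"
        unfolding S_def v_def u_def by (rule has_sum_cmult_right[OF cluster_coefficient_has_sum[OF k t(2,1)]])
      have "integrable Z (\<lambda>n. circle_to_mode x n * mode_to_outer n y)"
        by (rule circle_to_outer_integrable[OF xy])
      also have eq: "(\<lambda>n. circle_to_mode x n * mode_to_outer n y) =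
          (\<lambda>n. w * (cluster_coefficient q k \<gamma> n * (v powi n * u powi (- n - 1))))"
      proof
        fix n
        have "circle_to_mode x n = w * v powi n" "mode_to_outer n y = cluster_coefficient q k \<gamma> n * u powi (- n - 1)"
          using True x(1) y(1) by (simp_all add: circle_to_mode_def mode_to_outer_def w_def v_def u_def)
        then show "circle_to_mode x n * mode_to_outer n y =
            w * (cluster_coefficient q k \<gamma> n * (v powi n * u powi (- n - 1)))"
          by (simp only: mult_ac)
      qed
      finally have "Infinite_Set_Sum.abs_summable_on (\<lambda>n. w * (cluster_coefficient q k \<gamma> n * (v powi n * u powi (- n - 1)))) UNIV"
        by (simp add: Infinite_Set_Sum.abs_summable_on_def)
      then have "infsetsum (\<lambda>n. w * (cluster_coefficient q k \<gamma> n * (v powi n * u powi (- n - 1)))) UNIV = w * (S / (u - v))"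
        using infsumI[OF sum] by (simp only: infsetsum_infsum)
      then have 1: "circle_to_outer x y = w * (S / (u - v))"
        unfolding kernel_comp_def eq infsetsum_def .
      have 2: "outer_to_circle x y = 0"
        using True x by (simp add: outer_to_circle_def)
      have M: "M v u = S / (2 * of_real pi * \<i> * (v - u))"
        unfolding M_def M_kernel_def v_def u_def ind[OF x(3)] ind[OF y(3)] S_def
        by (simp only: mult_1_left mult_zero_left diff_zero)
      \<comment> \<open>The denominators of \<open>M\<close> and of the geometric sum have opposite signs.\<close>
      have "- (S / (2 * of_real pi * \<i> * - D)) * velocity (c 1) s = w * (S / D)" for D
        by (simp add: w_def)
      from this[of "u - v"] have 3: "- M v u * velocity (c 1) s = w * (S / (u - v))"
        unfolding M minus_diff_eq .
      have "c (fst x) (snd x) = v" "c (fst y) (snd y) = u" "velocity (c (fst x)) (snd x) = velocity (c 1) s"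
        using True x(1) y(1) by (simp_all add: v_def u_def)
      then show ?thesis unfolding 1 2 by (simp only: 3 add_0_left)
    next
      case False
      then consider "i = j" "i = 1" | "i = j" "i = 2" | "i = 2" "j = 1"
        using x(2) y(2) by blast
      then have "- M (c i s) (c j t) * velocity (c i) s = outer_to_circle (i, s) (j, t)"
      proof cases
        case 1
        then show ?thesis
          unfolding M_def M_kernel_def using ind[OF x(3)] ind[OF y(3)] by (simp add: outer_to_circle_def)
      next
        case 2
        then show ?thesis
          unfolding M_def M_kernel_def using ind[OF x(3)] ind[OF y(3)] by (simp add: outer_to_circle_def)
      next
        case 3
        then show ?thesis
          unfolding M_def M_kernel_def using ind[OF x(3)] ind[OF y(3)]
          by (simp add: outer_to_circle_def G_def)
      qed
      then show ?thesis
        unfolding zero[OF False] unfolding x(1) y(1) fst_conv snd_conv add_0_right .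
    qed
  qed
  have power: "contour_power {1, 2} p = PiM {..<p} (\<lambda>_. X)" for p
    by (simp add: contour_power_def)
  have det_M: "kernel_det_form c (\<lambda>z z'. - M z z') p x =
      leibniz_det {..<p} (\<lambda>x y. outer_to_circle x y + circle_to_outer x y) x"
    if x: "x \<in> space (PiM {..<p} (\<lambda>_. X))" for p x
    unfolding kernel_det_form_def kernel_det_eq_leibniz_det leibniz_det_def sum_distrib_right mult.assoc
      prod.distrib[symmetric]
  proof (intro sum.cong refl arg_cong2[where f = "(*)"] prod.cong)
    fix \<sigma> i assume "\<sigma> \<in> {\<sigma>. \<sigma> permutes {..<p}}" "i \<in> {..<p}"
    then have "x i \<in> space X" "x (\<sigma> i) \<in> space X"
      using x permutes_in_image[of \<sigma> "{..<p}" i] by (auto simp: space_PiM PiE_iff)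
    then show "- M (c (fst (x i)) (snd (x i))) (c (fst (x (\<sigma> i))) (snd (x (\<sigma> i)))) * velocity (c (fst (x i))) (snd (x i)) =
        outer_to_circle (x i) (x (\<sigma> i)) + circle_to_outer (x i) (x (\<sigma> i))"
      by (rule M)
  qed
  have integrable_M: "integrable (contour_power {1, 2} p) (kernel_det_form c (\<lambda>z z'. - M z z') p)" for p
    unfolding power
    by (rule Bochner_Integration.integrable_cong[OF refl det_M, THEN iffD2, OF _ contour_minors_integrable])
  have term_M: "fredholm_term_contours c {1, 2} (\<lambda>z z'. - M z z') p =
      (if even p then fredholm_term_seq (\<lambda>\<sigma> n. - T \<sigma> n) (p div 2) else 0)" for p
  proof -
    have "fredholm_term_contours c {1, 2} (\<lambda>z z'. - M z z') p =
        1 / fact p * minor_integral X {..<p} (\<lambda>x y. outer_to_circle x y + circle_to_outer x y)"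
      unfolding fredholm_term_contours_def minor_integral_def power
      by (subst Bochner_Integration.integral_cong[OF refl det_M]) simp_all
    also have "\<dots> = (if even p then fredholm_term_seq (\<lambda>\<sigma> n. - T \<sigma> n) (p div 2) else 0)"
      unfolding minor_integral_contours term_T
      by (simp add: minor_integral_def leibniz_det_uminus)
    finally show ?thesis .
  qed

  have term_even: "fredholm_term_contours c {1, 2} (\<lambda>z z'. - M z z') (2 * m) = fredholm_term_seq (\<lambda>\<sigma> n. - T \<sigma> n) m" for m
    unfolding term_M by simp
  \<comment> \<open>The terms of even order \<open>2 m\<close> on the contours are the terms of order \<open>m\<close> on the sequences.\<close>
  define s where "s = (\<Sum>\<^sub>\<infinity>p\<in>{1..}. fredholm_term_seq (\<lambda>\<sigma> n. - T \<sigma> n) p)"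
  have "(fredholm_term_seq (\<lambda>\<sigma> n. - T \<sigma> n) has_sum s) {1..}"
    unfolding s_def using summable_terms by (rule has_sum_infsum)
  then have "((fredholm_term_contours c {1, 2} (\<lambda>z z'. - M z z') \<circ> (\<lambda>m. 2 * m)) has_sum s) {1..}"
    by (simp only: o_def term_even)
  then have "(fredholm_term_contours c {1, 2} (\<lambda>z z'. - M z z') has_sum s) ((\<lambda>m. 2 * m) ` {1..})"
    by (subst has_sum_reindex) (auto intro: inj_onI)
  then have sum_M: "(fredholm_term_contours c {1, 2} (\<lambda>z z'. - M z z') has_sum s) {1..}"
  proof (rule has_sum_cong_neutral[THEN iffD1, rotated -1])
    fix p :: nat assume p: "p \<in> {1..} - (\<lambda>m. 2 * m) ` {1..}"
    have "odd p"
    proof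
      assume "even p"
      then obtain m where "p = 2 * m" by blast
      then show False using p by auto
    qed
    then show "fredholm_term_contours c {1, 2} (\<lambda>z z'. - M z z') p = 0"
      unfolding term_M by (rule if_not_P)
  qed auto
  show ?thesis
    unfolding fredholm_converges_seq_def fredholm_converges_contours_def fredholm_det_seq_def fredholm_det_contours_def
    using summable_T summable_terms integrable_M sum_M infsumI[OF sum_M] has_sum_imp_summable[OF sum_M]
    by (simp add: s_def)
qed

end
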